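(* Let $n,m\ge1$, $\mu>0$, $\nu>-1$, $D_{n,m}(\mu)=\{(z,w)\in\mathbb{C}^n\times\mathbb{C}^m:\|w\|^2<e^{-\mu\|z\|^2}\}$, $\Phi(z,w)=\nu\mu\|z\|^2-\ln\left(e^{-\mu\|z\|^2}-\|w\|^2\right)$ and $\omega(\mu;\nu)=\frac{\sqrt{-1}}{2\pi}\partial\bar\partial\Phi$. For $\alpha>m+n$, the Bergman (reproducing) kernel of the weighted Hilbert space $$\mathcal{H}_\alpha=\left\{f\in\mathrm{Hol}(D_{n,m}(\mu)):\int_{D_{n,m}(\mu)}|f|^2e^{-\alpha\Phi}\frac{\omega(\mu;\nu)^{m+n}}{(n+m)!}<\infty\right\}$$ is given on the diagonal by $$K_\alpha(z,w,\bar z,\bar w)=(\alpha-m-n)_{m+n}\,e^{\mu(\nu+1)\alpha\|z\|^2}\sum_{q\in\mathbb{N}^m}\psi(\alpha,|q|)\frac{\Gamma(|q|+\alpha)}{\Gamma(\alpha)\prod_{i=1}^m\Gamma(q_i+1)}\tilde w^q\overline{\tilde w^q},$$ where $\tilde w=e^{\frac{\mu}{2}\|z\|^2}w$, $(\alpha)_k=\frac{\Gamma(\alpha+k)}{\Gamma(\alpha)}$, $\psi(\alpha,|q|)=\frac{\Gamma(\alpha-m-n)\chi(\alpha,|q|)}{\Gamma(\alpha+|q|)}$ and $$\chi(\alpha,|q|)=\frac{[(\nu+1)\alpha+|q|]^n}{\sum_{d=0}^n\binom{n}{d}\nu^{n-d}\frac{\Gamma(\alpha-m-d)}{\Gamm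a(\alpha-d+|q|)}}.$$
   Context: $\mathbb{N}$ includes $0$; for $q\in\mathbb{N}^m$, $|q|=\sum q_i$ and $\tilde w^q=\prod_j\tilde w_j^{q_j}$; $\mathrm{Hol}$ denotes holomorphic functions; $\|\cdot\|$ is the standard Hermitian norm; $\nu^0=1$. *)

theory Defs
  imports "HOL-Analysis.Analysis"
begin

definition zpart :: "complex^('n::finite + 'm::finite) \<Rightarrow> complex^'n" where
  "zpart p = (\<chi> i. p $ Inl i)"

definition wpart :: "complex^('n::finite + 'm::finite) \<Rightarrow> complex^'m" where
  "wpart p = (\<chi> j. p $ Inr j)"

definition holo_on :: "(complex^'N::finite) set \<Rightarrow> (complex^'N \<Rightarrow> complex) \<Rightarrow> bool" where
  "holo_on S f \<longleftrightarrow> (\<forall>p\<in>S. \<exists>L. (f has_derivative L) (at p) \<and> (\<forall>c v. L (c *s v) = c * L v))"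

definition dirD :: "'a::real_normed_vector \<Rightarrow> ('a \<Rightarrow> real) \<Rightarrow> 'a \<Rightarrow> real" where
  "dirD v F p = deriv (\<lambda>t::real. F (p + t *\<^sub>R v)) 0"

text \<open>Complex Hessian (Levi form) entries  d^2 F / (d zeta_j d conj(zeta_k)),
  written via real partial derivatives: (1/4)(dxj dxk + dyj dyk + i(dxj dyk - dyj dxk)).\<close>
definition levi :: "(complex^'N::finite \<Rightarrow> real) \<Rightarrow> complex^'N \<Rightarrow> 'N \<Rightarrow> 'N \<Rightarrow> complex" where
  "levi F p j k =
     (1/4) * Complex
       (dirD (axis j 1) (dirD (axis k 1) F) p + dirD (axis j \<i>) (dirD (axis k \<i>) F) p)
       (dirD (axis j 1) (dirD (axis k \<i>) F) p - dirD (axis j \<i>) (dirD (axis k 1) F) p)"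

text \<open>Density of omega^N/N! with omega = (i/(2 pi)) ddbar F, w.r.t. Lebesgue measure on C^N = R^(2N):
  omega^N/N! = det(F_{j kbar}) / pi^N  dLeb.\<close>
definition vol_density :: "(complex^'N::finite \<Rightarrow> real) \<Rightarrow> complex^'N \<Rightarrow> real" where
  "vol_density F p = Re (det (\<chi> j. \<chi> k. levi F p j k)) / pi ^ CARD('N)"

definition Dom :: "real \<Rightarrow> (complex^('n::finite + 'm::finite)) set" where
  "Dom \<mu> = {p. norm (wpart p) ^ 2 < exp (- \<mu> * norm (zpart p) ^ 2)}"

definition Phi :: "real \<Rightarrow> real \<Rightarrow> complex^('n::finite + 'm::finite) \<Rightarrow> real" where
  "Phi \<mu> \<nu> p = \<nu> * \<mu> * norm (zpart p) ^ 2 - ln (exp (- \<mu> * norm (zpart p) ^ 2) - norm (wpart p) ^ 2)"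

definition weight :: "real \<Rightarrow> real \<Rightarrow> real \<Rightarrow> complex^('n::finite + 'm::finite) \<Rightarrow> real" where
  "weight \<mu> \<nu> \<alpha> p = exp (- \<alpha> * Phi \<mu> \<nu> p) * vol_density (Phi \<mu> \<nu>) p"

definition inH :: "real \<Rightarrow> real \<Rightarrow> real \<Rightarrow> (complex^('n::finite + 'm::finite) \<Rightarrow> complex) \<Rightarrow> bool" where
  "inH \<mu> \<nu> \<alpha> f \<longleftrightarrow> holo_on (Dom \<mu>) f \<and>
     (\<integral>\<^sup>+ p. indicator (Dom \<mu>) p * ennreal ((cmod (f p))\<^sup>2 * weight \<mu> \<nu> \<alpha> p) \<partial>lebesgue) < \<infinity>"

definition is_bergman_kernel ::
  "real \<Rightarrow> real \<Rightarrow> real \<Rightarrow> (complex^('n::finite + 'm::finite) \<Rightarrow> complex^('n + 'm) \<Rightarrow> complex) \<Rightarrow> bool" where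
  "is_bergman_kernel \<mu> \<nu> \<alpha> K \<longleftrightarrow>
     (\<forall>q\<in>Dom \<mu>. inH \<mu> \<nu> \<alpha> (\<lambda>p. K p q) \<and>
        (\<forall>f. inH \<mu> \<nu> \<alpha> f \<longrightarrow>
           f q = set_lebesgue_integral lebesgue (Dom \<mu>) (\<lambda>p. weight \<mu> \<nu> \<alpha> p *\<^sub>R (f p * cnj (K p q)))))"

definition chi :: "nat \<Rightarrow> nat \<Rightarrow> real \<Rightarrow> real \<Rightarrow> nat \<Rightarrow> real" where
  "chi n m \<nu> \<alpha> k = ((\<nu> + 1) * \<alpha> + real k) ^ n /
     (\<Sum>d=0..n. real (n choose d) * \<nu> ^ (n - d) * Gamma (\<alpha> - real m - real d) / Gamma (\<alpha> - real d + real k))"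

definition psi :: "nat \<Rightarrow> nat \<Rightarrow> real \<Rightarrow> real \<Rightarrow> nat \<Rightarrow> real" where
  "psi n m \<nu> \<alpha> k = Gamma (\<alpha> - real m - real n) * chi n m \<nu> \<alpha> k / Gamma (\<alpha> + real k)"

end

theory Submission
  imports Defs "HOL-Complex_Analysis.Cauchy_Integral_Formula"
begin

text \<open>
  The domain is a complete Reinhardt domain and the weight only depends on the moduli of the
  coordinates, so rotating one coordinate shows that the monomials are pairwise orthogonal. A
  holomorphic function on the domain is the sum of one global power series (Cauchy's formula on a
  torus, expanded into geometric series), and its coefficients are recovered as inner products with
  the monomials. Hence the kernel is the sum of the terms \<open>mon p a * cnj (mon q a) / N a\<close> with
  \<open>N a\<close> the squared norm of the monomial.

  With \<open>E = exp (- \<mu> * norm z ^ 2) - norm w ^ 2\<close> the Levi determinant of \<open>Phi\<close> is computed by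
  passing to the coframe \<open>dz\<close>, \<open>dw + \<mu> w (cnj z dz)\<close>, in which the Levi form is
  diagonal plus a matrix of rank one. Expanding the \<open>n\<close>-th power in the volume density by the
  binomial theorem turns \<open>N a\<close> into a sum of products of Dirichlet integrals over \<open>w\<close>
  and Gaussian integrals over \<open>z\<close>; summing the kernel over the exponents of \<open>z\<close> gives an
  exponential.
\<close>

section \<open>Moments of monomials on Hartogs domains\<close>

text \<open>The form of \<open>chi\<close> has one source. After the integration over
  \<open>w\<close>, every binomial term leaves a Gaussian in \<open>z\<close> of the same rate
  \<open>\<mu> * ((\<nu> + 1) * \<alpha> + k)\<close>, where \<open>k\<close> is the degree in
  \<open>w\<close>: each extra power of \<open>exp (- \<mu> * norm z ^ 2)\<close> coming from the
  volume density is paid for by one power less from the \<open>w\<close> integral. So the rate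
  factors out of the binomial sum, its \<open>n\<close>-th power becomes the numerator of
  \<open>chi\<close>, and only Gamma quotients are left to be summed. The bound on
  \<open>\<alpha>\<close> is the convergence of the \<open>w\<close> integral in the worst term
  \<open>d = n\<close>, where \<open>E\<close> carries the exponent
  \<open>\<alpha> - m - n - 1\<close>. Two obstacles shape the analysis. For negative
  \<open>\<nu>\<close> the binomial terms change sign, so moments are computed term by term and
  positivity of the weight is taken from the unexpanded density. A power series on the domain
  converges absolutely at each point but without a uniform bound there, so termwise integration
  needs rotation-invariant cut-offs.\<close>

lemma borel_measurable_vec_lambda:
  "vec_lambda \<in> (\<Pi>\<^sub>M i\<in>UNIV. (borel :: 'a::euclidean_space measure)) \<rightarrow>\<^sub>M (borel :: ('a^'n) measure)"
proof (subst borel_measurable_euclidean_space, intro ballI)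
  fix b :: "'a^'n" assume "b \<in> Basis"
  then obtain i u where b: "b = axis i u" by (auto simp: Basis_vec_def)
  show "(\<lambda>x. vec_lambda x \<bullet> b) \<in> borel_measurable (\<Pi>\<^sub>M i\<in>UNIV. (borel :: 'a measure))"
    unfolding b inner_axis by simp
qed

text \<open>The preimage of a box is a product set, so the product measure splits into
  one-coordinate measures. Allowing any measure-preserving \<open>T i\<close> serves two ends: the
  identity exhibits \<open>lborel\<close> on vectors as a product measure, and rotations of single
  coordinates give the symmetry behind orthogonality.\<close>

lemma emeasure_lborel_coordinatewise:
  fixes T :: "'n::finite \<Rightarrow> 'a \<Rightarrow> 'a::euclidean_space" and l u :: "'a^'n"
  assumes T: "\<And>i. T i \<in> borel_measurable borel" "\<And>i. distr lborel borel (T i) = lborel"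
    and lu: "\<And>b. b \<in> Basis \<Longrightarrow> l \<bullet> b \<le> u \<bullet> b"
  shows "emeasure (distr (\<Pi>\<^sub>M i\<in>UNIV. lborel) borel (\<lambda>f. \<chi> i. T i (f i))) (box l u)
    = (\<Prod>b\<in>Basis. (u - l) \<bullet> b)"
proof -
  interpret product_sigma_finite "\<lambda>_::'n. lborel :: 'a measure" ..
  have lu': "l $ i \<bullet> b \<le> u $ i \<bullet> b" if "b \<in> Basis" for i b
    using lu[of "axis i b"] that by (auto simp: Basis_vec_def inner_axis)
  have [measurable]: "(\<lambda>f. \<chi> i. T i (f i)) \<in> (\<Pi>\<^sub>M i\<in>UNIV. (lborel :: 'a measure)) \<rightarrow>\<^sub>M (borel :: ('a^'n) measure)"
    by (rule measurable_compose[OF _ borel_measurable_vec_lambda])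
       (rule measurable_PiM_single', use T in auto)
  have vimage: "(\<lambda>f. \<chi> i. T i (f i)) -` box l u = (\<Pi>\<^sub>E i\<in>UNIV. T i -` box (l$i) (u$i))"
    by (auto simp: mem_box Basis_vec_def inner_axis PiE_def Pi_def)
  have "emeasure (distr (\<Pi>\<^sub>M i\<in>UNIV. lborel) borel (\<lambda>f. \<chi> i. T i (f i))) (box l u)
    = emeasure (\<Pi>\<^sub>M i\<in>UNIV. lborel) (\<Pi>\<^sub>E i\<in>UNIV. T i -` box (l$i) (u$i))"
    by (subst emeasure_distr) (auto simp: vimage space_PiM)
  also have "\<dots> = (\<Prod>i\<in>UNIV. emeasure lborel (T i -` box (l$i) (u$i)))"
    using T by (intro emeasure_PiM) (auto intro!: measurable_sets_borel)
  also have "\<dots> = (\<Prod>i\<in>UNIV. emeasure (distr lborel borel (T i)) (box (l$i) (u$i)))"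
    by (intro prod.cong refl, subst emeasure_distr) (use T(1) in auto)
  also have "\<dots> = (\<Prod>i\<in>UNIV. ennreal (\<Prod>b\<in>Basis. (u$i - l$i) \<bullet> b))"
    using lu' by (simp add: T(2) emeasure_lborel_box)
  also have "\<dots> = ennreal (\<Prod>i\<in>UNIV. \<Prod>b\<in>Basis. (u$i - l$i) \<bullet> b)"
    by (rule prod_ennreal) (auto intro!: prod_nonneg simp: inner_diff_left lu')
  also have "(\<Prod>i\<in>UNIV. \<Prod>b\<in>Basis. (u$i - l$i) \<bullet> b) = (\<Prod>(i,b)\<in>UNIV\<times>Basis. (u - l) \<bullet> axis i b)"
    by (subst prod.cartesian_product[symmetric]) (simp add: inner_axis)
  also have "\<dots> = (\<Prod>b\<in>Basis. (u - l) \<bullet> b)"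
  proof (subst case_prod_unfold, rule prod.reindex_bij_betw[where h="\<lambda>x. axis (fst x) (snd x)"])
    show "bij_betw (\<lambda>x. axis (fst x) (snd x)) (UNIV \<times> Basis) (Basis :: ('a^'n) set)"
      unfolding bij_betw_def inj_on_def by (fastforce simp: Basis_vec_def axis_eq_axis image_iff)
  qed
  finally show ?thesis .
qed

lemma lborel_vec_eq:
  "(lborel :: ('a::euclidean_space^'n::finite) measure) = distr (\<Pi>\<^sub>M i\<in>UNIV. lborel) borel vec_lambda"
  using emeasure_lborel_coordinatewise[of "\<lambda>_::'n. \<lambda>x::'a. x"]
  by (intro lborel_eqI) (simp_all add: distr_id2)

lemma lborel_distr_coordinatewise:
  fixes T :: "'n::finite \<Rightarrow> 'a \<Rightarrow> 'a::euclidean_space"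
  assumes T: "\<And>i. T i \<in> borel_measurable borel" "\<And>i. distr lborel borel (T i) = lborel"
  shows "distr lborel borel (\<lambda>p. \<chi> i. T i (p $ i)) = lborel"
proof -
  have nth: "(\<lambda>p. p $ i) \<in> borel_measurable (borel :: ('a^'n) measure)" for i
    by (intro borel_measurable_continuous_onI continuous_intros)
  have 1: "(\<lambda>p. \<chi> i. T i (p $ i)) \<in> borel_measurable (borel :: ('a^'n) measure)"
    by (rule measurable_compose[OF _ borel_measurable_vec_lambda])
       (rule measurable_PiM_single', auto intro: measurable_compose[OF nth T(1)])
  have 2: "vec_lambda \<in> (\<Pi>\<^sub>M i\<in>UNIV. (lborel :: 'a measure)) \<rightarrow>\<^sub>M (borel :: ('a^'n) measure)"
    using borel_measurable_vec_lambda by (simp cong: measurable_cong_sets sets_PiM_cong)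
  have "distr lborel borel (\<lambda>p. \<chi> i. T i (p $ i)) = distr (\<Pi>\<^sub>M i\<in>UNIV. lborel) borel (\<lambda>f. \<chi> i. T i (f i))"
    by (subst lborel_vec_eq, subst distr_distr) (use 1 2 in \<open>auto simp: o_def\<close>)
  also have "\<dots> = lborel"
    by (rule lborel_eqI[symmetric], rule emeasure_lborel_coordinatewise[OF T]) auto
  finally show ?thesis .
qed

text \<open>This replaces polar coordinates. The disc \<open>(cmod z)\<^sup>2 \<le> a\<close> has
  area \<open>pi * a\<close>, so squared modulus carries area to pi times length on the half-line;
  it suffices to compare the two measures on the generating sets \<open>{..a}\<close>.\<close>

lemma nn_integral_complex_norm_sq:
  assumes [measurable]: "g \<in> borel_measurable borel"
  shows "(\<integral>\<^sup>+z. g ((cmod z)\<^sup>2) \<partial>lborel) = ennreal pi * (\<integral>\<^sup>+t. g t * indicator {0..} t \<partial>lborel)"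
proof -
  have "distr lborel borel (\<lambda>z. (cmod z)\<^sup>2) = density lborel (\<lambda>t. ennreal pi * indicator {0..} t)" (is "?M = ?N")
  proof (rule measure_eqI_generator_eq)
    let ?E = "range (\<lambda>a::real. {..a})"
    show "Int_stable ?E" by (auto simp: Int_stable_def)
    show "?E \<subseteq> Pow UNIV" "sets ?M = sigma_sets UNIV ?E" "sets ?N = sigma_sets UNIV ?E"
      by (simp_all add: borel_eq_atMost)
    show "range (\<lambda>n. {..real n}) \<subseteq> ?E" "(\<Union>n. {..real n}) = UNIV"
      by (auto simp: real_arch_simple)
    have M: "emeasure ?M {..a} = (if a \<ge> 0 then ennreal (pi * a) else 0)" for a
    proof -
      have "emeasure ?M {..a} = emeasure lborel {z. (cmod z)\<^sup>2 \<le> a}"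
        by (subst emeasure_distr) (auto simp: vimage_def)
      also have "{z. (cmod z)\<^sup>2 \<le> a} = (if a \<ge> 0 then cball 0 (sqrt a) else {})"
        by (auto simp: real_le_rsqrt real_sqrt_le_iff dest: order_trans[OF zero_le_power2]
            intro: sqrt_ge_absD real_le_rsqrt)
      finally show ?thesis
        by (simp add: emeasure_cball unit_ball_vol_2)
    qed
    show "emeasure ?M {..real i} \<noteq> \<infinity>" for i by (simp add: M)
    fix X assume "X \<in> ?E"
    then obtain a where X: "X = {..a}" by auto
    have "emeasure ?N X = ennreal pi * emeasure lborel {0..a}"
      by (subst X, subst emeasure_density)
         (auto simp: nn_integral_cmult mult.assoc simp flip: nn_integral_indicator
           intro!: arg_cong[where f="\<lambda>x. ennreal pi * x"] nn_integral_cong split: split_indicator)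
    also have "\<dots> = emeasure ?M X" by (simp add: X M ennreal_mult)
    finally show "emeasure ?M X = emeasure ?N X" by simp
  qed
  then have "(\<integral>\<^sup>+t. g t \<partial>?M) = (\<integral>\<^sup>+t. g t \<partial>?N)" by simp
  then show ?thesis
    by (simp add: nn_integral_distr nn_integral_density nn_integral_cmult[symmetric] mult_ac)
qed

lemma nn_integral_Beta_scaled:
  fixes b R :: real
  assumes "a > 0" "b > 0" "R > 0"
  shows "(\<integral>\<^sup>+t. ennreal (t powr (a - 1) * (R - t) powr (b - 1)) * indicator {0..<R} t \<partial>lborel)
    = ennreal (Beta a b * R powr (a + b - 1))"
proof -
  let ?f = "\<lambda>t. t powr (a - 1) * (1 - t) powr (b - 1)"
  have ne: "AE t in lborel. t \<noteq> R" by (simp add: AE_lborel_singleton)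
  have "(\<integral>\<^sup>+t. ennreal (t powr (a - 1) * (R - t) powr (b - 1)) * indicator {0..<R} t \<partial>lborel)
      = (\<integral>\<^sup>+t. ennreal (t powr (a - 1) * (R - t) powr (b - 1)) * indicator {0..R} t \<partial>lborel)"
  proof (rule nn_integral_cong_AE)
    show "AE t in lborel. ennreal (t powr (a - 1) * (R - t) powr (b - 1)) * indicator {0..<R} t
       = ennreal (t powr (a - 1) * (R - t) powr (b - 1)) * indicator {0..R} t"
      using ne by eventually_elim (auto split: split_indicator)
  qed
  also have "\<dots> = ennreal R * (\<integral>\<^sup>+t. ennreal ((R * t) powr (a - 1) * (R - R * t) powr (b - 1)) * indicator {0..R} (R * t) \<partial>lborel)"
    using assms by (subst nn_integral_real_affine[where c=R and t=0]) auto
  also have "(\<lambda>t. ennreal ((R * t) powr (a - 1) * (R - R * t) powr (b - 1)) * indicator {0..R} (R * t))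
      = (\<lambda>t. ennreal (R powr (a + b - 2)) * (ennreal (?f t) * indicator {0..1} t))"
  proof
    fix t :: real
    have "(R * t) powr (a - 1) * (R - R * t) powr (b - 1) = R powr (a + b - 2) * ?f t" if "0 \<le> t" "t \<le> 1"
    proof -
      have 1: "R - R * t = R * (1 - t)" by (simp add: algebra_simps)
      have 2: "R powr (a + b - 2) = R powr (a - 1) * R powr (b - 1)"
        by (simp flip: powr_add; simp add: algebra_simps)
      show ?thesis unfolding 1 2 using that assms by (simp add: powr_mult)
    qed
    then show "ennreal ((R * t) powr (a - 1) * (R - R * t) powr (b - 1)) * indicator {0..R} (R * t)
      = ennreal (R powr (a + b - 2)) * (ennreal (?f t) * indicator {0..1} t)"
      using assms by (auto split: split_indicator simp: zero_le_mult_iff simp flip: ennreal_mult')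
  qed
  also have "(\<integral>\<^sup>+t. ennreal (R powr (a + b - 2)) * (ennreal (?f t) * indicator {0..1} t) \<partial>lborel)
      = ennreal (R powr (a + b - 2)) * ennreal (Beta a b)"
    using nn_integral_has_integral_lebesgue'[OF _ has_integral_Beta_real[OF assms(1,2)]]
    by (subst nn_integral_cmult) auto
  also have "ennreal R * (ennreal (R powr (a + b - 2)) * ennreal (Beta a b)) = ennreal (Beta a b * (R powr 1 * R powr (a + b - 2)))"
    using assms by (simp add: ennreal_mult' Beta_def Gamma_real_pos mult_ac flip: ennreal_mult')
  also have "R powr 1 * R powr (a + b - 2) = R powr (a + b - 1)"
    by (subst powr_add[symmetric]) (simp add: algebra_simps)
  finally show ?thesis .
qed

text \<open>In the variable \<open>(cmod z)\<^sup>2\<close> this is a Beta integral. Nonpositive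
  \<open>R\<close> is included because in \<open>nn_integral_Dirichlet\<close> its place is taken by
  what the other coordinates leave of the squared radius.\<close>

lemma nn_integral_disc_moment:
  fixes \<beta> R :: real
  assumes "\<beta> > 0"
  shows "(\<integral>\<^sup>+z. ennreal (((cmod z)\<^sup>2) ^ b * (R - (cmod z)\<^sup>2) powr (\<beta> - 1)) * indicator {z. (cmod z)\<^sup>2 < R} z \<partial>lborel)
    = (if R > 0 then ennreal (pi * fact b * Gamma \<beta> / Gamma (\<beta> + b + 1) * R powr (\<beta> + b)) else 0)"
proof (cases "R > 0")
  case False
  have "\<not> (cmod z)\<^sup>2 < R" for z using False zero_le_power2[of "cmod z"] by linarith
  then show ?thesis using False by simp
next
  case True
  have "(\<integral>\<^sup>+z. ennreal (((cmod z)\<^sup>2) ^ b * (R - (cmod z)\<^sup>2) powr (\<beta> - 1)) * indicator {z. (cmod z)\<^sup>2 < R} z \<partial>lborel)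
     = ennreal pi * (\<integral>\<^sup>+t. ennreal (t ^ b * (R - t) powr (\<beta> - 1)) * indicator {..<R} t * indicator {0..} t \<partial>lborel)"
    by (subst nn_integral_complex_norm_sq[symmetric]) (auto intro!: nn_integral_cong split: split_indicator)
  also have "(\<integral>\<^sup>+t. ennreal (t ^ b * (R - t) powr (\<beta> - 1)) * indicator {..<R} t * indicator {0..} t \<partial>lborel)
     = (\<integral>\<^sup>+t. ennreal (t powr (real (b + 1) - 1) * (R - t) powr (\<beta> - 1)) * indicator {0..<R} t \<partial>lborel)"
  proof (rule nn_integral_cong_AE)
    \<comment> \<open>At \<open>t = 0\<close> with \<open>b = 0\<close> the two sides differ, since
      \<open>0 ^ 0 = 1\<close> while \<open>0 powr 0 = 0\<close>.\<close>
    have "AE t in lborel. t \<noteq> (0::real)" by (simp add: AE_lborel_singleton)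
    then show "AE t in lborel. ennreal (t ^ b * (R - t) powr (\<beta> - 1)) * indicator {..<R} t * indicator {0..} t
       = ennreal (t powr (real (b + 1) - 1) * (R - t) powr (\<beta> - 1)) * indicator {0..<R} t"
      by eventually_elim (auto split: split_indicator simp: powr_realpow)
  qed
  also have "\<dots> = ennreal (Beta (real (b + 1)) \<beta> * R powr (real (b + 1) + \<beta> - 1))"
    using assms True by (intro nn_integral_Beta_scaled) auto
  also have "ennreal pi * \<dots> = ennreal (pi * fact b * Gamma \<beta> / Gamma (\<beta> + b + 1) * R powr (\<beta> + b))"
    by (simp add: Beta_def Gamma_fact[symmetric] ac_simps flip: ennreal_mult')
  finally show ?thesis using True by simp
qed

lemma nn_integral_gaussian_moment:
  fixes c :: real
  assumes "c > 0"
  shows "(\<integral>\<^sup>+z. ennreal (((cmod z)\<^sup>2) ^ a * exp (- c * (cmod z)\<^sup>2)) \<partial>lborel)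
    = ennreal (pi * fact a / c ^ (a + 1))"
proof -
  have "(\<integral>\<^sup>+z. ennreal (((cmod z)\<^sup>2) ^ a * exp (- c * (cmod z)\<^sup>2)) \<partial>lborel)
     = ennreal pi * (\<integral>\<^sup>+t. ennreal (t ^ a * exp (- c * t)) * indicator {0..} t \<partial>lborel)"
    by (subst nn_integral_complex_norm_sq[symmetric]) auto
  also have "(\<integral>\<^sup>+t. ennreal (t ^ a * exp (- c * t)) * indicator {0..} t \<partial>lborel)
      = ennreal (1 / c) * (\<integral>\<^sup>+t. ennreal ((t / c) ^ a * exp (- t)) * indicator {0..} (t / c) \<partial>lborel)"
    using assms by (subst nn_integral_real_affine[where c="1/c" and t=0]) auto
  also have "(\<integral>\<^sup>+t. ennreal ((t / c) ^ a * exp (- t)) * indicator {0..} (t / c) \<partial>lborel)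
      = (\<integral>\<^sup>+t. ennreal (1 / c ^ a) * (ennreal (t powr (real (a + 1) - 1) / exp t) * indicator {0..} t) \<partial>lborel)"
  proof (rule nn_integral_cong_AE)
    have "AE t in lborel. t \<noteq> (0::real)" by (simp add: AE_lborel_singleton)
    then show "AE t in lborel. ennreal ((t / c) ^ a * exp (- t)) * indicator {0..} (t / c)
       = ennreal (1 / c ^ a) * (ennreal (t powr (real (a + 1) - 1) / exp t) * indicator {0..} t)"
      by eventually_elim (use assms in \<open>auto split: split_indicator
        simp: powr_realpow exp_minus divide_simps zero_le_divide_iff simp flip: ennreal_mult'\<close>)
  qed
  also have "\<dots> = ennreal (1 / c ^ a) * ennreal (Gamma (real (a + 1)))"
    using nn_integral_has_integral_lebesgue'[OF _ Gamma_integral_real[of "real (a + 1)"]]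
    by (subst nn_integral_cmult) auto
  finally show ?thesis
    using assms by (simp add: Gamma_fact[symmetric] ac_simps flip: ennreal_mult')
qed

text \<open>Integrating out coordinate \<open>j\<close> by the disc moment leaves an integral of the
  same shape over the remaining ones, with \<open>\<beta>\<close> replaced by
  \<open>\<beta> + b j + 1\<close>. Hence the induction generalises over \<open>\<beta>\<close>,
  keeps \<open>R\<close> fixed, and the Gamma quotients telescope.\<close>

lemma nn_integral_Dirichlet:
  fixes b :: "'i \<Rightarrow> nat" and \<beta> R :: real
  assumes "finite S" "\<beta> > 0" "R > 0"
  shows "(\<integral>\<^sup>+x. ennreal ((\<Prod>i\<in>S. ((cmod (x i))\<^sup>2) ^ b i) * (R - (\<Sum>i\<in>S. (cmod (x i))\<^sup>2)) powr (\<beta> - 1))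
            * indicator {s. s < R} (\<Sum>i\<in>S. (cmod (x i))\<^sup>2) \<partial>(\<Pi>\<^sub>M i\<in>S. (lborel :: complex measure)))
    = ennreal (pi ^ card S * (\<Prod>i\<in>S. fact (b i)) * Gamma \<beta> / Gamma (\<beta> + card S + (\<Sum>i\<in>S. b i))
        * R powr (\<beta> - 1 + card S + (\<Sum>i\<in>S. b i)))"
  using assms(1,2)
proof (induction S arbitrary: \<beta> rule: finite_induct)
  case empty
  interpret product_sigma_finite "\<lambda>_::'i. lborel :: complex measure" ..
  have "Gamma \<beta> > 0" using empty by (simp add: Gamma_real_pos)
  then show ?case using assms(3) by (subst nn_integral_empty; simp)
next
  case (insert j S)
  interpret product_sigma_finite "\<lambda>_::'i. lborel :: complex measure" ..
  let ?M = "\<Pi>\<^sub>M i\<in>S. (lborel :: complex measure)"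
  let ?s = "\<lambda>x. \<Sum>i\<in>S. (cmod (x i))\<^sup>2" and ?m = "\<lambda>x. \<Prod>i\<in>S. ((cmod (x i))\<^sup>2) ^ b i"
  let ?C = "pi * fact (b j) * Gamma \<beta> / Gamma (\<beta> + b j + 1)"
  have C: "?C \<ge> 0" using insert.prems by (auto intro!: divide_nonneg_nonneg mult_nonneg_nonneg Gamma_real_nonneg)
  have "(\<integral>\<^sup>+x. ennreal ((\<Prod>i\<in>insert j S. ((cmod (x i))\<^sup>2) ^ b i) * (R - (\<Sum>i\<in>insert j S. (cmod (x i))\<^sup>2)) powr (\<beta> - 1))
            * indicator {s. s < R} (\<Sum>i\<in>insert j S. (cmod (x i))\<^sup>2) \<partial>(\<Pi>\<^sub>M i\<in>insert j S. (lborel :: complex measure)))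
     = (\<integral>\<^sup>+x. (\<integral>\<^sup>+y. ennreal (?m x) * (ennreal (((cmod y)\<^sup>2) ^ b j * ((R - ?s x) - (cmod y)\<^sup>2) powr (\<beta> - 1))
            * indicator {z. (cmod z)\<^sup>2 < R - ?s x} y) \<partial>lborel) \<partial>?M)"
  proof (subst product_nn_integral_insert[OF insert.hyps(1,2)], measurable, intro nn_integral_cong)
    fix x y
    have 1: "(\<Sum>i\<in>insert j S. (cmod ((x(j := y)) i))\<^sup>2) = ?s x + (cmod y)\<^sup>2"
      using insert.hyps by (simp add: sum.insert_if) (rule sum.cong, auto)
    have 2: "(\<Prod>i\<in>insert j S. ((cmod ((x(j := y)) i))\<^sup>2) ^ b i) = ?m x * ((cmod y)\<^sup>2) ^ b j"
      using insert.hyps by (simp add: prod.insert_if) (rule disjI2, rule prod.cong, auto)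
    show "ennreal ((\<Prod>i\<in>insert j S. ((cmod ((x(j := y)) i))\<^sup>2) ^ b i) * (R - (\<Sum>i\<in>insert j S. (cmod ((x(j := y)) i))\<^sup>2)) powr (\<beta> - 1))
            * indicator {s. s < R} (\<Sum>i\<in>insert j S. (cmod ((x(j := y)) i))\<^sup>2)
        = ennreal (?m x) * (ennreal (((cmod y)\<^sup>2) ^ b j * ((R - ?s x) - (cmod y)\<^sup>2) powr (\<beta> - 1))
            * indicator {z. (cmod z)\<^sup>2 < R - ?s x} y)"
      unfolding 1 2 
      by (auto simp: ennreal_mult' prod_nonneg algebra_simps split: split_indicator simp flip: ennreal_mult')
  qed
  also have "\<dots> = (\<integral>\<^sup>+x. ennreal (?m x) * (if R - ?s x > 0 then ennreal (?C * (R - ?s x) powr (\<beta> + b j)) else 0) \<partial>?M)"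
    by (intro nn_integral_cong, subst nn_integral_cmult, measurable, subst nn_integral_disc_moment[OF insert.prems]) simp
  also have "\<dots> = (\<integral>\<^sup>+x. ennreal ?C * (ennreal (?m x * (R - ?s x) powr ((\<beta> + b j + 1) - 1)) * indicator {s. s < R} (?s x)) \<partial>?M)"
  proof (intro nn_integral_cong)
    fix x
    have aux: "ennreal a * (if R - s > 0 then ennreal (c * (R - s) powr e) else 0)
      = ennreal c * (ennreal (a * (R - s) powr e) * indicator {s. s < R} s)"
      if "a \<ge> 0" "c \<ge> 0" for a c s e :: real
      using that by (auto simp: ennreal_mult' mult_ac split: split_indicator)
    have "?m x \<ge> 0" by (simp add: prod_nonneg)
    then show "ennreal (?m x) * (if R - ?s x > 0 then ennreal (?C * (R - ?s x) powr (\<beta> + b j)) else 0)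
      = ennreal ?C * (ennreal (?m x * (R - ?s x) powr ((\<beta> + b j + 1) - 1)) * indicator {s. s < R} (?s x))"
      using aux[OF _ C] by simp
  qed
  also have "\<dots> = ennreal ?C * ennreal (pi ^ card S * (\<Prod>i\<in>S. fact (b i)) * Gamma (\<beta> + b j + 1) / Gamma (\<beta> + b j + 1 + card S + (\<Sum>i\<in>S. b i))
        * R powr (\<beta> + b j + 1 - 1 + card S + (\<Sum>i\<in>S. b i)))"
    using insert.prems by (subst nn_integral_cmult, measurable, subst insert.IH) auto
  also have "\<dots> = ennreal (?C * (pi ^ card S * (\<Prod>i\<in>S. fact (b i)) * Gamma (\<beta> + b j + 1) / Gamma (\<beta> + b j + 1 + card S + (\<Sum>i\<in>S. b i))
        * R powr (\<beta> + b j + 1 - 1 + card S + (\<Sum>i\<in>S. b i))))"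
    by (rule ennreal_mult'[OF C, symmetric])
  also have "?C * (pi ^ card S * (\<Prod>i\<in>S. fact (b i)) * Gamma (\<beta> + b j + 1) / Gamma (\<beta> + b j + 1 + card S + (\<Sum>i\<in>S. b i))
        * R powr (\<beta> + b j + 1 - 1 + card S + (\<Sum>i\<in>S. b i)))
     = pi ^ card (insert j S) * (\<Prod>i\<in>insert j S. fact (b i)) * Gamma \<beta> / Gamma (\<beta> + card (insert j S) + (\<Sum>i\<in>insert j S. b i))
        * R powr (\<beta> - 1 + card (insert j S) + (\<Sum>i\<in>insert j S. b i))"
  proof -
    have "Gamma (\<beta> + b j + 1) > 0" using insert.prems by (intro Gamma_real_pos) auto
    then show ?thesis using insert.hyps by (simp add: field_simps)
  qed
  finally show ?case .
qed

text \<open>For fixed \<open>z\<close> the fibre is a ball of squared radius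
  \<open>exp (- \<mu> * norm z ^ 2)\<close>, and the Dirichlet integral over it contributes the
  power \<open>E\<close> of that exponential. What remains is a product of one-variable Gaussian
  moments of rate \<open>\<mu> * (\<kappa> + E)\<close>. Only the sum \<open>\<kappa> + E\<close> is
  asked to be positive, because \<open>\<kappa>\<close> can be negative when \<open>\<nu>\<close>
  is.\<close>

lemma nn_integral_Hartogs_moment:
  fixes a :: "'n::finite + 'm::finite \<Rightarrow> nat" and \<mu> \<kappa> \<beta> :: real
  defines "A \<equiv> range Inl :: ('n + 'm) set" and "B \<equiv> range Inr :: ('n + 'm) set"
  defines "E \<equiv> \<beta> - 1 + real CARD('m) + real (\<Sum>i\<in>B. a i)"
  assumes "\<mu> > 0" "\<beta> > 0" "\<kappa> + E > 0"
  shows "(\<integral>\<^sup>+p. ennreal ((\<Prod>i\<in>UNIV. ((cmod (p $ i))\<^sup>2) ^ a i) * exp (- \<mu> * \<kappa> * (\<Sum>i\<in>A. (cmod (p $ i))\<^sup>2))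
      * (exp (- \<mu> * (\<Sum>i\<in>A. (cmod (p $ i))\<^sup>2)) - (\<Sum>i\<in>B. (cmod (p $ i))\<^sup>2)) powr (\<beta> - 1))
      * indicator {p. (\<Sum>i\<in>B. (cmod (p $ i))\<^sup>2) < exp (- \<mu> * (\<Sum>i\<in>A. (cmod (p $ i))\<^sup>2))} p \<partial>lborel)
    = ennreal (pi ^ CARD('n + 'm) * (\<Prod>i\<in>UNIV. fact (a i)) * Gamma \<beta> / Gamma (E + 1)
        / (\<mu> * (\<kappa> + E)) ^ (CARD('n) + (\<Sum>i\<in>A. a i)))"
    (is "integral\<^sup>N _ ?F = _")
proof -
  interpret product_sigma_finite "\<lambda>_::'n + 'm. lborel :: complex measure" ..
  have AB: "UNIV = A \<union> B" "A \<inter> B = {}" "finite A" "finite B"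
    by (auto simp: A_def B_def UNIV_sum)
  have cards: "card A = CARD('n)" "card B = CARD('m)"
    by (simp_all add: A_def B_def card_image)
  have prodAB: "(\<Prod>i\<in>UNIV. f i) = (\<Prod>i\<in>A. f i) * (\<Prod>i\<in>B. f i)" for f :: "'n + 'm \<Rightarrow> real"
    unfolding AB(1) using AB(2-4) by (rule prod.union_disjoint[rotated 2])
  have [measurable]: "vec_lambda \<in> (\<Pi>\<^sub>M i\<in>UNIV. (lborel :: complex measure)) \<rightarrow>\<^sub>M (borel :: (complex^('n + 'm)) measure)"
    using borel_measurable_vec_lambda by (simp cong: measurable_cong_sets sets_PiM_cong)
  have [measurable]: "(\<lambda>p. p $ i) \<in> borel_measurable (borel :: (complex^('n + 'm)) measure)" for i
    by (intro borel_measurable_continuous_onI continuous_intros)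
  have [measurable]: "?F \<in> borel_measurable borel" by measurable
  let ?t = "\<lambda>x. \<Sum>i\<in>A. (cmod (x i))\<^sup>2" and ?s = "\<lambda>x. \<Sum>i\<in>B. (cmod (x i))\<^sup>2"
  let ?mA = "\<lambda>x. \<Prod>i\<in>A. ((cmod (x i))\<^sup>2) ^ a i" and ?mB = "\<lambda>x. \<Prod>i\<in>B. ((cmod (x i))\<^sup>2) ^ a i"
  let ?C = "pi ^ CARD('m) * (\<Prod>i\<in>B. fact (a i)) * Gamma \<beta> / Gamma (E + 1)"
  let ?c = "\<mu> * (\<kappa> + E)"
  have c: "?c > 0" using assms by simp
  have "E + 1 > 0" 
    unfolding E_def using \<open>\<beta> > 0\<close> by (simp add: add_pos_nonneg sum_nonneg)
  then have Cpos: "?C \<ge> 0"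
    using \<open>\<beta> > 0\<close> by (auto intro!: divide_nonneg_nonneg mult_nonneg_nonneg Gamma_real_nonneg prod_nonneg)
  have "integral\<^sup>N lborel ?F = (\<integral>\<^sup>+x. ?F (vec_lambda x) \<partial>(\<Pi>\<^sub>M i\<in>A \<union> B. lborel))"
    unfolding AB(1)[symmetric] by (subst lborel_vec_eq) (subst nn_integral_distr, auto)
  also have "\<dots> = (\<integral>\<^sup>+x. \<integral>\<^sup>+y. ?F (vec_lambda (merge A B (x, y))) \<partial>(\<Pi>\<^sub>M i\<in>B. lborel) \<partial>(\<Pi>\<^sub>M i\<in>A. lborel))"
  proof (rule product_nn_integral_fold[OF AB(2-4)])
    show "(\<lambda>x. ?F (vec_lambda x)) \<in> borel_measurable (\<Pi>\<^sub>M i\<in>A \<union> B. lborel)"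
      unfolding AB(1)[symmetric] by measurable
  qed
  also have "\<dots> = (\<integral>\<^sup>+x. ennreal (?mA x * exp (- \<mu> * \<kappa> * ?t x)) *
      (\<integral>\<^sup>+y. ennreal (?mB y * (exp (- \<mu> * ?t x) - ?s y) powr (\<beta> - 1)) * indicator {s. s < exp (- \<mu> * ?t x)} (?s y) \<partial>(\<Pi>\<^sub>M i\<in>B. lborel))
      \<partial>(\<Pi>\<^sub>M i\<in>A. lborel))"
  proof (intro nn_integral_cong, subst nn_integral_cmult[symmetric], measurable, intro nn_integral_cong)
    fix x y :: "'n + 'm \<Rightarrow> complex"
    let ?p = "vec_lambda (merge A B (x, y))"
    have *: "(\<Sum>i\<in>A. (cmod (?p $ i))\<^sup>2) = ?t x" "(\<Sum>i\<in>B. (cmod (?p $ i))\<^sup>2) = ?s y"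
         "(\<Prod>i\<in>A. ((cmod (?p $ i))\<^sup>2) ^ a i) = ?mA x" "(\<Prod>i\<in>B. ((cmod (?p $ i))\<^sup>2) ^ a i) = ?mB y"
      using AB(2) by (auto intro!: sum.cong prod.cong simp: merge_def)
    have "?mA x \<ge> 0" by (simp add: prod_nonneg)
    then show "?F ?p = ennreal (?mA x * exp (- \<mu> * \<kappa> * ?t x)) *
      (ennreal (?mB y * (exp (- \<mu> * ?t x) - ?s y) powr (\<beta> - 1)) * indicator {s. s < exp (- \<mu> * ?t x)} (?s y))"
      unfolding prodAB * mem_Collect_eq by (auto simp: mult_ac *[unfolded vec_lambda_beta] split: split_indicator simp flip: ennreal_mult')
  qed
  also have "\<dots> = (\<integral>\<^sup>+x. ennreal (?mA x * exp (- \<mu> * \<kappa> * ?t x)) * ennreal (?C * exp (- \<mu> * ?t x) powr E) \<partial>(\<Pi>\<^sub>M i\<in>A. lborel))"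
    using \<open>\<beta> > 0\<close> by (intro nn_integral_cong, subst nn_integral_Dirichlet[OF AB(4)]) (auto simp: cards E_def algebra_simps)
  also have "\<dots> = (\<integral>\<^sup>+x. ennreal ?C * (\<Prod>i\<in>A. ennreal (((cmod (x i))\<^sup>2) ^ a i * exp (- ?c * (cmod (x i))\<^sup>2))) \<partial>(\<Pi>\<^sub>M i\<in>A. lborel))"
  proof (intro nn_integral_cong)
    fix x
    have "?mA x \<ge> 0" by (simp add: prod_nonneg)
    have "exp (- \<mu> * \<kappa> * ?t x) * exp (- \<mu> * ?t x) powr E = (\<Prod>i\<in>A. exp (- ?c * (cmod (x i))\<^sup>2))"
      by (simp add: exp_sum[symmetric] AB powr_def sum_distrib_left[symmetric] sum_negf flip: exp_add)
         (simp add: algebra_simps)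
    then have e: "?mA x * exp (- \<mu> * \<kappa> * ?t x) * exp (- \<mu> * ?t x) powr E
       = (\<Prod>i\<in>A. ((cmod (x i))\<^sup>2) ^ a i * exp (- ?c * (cmod (x i))\<^sup>2))"
      by (simp add: prod.distrib)
    have "ennreal (?mA x * exp (- \<mu> * \<kappa> * ?t x)) * ennreal (?C * exp (- \<mu> * ?t x) powr E)
        = ennreal (?C * (?mA x * exp (- \<mu> * \<kappa> * ?t x) * exp (- \<mu> * ?t x) powr E))"
      using \<open>?mA x \<ge> 0\<close> by (subst ennreal_mult'[symmetric]) (auto simp: mult_ac)
    also have "\<dots> = ennreal ?C * (\<Prod>i\<in>A. ennreal (((cmod (x i))\<^sup>2) ^ a i * exp (- ?c * (cmod (x i))\<^sup>2)))"
      unfolding e by (subst ennreal_mult'[OF Cpos]) (simp add: prod_ennreal)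
    finally show "ennreal (?mA x * exp (- \<mu> * \<kappa> * ?t x)) * ennreal (?C * exp (- \<mu> * ?t x) powr E) = \<dots>" .
  qed
  also have "\<dots> = ennreal ?C * (\<Prod>i\<in>A. ennreal (pi * fact (a i) / ?c ^ (a i + 1)))"
    by (subst nn_integral_cmult, measurable)
       (subst product_nn_integral_prod[OF AB(3)], measurable, simp only: nn_integral_gaussian_moment[OF c])
  also have "\<dots> = ennreal (?C * (\<Prod>i\<in>A. pi * fact (a i) / ?c ^ (a i + 1)))"
    by (subst prod_ennreal, use c in simp) (rule ennreal_mult'[OF Cpos, symmetric])
  also have "(\<Prod>i\<in>A. pi * fact (a i) / ?c ^ (a i + 1)) = pi ^ CARD('n) * (\<Prod>i\<in>A. fact (a i)) / ?c ^ (CARD('n) + (\<Sum>i\<in>A. a i))"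
    by (simp add: prod.distrib prod_dividef cards power_add power_sum)
  also have "?C * \<dots> = pi ^ CARD('n + 'm) * (\<Prod>i\<in>UNIV. fact (a i)) * Gamma \<beta> / Gamma (E + 1)
        / ?c ^ (CARD('n) + (\<Sum>i\<in>A. a i))"
    unfolding prodAB by (simp add: power_add)
  finally show ?thesis .
qed

section \<open>Rotation invariance of Lebesgue measure on the complex plane\<close>

lemma lborel_distr_real_2_complex:
  "distr lborel borel (\<lambda>x :: real^2. Complex (x $ 1) (x $ 2)) = lborel"
proof (rule lborel_eqI[symmetric])
  fix l u :: complex
  assume le: "\<And>b. b \<in> Basis \<Longrightarrow> l \<bullet> b \<le> u \<bullet> b"
  have [measurable]: "(\<lambda>x :: real^2. Complex (x $ 1) (x $ 2)) \<in> borel_measurable borel"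
    unfolding complex_eq_iff[abs_def] Complex_eq by (intro borel_measurable_continuous_onI continuous_intros)
  have "(\<lambda>x :: real^2. Complex (x $ 1) (x $ 2)) -` box l u = box (vector [Re l, Im l]) (vector [Re u, Im u])"
    by (auto simp: box_def Basis_complex_def Basis_vec_def inner_axis forall_2 UNIV_2)
  moreover have "Re l \<le> Re u" "Im l \<le> Im u" using le[of 1] le[of \<i>] by (auto simp: Basis_complex_def)
  moreover have "emeasure (distr lborel borel (\<lambda>x :: real^2. Complex (x $ 1) (x $ 2))) (box l u)
     = emeasure lborel ((\<lambda>x :: real^2. Complex (x $ 1) (x $ 2)) -` box l u)"
    by (simp add: emeasure_distr)
  ultimately show "emeasure (distr lborel borel (\<lambda>x :: real^2. Complex (x $ 1) (x $ 2))) (box l u) = ennreal (\<Prod>b\<in>Basis. (u - l) \<bullet> b)"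
    by (auto simp: emeasure_lborel_box_eq Basis_complex_def Basis_vec_def inner_axis UNIV_2 axis_eq_axis)
qed simp

text \<open>The maps \<open>C\<close> and \<open>V\<close> identify the plane with
  \<open>real^2\<close>, where multiplication by a unit becomes an orthogonal transformation and
  invariance of Lebesgue measure under such maps applies.\<close>

lemma lborel_distr_unit_mult:
  assumes "cmod c = 1"
  shows "distr lborel borel ((*) c) = (lborel :: complex measure)"
proof (rule lborel_eqI[symmetric])
  define C where "C = (\<lambda>x :: real^2. Complex (x $ 1) (x $ 2))"
  define V where "V = (\<lambda>z. vector [Re z, Im z] :: real^2)"
  have CV: "C (V z) = z" and VC: "V (C x) = x" for z x
    by (simp_all add: C_def V_def complex_eq_iff vec_eq_iff forall_2)
  have [measurable]: "C \<in> borel_measurable borel"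
    unfolding C_def Complex_eq by (intro borel_measurable_continuous_onI continuous_intros)
  have distr: "distr lborel borel C = lborel" unfolding C_def by (rule lborel_distr_real_2_complex)
  have c2: "c * (cnj c * z) = z" "cnj c * (c * z) = z" for z
    using assms complex_norm_square[of c] by (simp_all flip: mult.assoc add: mult.commute)
  have normV: "norm (V z) = cmod z" for z
    by (simp add: V_def norm_vec_def L2_set_def UNIV_2 cmod_def)
  have normC: "cmod (C x) = norm x" for x
    using normV[of "C x"] by (simp add: VC)
  \<comment> \<open>The inverse rotation: the preimage of a box under multiplication by
    \<open>c\<close> is its image under multiplication by \<open>cnj c\<close>.\<close>
  define T where "T = (\<lambda>x. V (cnj c * C x))"
  have lin: "linear T"
    by (auto intro!: linearI simp: T_def V_def C_def vec_eq_iff forall_2 algebra_simps)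
  have T: "orthogonal_transformation T"
    unfolding orthogonal_transformation using lin assms by (simp add: T_def normV normC norm_mult)
  fix l u :: complex
  assume le: "\<And>b. b \<in> Basis \<Longrightarrow> l \<bullet> b \<le> u \<bullet> b"
  have emC: "emeasure lborel (C -` X) = emeasure lborel X" if "X \<in> sets borel" for X
    using that by (subst distr[symmetric], subst emeasure_distr) auto
  have B: "C -` box l u = box (V l) (V u)"
    by (auto simp: C_def V_def box_def Basis_complex_def Basis_vec_def inner_axis forall_2 UNIV_2)
  have im: "C -` ((*) c -` box l u) = T ` (C -` box l u)"
  proof (intro equalityI subsetI)
    fix x assume "x \<in> C -` ((*) c -` box l u)"
    then have "V (c * C x) \<in> C -` box l u" by (simp add: CV)
    moreover have "T (V (c * C x)) = x" by (simp add: T_def CV VC c2)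
    ultimately show "x \<in> T ` (C -` box l u)" by (metis imageI)
  next
    fix y assume "y \<in> T ` (C -` box l u)"
    then show "y \<in> C -` ((*) c -` box l u)" by (auto simp: T_def CV c2)
  qed
  have [measurable]: "T ` (C -` box l u) \<in> sets borel"
    unfolding im[symmetric] by (intro measurable_sets_borel[where M=borel]) auto
  have lm: "T ` (C -` box l u) \<in> lmeasurable"
    by (intro measurable_orthogonal_image[OF T]) (auto simp: B)
  have "emeasure (distr lborel borel ((*) c)) (box l u) = emeasure lborel ((*) c -` box l u)"
    by (subst emeasure_distr) auto
  also have "\<dots> = emeasure lborel (T ` (C -` box l u))"
    by (subst im[symmetric], rule emC[symmetric]) (auto intro!: measurable_sets_borel[where M=borel])
  also have "\<dots> = emeasure lebesgue (T ` (C -` box l u))" by simp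
  also have "\<dots> = ennreal (measure lebesgue (T ` (C -` box l u)))"
    using lm by (auto simp: fmeasurable_def emeasure_eq_ennreal_measure)
  also have "\<dots> = ennreal (measure lebesgue (C -` box l u))"
    by (subst measure_orthogonal_image[OF T]) (auto simp: B)
  also have "\<dots> = emeasure lborel (C -` box l u)"
    unfolding B using emeasure_lborel_box_finite[of "V l" "V u"] by (subst emeasure_eq_ennreal_measure) auto
  also have "\<dots> = ennreal (\<Prod>b\<in>Basis. (u - l) \<bullet> b)"
    using le by (subst emC) (auto simp: emeasure_lborel_box)
  finally show "emeasure (distr lborel borel ((*) c)) (box l u) = ennreal (\<Prod>b\<in>Basis. (u - l) \<bullet> b)" .
qed simp

section \<open>Holomorphic functions of several variables\<close>

definition mon :: "complex^'N::finite \<Rightarrow> ('N \<Rightarrow> nat) \<Rightarrow> complex" where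
  "mon p a = (\<Prod>i\<in>UNIV. p $ i ^ a i)"

lemma holo_on_continuous: "holo_on S f \<Longrightarrow> continuous_on S f"
  unfolding holo_on_def
  by (auto intro!: continuous_at_imp_continuous_on dest!: has_derivative_continuous)

lemma holo_on_const: "holo_on S (\<lambda>_. c)"
  unfolding holo_on_def by (auto intro!: exI[of _ "\<lambda>_. 0"])

lemma holo_on_nth: "holo_on S (\<lambda>p. p $ i)"
  unfolding holo_on_def
  by (auto intro!: exI[of _ "\<lambda>v. v $ i"] bounded_linear_imp_has_derivative bounded_linear_vec_nth)

lemma holo_on_add:
  assumes "holo_on S f" "holo_on S g"
  shows "holo_on S (\<lambda>p. f p + g p)"
  unfolding holo_on_def
proof
  fix p assume "p \<in> S"
  then obtain L M where "(f has_derivative L) (at p)" "\<forall>c v. L (c *s v) = c * L v"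
    "(g has_derivative M) (at p)" "\<forall>c v. M (c *s v) = c * M v"
    using assms unfolding holo_on_def by metis
  then show "\<exists>L. ((\<lambda>p. f p + g p) has_derivative L) (at p) \<and> (\<forall>c v. L (c *s v) = c * L v)"
    by (intro exI[of _ "\<lambda>v. L v + M v"]) (auto intro!: derivative_intros simp: algebra_simps)
qed

lemma holo_on_mult:
  assumes "holo_on S f" "holo_on S g"
  shows "holo_on S (\<lambda>p. f p * g p)"
  unfolding holo_on_def
proof
  fix p assume "p \<in> S"
  then obtain L M where "(f has_derivative L) (at p)" "\<forall>c v. L (c *s v) = c * L v"
    "(g has_derivative M) (at p)" "\<forall>c v. M (c *s v) = c * M v"
    using assms unfolding holo_on_def by metis
  then show "\<exists>L. ((\<lambda>p. f p * g p) has_derivative L) (at p) \<and> (\<forall>c v. L (c *s v) = c * L v)"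
    by (intro exI[of _ "\<lambda>v. f p * M v + L v * g p"] conjI has_derivative_mult) (auto simp: algebra_simps)
qed

lemma holo_on_sum: "(\<And>a. a \<in> A \<Longrightarrow> holo_on S (f a)) \<Longrightarrow> holo_on S (\<lambda>p. \<Sum>a\<in>A. f a p)"
  by (induction A rule: infinite_finite_induct) (auto intro: holo_on_const holo_on_add)

lemma holo_on_power: "holo_on S f \<Longrightarrow> holo_on S (\<lambda>p. f p ^ k)"
  by (induction k) (auto intro: holo_on_const holo_on_mult)

lemma holo_on_mon: "holo_on S (\<lambda>p. mon p a)"
proof -
  have "holo_on S (\<lambda>p. \<Prod>i\<in>A. p $ i ^ a i)" for A
    by (induction A rule: infinite_finite_induct)
       (auto intro!: holo_on_const holo_on_mult holo_on_power[OF holo_on_nth])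
  then show ?thesis unfolding mon_def by blast
qed

lemma norm_vector_smult: "norm (c *s v) = cmod c * norm v" for v :: "complex^'N"
  by (simp add: norm_vec_def L2_set_right_distrib norm_mult)

text \<open>Restriction to a complex line, the passage to one-variable theory. Complex homogeneity
  of \<open>L\<close> turns the real derivative of the restriction into multiplication by
  \<open>L v\<close>, which is a complex derivative.\<close>

lemma holo_on_line:
  assumes f: "holo_on S f" and sub: "\<And>t. t \<in> A \<Longrightarrow> p + t *s v \<in> S"
  shows "(\<lambda>t. f (p + t *s v)) holomorphic_on A"
    "\<And>t L. t \<in> A \<Longrightarrow> (f has_derivative L) (at (p + t *s v)) \<Longrightarrow> (\<forall>c w. L (c *s w) = c * L w) \<Longrightarrow>
       ((\<lambda>t. f (p + t *s v)) has_field_derivative L v) (at t)"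
proof -
  show D: "((\<lambda>t. f (p + t *s v)) has_field_derivative L v) (at t)"
    if "t \<in> A" and L: "(f has_derivative L) (at (p + t *s v))" "\<forall>c w. L (c *s w) = c * L w" for t L
  proof -
    have "((\<lambda>t. p + t *s v) has_derivative (\<lambda>h. h *s v)) (at t)"
      by (auto intro!: derivative_eq_intros bounded_linear_imp_has_derivative bounded_linear_intro[where K="norm v"]
          simp: norm_vector_smult vec_eq_iff algebra_simps)
    from diff_chain_at[OF this L(1)] show ?thesis
      unfolding has_field_derivative_def o_def using L(2) by (simp add: mult_commute_abs)
  qed
  show "(\<lambda>t. f (p + t *s v)) holomorphic_on A"
    unfolding holomorphic_on_def
  proof
    fix t assume t: "t \<in> A"
    then obtain L where "(f has_derivative L) (at (p + t *s v))" "\<forall>c w. L (c *s w) = c * L w"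
      using f sub unfolding holo_on_def by blast
    from D[OF t this] show "(\<lambda>t. f (p + t *s v)) field_differentiable at t within A"
      unfolding field_differentiable_def by (blast intro: has_field_derivative_at_within)
  qed
qed

section \<open>Unordered sums along a sequence of finite sets\<close>

definition exhaustion :: "nat \<Rightarrow> 'a::countable set" where
  "exhaustion n = to_nat -` {..n}"

lemma finite_exhaustion [simp]: "finite (exhaustion n)"
  unfolding exhaustion_def by (intro finite_vimageI) auto

lemma exhaustion_mono: "m \<le> n \<Longrightarrow> exhaustion m \<subseteq> exhaustion n"
  by (auto simp: exhaustion_def)

text \<open>Unordered sums are limits along the net of finite sets, whereas dominated convergence,
  Fatou's lemma and the theorem on derivatives of limits are applied to sequences. This limit passes
  from the net to a sequence, which exists because the index type is countable.\<close>

lemma filterlim_exhaustion: "filterlim exhaustion (finite_subsets_at_top UNIV) sequentially"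
  unfolding filterlim_finite_subsets_at_top
proof safe
  fix X :: "'a set" assume "finite X"
  then have "\<forall>\<^sub>F n in sequentially. \<forall>x\<in>X. to_nat x \<le> n"
    by (intro eventually_ball_finite) (auto simp: eventually_ge_at_top)
  then show "\<forall>\<^sub>F n in sequentially. finite (exhaustion n :: 'a set) \<and> X \<subseteq> exhaustion n \<and> exhaustion n \<subseteq> (UNIV :: 'a set)"
  proof eventually_elim
    case (elim n)
    then have "X \<subseteq> exhaustion n" by (auto simp: exhaustion_def)
    then show ?case by simp
  qed
qed

lemma subset_exhaustion: "finite X \<Longrightarrow> \<exists>n. X \<subseteq> exhaustion n"
  using filterlim_exhaustion[unfolded filterlim_finite_subsets_at_top, rule_format, of X]
  by (auto simp: eventually_sequentially)

lemma has_sum_imp_exhaustion_limit: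
  "(f has_sum s) UNIV \<Longrightarrow> (\<lambda>n. sum f (exhaustion n)) \<longlonglongrightarrow> s"
  unfolding has_sum_def by (rule filterlim_compose[OF _ filterlim_exhaustion])

text \<open>Dominated convergence along \<open>exhaustion\<close> yields only a sequential limit of
  the sums of integrals. That the integrals have an unordered sum at all follows separately, since
  their absolute sums are bounded by the integral of \<open>h\<close>; the two limits must then
  agree.\<close>

lemma has_sum_integral_dominated:
  fixes g :: "'a::countable \<Rightarrow> 'b \<Rightarrow> complex"
  assumes h: "integrable M h" and g: "\<And>a. g a \<in> borel_measurable M"
    and bd: "\<And>x F. x \<in> space M \<Longrightarrow> finite F \<Longrightarrow> (\<Sum>a\<in>F. norm (g a x)) \<le> h x"
    and sm: "\<And>x. x \<in> space M \<Longrightarrow> ((\<lambda>a. g a x) has_sum G x) UNIV"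
  shows "((\<lambda>a. \<integral>x. g a x \<partial>M) has_sum (\<integral>x. G x \<partial>M)) UNIV"
proof -
  have int: "integrable M (g a)" for a
    using bd[of _ "{a}"] by (intro Bochner_Integration.integrable_bound[OF h g]) force
  have lim: "(\<lambda>n. \<Sum>a\<in>exhaustion n. g a x) \<longlonglongrightarrow> G x" if "x \<in> space M" for x
    by (rule has_sum_imp_exhaustion_limit[OF sm[OF that]])
  have Gm: "G \<in> borel_measurable M"
    by (rule borel_measurable_LIMSEQ_metric[OF _ lim]) (use g in measurable)
  have "(\<lambda>n. \<integral>x. (\<Sum>a\<in>exhaustion n. g a x) \<partial>M) \<longlonglongrightarrow> (\<integral>x. G x \<partial>M)"
  proof (rule integral_dominated_convergence[OF Gm _ h])
    show "(\<lambda>x. \<Sum>a\<in>exhaustion n. g a x) \<in> borel_measurable M" for n using g by measurable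
    show "AE x in M. (\<lambda>n. \<Sum>a\<in>exhaustion n. g a x) \<longlonglongrightarrow> G x" using lim by auto
    show "AE x in M. norm (\<Sum>a\<in>exhaustion n. g a x) \<le> h x" for n
      using bd[OF _ finite_exhaustion] by (auto intro: order_trans[OF norm_sum])
  qed
  then have L: "(\<lambda>n. \<Sum>a\<in>exhaustion n. \<integral>x. g a x \<partial>M) \<longlonglongrightarrow> (\<integral>x. G x \<partial>M)"
    using int by simp
  have "(\<lambda>a. norm (\<integral>x. g a x \<partial>M)) summable_on UNIV"
  proof (rule nonneg_bounded_partial_sums_imp_summable_on)
    show "\<forall>\<^sub>F X in finite_subsets_at_top UNIV. (\<Sum>a\<in>X. norm (\<integral>x. g a x \<partial>M)) \<le> (\<integral>x. h x \<partial>M)"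
    proof (rule eventually_finite_subsets_at_top_weakI)
      fix X :: "'a set" assume X: "finite X"
      have "(\<Sum>a\<in>X. norm (\<integral>x. g a x \<partial>M)) \<le> (\<Sum>a\<in>X. \<integral>x. norm (g a x) \<partial>M)"
        by (intro sum_mono integral_norm_bound)
      also have "\<dots> = (\<integral>x. (\<Sum>a\<in>X. norm (g a x)) \<partial>M)"
        using int by simp
      also have "\<dots> \<le> (\<integral>x. h x \<partial>M)"
        using int h bd[OF _ X] by (intro integral_mono) auto
      finally show "(\<Sum>a\<in>X. norm (\<integral>x. g a x \<partial>M)) \<le> (\<integral>x. h x \<partial>M)" .
    qed
  qed auto
  then have "(\<lambda>a. \<integral>x. g a x \<partial>M) summable_on UNIV" by (rule abs_summable_summable)
  then obtain I where I: "((\<lambda>a. \<integral>x. g a x \<partial>M) has_sum I) UNIV" by (auto simp: summable_on_def)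
  have "(\<lambda>n. \<Sum>a\<in>exhaustion n. \<integral>x. g a x \<partial>M) \<longlonglongrightarrow> I"
    by (rule has_sum_imp_exhaustion_limit[OF I])
  with L have "I = (\<integral>x. G x \<partial>M)" by (rule LIMSEQ_unique[rotated])
  with I show ?thesis by simp
qed

section \<open>Cauchy estimates and uniform limits of holomorphic functions\<close>

lemma holo_derivative_bound:
  assumes f: "holo_on (ball p e) f" and L: "(f has_derivative L) (at x)" "\<forall>c v. L (c *s v) = c * L v"
    and x: "dist p x < e / 2" and B: "\<And>y. y \<in> ball p e \<Longrightarrow> cmod (f y) \<le> B"
  shows "cmod (L h) \<le> 2 * B / e * norm h"
proof (cases "h = 0")
  case True
  then show ?thesis using has_derivative_bounded_linear[OF L(1)] by (simp add: linear_simps)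
next
  case False
  have e: "e > 0" using x zero_le_dist[of p x] by linarith
  \<comment> \<open>On the disc of this radius \<open>t *s h\<close> has norm at most
    \<open>e / 2\<close>, so the line through \<open>x\<close> stays in the ball and the
    one-variable Cauchy inequality bounds the derivative along \<open>h\<close>.\<close>
  define r where "r = e / (2 * norm h)"
  have r: "r > 0" using e False by (simp add: r_def)
  have mem: "x + t *s h \<in> ball p e" if "cmod t \<le> r" for t
  proof -
    have "norm (t *s h) = cmod t * norm h" by (rule norm_vector_smult)
    also have "\<dots> \<le> e / 2" using that False by (simp add: r_def field_simps)
    finally show ?thesis using x norm_triangle_ineq[of "x - p" "t *s h"]
      by (simp add: dist_norm norm_minus_commute algebra_simps)
  qed
  note hol = holo_on_line[OF f, of "cball 0 r" x h]
  have "cmod ((deriv ^^ 1) (\<lambda>t. f (x + t *s h)) 0) \<le> fact 1 * B / r ^ 1"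
  proof (rule Cauchy_inequality)
    show "(\<lambda>t. f (x + t *s h)) holomorphic_on ball 0 r"
      using hol(1) mem by (auto intro: holomorphic_on_subset)
    show "continuous_on (cball 0 r) (\<lambda>t. f (x + t *s h))"
      using hol(1) mem by (auto intro: holomorphic_on_imp_continuous_on)
  qed (use r mem B in auto)
  moreover have "((\<lambda>t. f (x + t *s h)) has_field_derivative L h) (at 0)"
    using hol(2)[of 0 L] mem L r by auto
  ultimately have "cmod (L h) \<le> B / r" by (simp add: DERIV_imp_deriv)
  then show ?thesis by (simp add: r_def field_simps)
qed

text \<open>The Cauchy estimate for the differences \<open>f m - f n\<close> makes the derivatives
  uniformly Cauchy on the half ball, so they converge to the derivative of the limit, and complex
  homogeneity survives. The conclusion concerns the centre alone: holomorphy is a pointwise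
  condition and every point can be taken as a centre.\<close>

lemma holo_uniform_limit:
  fixes f :: "nat \<Rightarrow> complex^'N::finite \<Rightarrow> complex"
  assumes f: "\<And>n. holo_on (ball p e) (f n)" and e: "e > 0"
    and lim: "uniform_limit (ball p e) f g sequentially"
  shows "holo_on {p} g"
proof -
  let ?S = "ball p (e / 2)"
  have "\<forall>n. \<forall>x\<in>ball p e. \<exists>L. (f n has_derivative L) (at x) \<and> (\<forall>c v. L (c *s v) = c * L v)"
    using f unfolding holo_on_def by blast
  then obtain L where L: "\<And>n x. x \<in> ball p e \<Longrightarrow> (f n has_derivative L n x) (at x)"
     "\<And>n x c v. x \<in> ball p e \<Longrightarrow> L n x (c *s v) = c * L n x v" by metis
  have S: "x \<in> ball p e" if "x \<in> ?S" for x using that e by auto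
  have cauchy: "\<exists>N. \<forall>m\<ge>N. \<forall>n\<ge>N. \<forall>x\<in>?S. \<forall>h. cmod (L m x h - L n x h) \<le> d * norm h" if d: "d > 0" for d
  proof -
    have "d * e / 4 > 0" using d e by simp
    from uniform_limitD[OF lim this] obtain N where N: "\<And>n x. n \<ge> N \<Longrightarrow> x \<in> ball p e \<Longrightarrow> dist (f n x) (g x) < d * e / 4"
      unfolding eventually_sequentially by blast
    show ?thesis
    proof (intro exI[of _ N] allI impI ballI)
      fix m n x h assume mn: "m \<ge> N" "n \<ge> N" and x: "x \<in> ?S"
      have "cmod (L m x h - L n x h) \<le> 2 * (d * e / 2) / e * norm h"
      proof (rule holo_derivative_bound[where p=p and e=e and f="\<lambda>x. f m x - f n x"])
        have "holo_on (ball p e) (\<lambda>x. f m x + (-1) * f n x)"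
          by (intro holo_on_add holo_on_mult holo_on_const f)
        then show "holo_on (ball p e) (\<lambda>x. f m x - f n x)" by simp
        show "((\<lambda>x. f m x - f n x) has_derivative (\<lambda>h. L m x h - L n x h)) (at x)"
          using L(1) S[OF x] by (intro derivative_intros) auto
        show "dist p x < e / 2" using x by auto
        show "\<forall>c v. L m x (c *s v) - L n x (c *s v) = c * (L m x v - L n x v)"
          using L(2)[OF S[OF x]] by (simp add: algebra_simps)
        fix y assume "y \<in> ball p e"
        then show "cmod (f m y - f n y) \<le> d * e / 2"
          using N[OF mn(1), of y] N[OF mn(2), of y] dist_triangle_half_l[of "f m y" "g y" "d * e / 2" "f n y"]
          by (simp add: dist_norm)
      qed
      then show "cmod (L m x h - L n x h) \<le> d * norm h" using e by simp
    qed
  qed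
  have "\<exists>l. (\<lambda>n. L n x h) \<longlonglongrightarrow> l" if x: "x \<in> ?S" for x h
  proof -
    have "Cauchy (\<lambda>n. L n x h)"
    proof (rule CauchyI)
      fix d :: real assume "d > 0"
      \<comment> \<open>The summand 1 keeps the quotient meaningful for
        \<open>h = 0\<close>.\<close>
      then have "d / (norm h + 1) > 0" by (simp add: add_nonneg_pos)
      from cauchy[OF this] x obtain N where N: "\<And>m n. m \<ge> N \<Longrightarrow> n \<ge> N \<Longrightarrow> cmod (L m x h - L n x h) \<le> d / (norm h + 1) * norm h"
        by blast
      have "d / (norm h + 1) * norm h < d"
        using \<open>d > 0\<close> by (subst times_divide_eq_left, subst pos_divide_less_eq) (auto simp: algebra_simps add_pos_nonneg)
      then show "\<exists>M. \<forall>m\<ge>M. \<forall>n\<ge>M. norm (L m x h - L n x h) < d" using N by (meson le_less_trans)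
    qed
    then show ?thesis by (simp add: Cauchy_convergent_iff convergent_def)
  qed
  then obtain G where G: "\<And>x h. x \<in> ?S \<Longrightarrow> (\<lambda>n. L n x h) \<longlonglongrightarrow> G x h" by metis
  have unif: "\<forall>\<^sub>F n in sequentially. \<forall>x\<in>?S. \<forall>h. norm (L n x h - G x h) \<le> d * norm h" if d: "d > 0" for d
  proof -
    obtain N where N: "\<And>m n x h. m \<ge> N \<Longrightarrow> n \<ge> N \<Longrightarrow> x \<in> ?S \<Longrightarrow> cmod (L m x h - L n x h) \<le> d * norm h"
      using cauchy[OF d] by blast
    have "norm (L n x h - G x h) \<le> d * norm h" if "n \<ge> N" "x \<in> ?S" for n x h
    proof (rule tendsto_upperbound)
      show "(\<lambda>m. norm (L n x h - L m x h)) \<longlonglongrightarrow> norm (L n x h - G x h)"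
        by (intro tendsto_intros G that)
      show "\<forall>\<^sub>F m in sequentially. norm (L n x h - L m x h) \<le> d * norm h"
        using N[OF that(1) _ that(2)] by (auto simp: eventually_sequentially)
    qed auto
    then show ?thesis unfolding eventually_sequentially by blast
  qed
  have fg: "(\<lambda>n. f n x) \<longlonglongrightarrow> g x" if "x \<in> ball p e" for x
    using tendsto_uniform_limitI[OF lim that] .
  have p: "p \<in> ?S" using e by simp
  have "\<exists>g'. \<forall>x\<in>?S. (\<lambda>n. f n x) \<longlonglongrightarrow> g' x \<and> (g' has_derivative G x) (at x within ?S)"
  proof (rule has_derivative_sequence)
    show "(f n has_derivative L n x) (at x within ?S)" if "x \<in> ?S" for n x
      using L(1)[OF S[OF that]] by (rule has_derivative_at_withinI)
    show "\<forall>\<^sub>F n in sequentially. \<forall>x\<in>?S. \<forall>h. norm (L n x h - G x h) \<le> d * norm h" if "d > 0" for d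
      by (rule unif[OF that])
    show "(\<lambda>n. f n p) \<longlonglongrightarrow> g p" by (rule fg[OF S[OF p]])
  qed (use p in auto)
  then obtain g' where g': "\<And>x. x \<in> ?S \<Longrightarrow> (\<lambda>n. f n x) \<longlonglongrightarrow> g' x \<and> (g' has_derivative G x) (at x within ?S)"
    by blast
  have "g' x = g x" if "x \<in> ?S" for x using g'[OF that] fg[OF S[OF that]] LIMSEQ_unique by blast
  then have "(g has_derivative G p) (at p within ?S)"
    using g'[OF p] p has_derivative_transform[of p ?S g g'] by auto
  then have "(g has_derivative G p) (at p)" using p by (simp add: at_within_open[OF p])
  moreover have "G p (c *s v) = c * G p v" for c v
  proof (rule LIMSEQ_unique)
    show "(\<lambda>n. L n p (c *s v)) \<longlonglongrightarrow> G p (c *s v)" by (rule G[OF p])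
    show "(\<lambda>n. L n p (c *s v)) \<longlonglongrightarrow> c * G p v" using L(2)[OF S[OF p]] G[OF p] by (auto intro!: tendsto_intros)
  qed
  ultimately show ?thesis unfolding holo_on_def by blast
qed

section \<open>Cauchy formula and power series on polydiscs\<close>

text \<open>A finite set of multi-indices lies in the product of its coordinate projections, so its
  absolute sum is at most the product of the full one-variable sums. This gives summability; the
  value is the product formula for infinite sums.\<close>

lemma has_sum_prod_fun:
  fixes f :: "'i::finite \<Rightarrow> 'b \<Rightarrow> 'c :: {banach, real_normed_field}"
  assumes f: "\<And>i. (\<lambda>k. norm (f i k)) summable_on UNIV"
  shows "((\<lambda>a. \<Prod>i\<in>UNIV. f i (a i)) has_sum (\<Prod>i\<in>UNIV. infsum (f i) UNIV)) UNIV"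
proof -
  have abs: "(\<lambda>a. norm (\<Prod>i\<in>UNIV. f i (a i))) summable_on UNIV"
  proof (rule nonneg_bounded_partial_sums_imp_summable_on)
    show "\<forall>\<^sub>F X in finite_subsets_at_top UNIV. (\<Sum>a\<in>X. norm (\<Prod>i\<in>UNIV. f i (a i))) \<le> (\<Prod>i\<in>UNIV. infsum (\<lambda>k. norm (f i k)) UNIV)"
    proof (rule eventually_finite_subsets_at_top_weakI)
      fix X :: "('i \<Rightarrow> 'b) set" assume X: "finite X"
      have "(\<Sum>a\<in>X. norm (\<Prod>i\<in>UNIV. f i (a i))) \<le> (\<Sum>a\<in>(\<Pi>\<^sub>E i\<in>UNIV. (\<lambda>a. a i) ` X). norm (\<Prod>i\<in>UNIV. f i (a i)))"
        using X by (intro sum_mono2 finite_PiE) auto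
      also have "\<dots> = (\<Prod>i\<in>UNIV. \<Sum>k\<in>(\<lambda>a. a i) ` X. norm (f i k))"
        using X by (subst prod_sum_PiE) (auto simp: prod_norm)
      also have "\<dots> \<le> (\<Prod>i\<in>UNIV. infsum (\<lambda>k. norm (f i k)) UNIV)"
        using X f by (intro prod_mono conjI sum_nonneg finite_sum_le_infsum) auto
      finally show "(\<Sum>a\<in>X. norm (\<Prod>i\<in>UNIV. f i (a i))) \<le> (\<Prod>i\<in>UNIV. infsum (\<lambda>k. norm (f i k)) UNIV)" .
    qed
  qed auto
  have "infsum (\<lambda>a. \<Prod>i\<in>UNIV. f i (a i)) (\<Pi>\<^sub>E i\<in>UNIV. UNIV) = (\<Prod>i\<in>UNIV. infsum (f i) UNIV)"
    by (rule infsum_prod_PiE_abs) (use f in auto)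
  then show "((\<lambda>a. \<Prod>i\<in>UNIV. f i (a i)) has_sum (\<Prod>i\<in>UNIV. infsum (f i) UNIV)) UNIV"
    using has_sum_infsum[OF abs_summable_summable[OF abs]] by (simp add: PiE_UNIV_domain)
qed

lemma has_sum_geometric:
  fixes z :: "'c :: {banach, real_normed_field}"
  assumes "norm z < 1"
  shows "(\<lambda>k. norm (z ^ k)) summable_on UNIV" "((\<lambda>k. z ^ k) has_sum 1 / (1 - z)) UNIV"
proof -
  show "(\<lambda>k. norm (z ^ k)) summable_on UNIV"
    using assms by (intro norm_summable_imp_summable_on) (simp add: norm_power summable_geometric)
  then have "(\<lambda>k. z ^ k) summable_on UNIV" by (rule abs_summable_summable)
  then have "((\<lambda>k. z ^ k) has_sum infsum (\<lambda>k. z ^ k) UNIV) UNIV" by (rule has_sum_infsum)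
  moreover have "infsum (\<lambda>k. z ^ k) UNIV = 1 / (1 - z)"
    using has_sum_imp_sums[OF calculation] sums_unique2 geometric_sums[OF assms] by blast
  ultimately show "((\<lambda>k. z ^ k) has_sum 1 / (1 - z)) UNIV" by simp
qed

lemma has_sum_geometric_multi:
  fixes z :: "'i::finite \<Rightarrow> 'c :: {banach, real_normed_field}"
  assumes "\<And>i. norm (z i) < 1"
  shows "((\<lambda>a. \<Prod>i\<in>UNIV. z i ^ a i) has_sum (\<Prod>i\<in>UNIV. 1 / (1 - z i))) UNIV"
  using has_sum_prod_fun[of "\<lambda>i k. z i ^ k"] has_sum_geometric(1)[OF assms] infsumI[OF has_sum_geometric(2)[OF assms]]
  by simp

section \<open>Cauchy's formula as an average over angles\<close>

definition unit_uniform :: "real measure" where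
  "unit_uniform = density lborel (\<lambda>t. ennreal (indicator {0..1} t))"

lemma sets_unit_uniform [measurable_cong, simp]: "sets unit_uniform = sets borel"
  by (simp add: unit_uniform_def)

lemma space_unit_uniform [simp]: "space unit_uniform = UNIV"
  by (simp add: unit_uniform_def)

lemma emeasure_unit_uniform: "emeasure unit_uniform UNIV = 1"
  by (simp add: unit_uniform_def emeasure_density ennreal_indicator)

interpretation unit_uniform: product_sigma_finite "\<lambda>_. unit_uniform"
proof -
  interpret finite_measure unit_uniform by (rule finite_measureI) (simp add: emeasure_unit_uniform)
  show "product_sigma_finite (\<lambda>_. unit_uniform)" by unfold_locales
qed

lemma finite_measure_PiM_unit_uniform:
  "finite S \<Longrightarrow> finite_measure (\<Pi>\<^sub>M i\<in>S. unit_uniform)"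
proof (rule finite_measureI)
  assume "finite S"
  then have "emeasure (\<Pi>\<^sub>M i\<in>S. unit_uniform) (\<Pi>\<^sub>E i\<in>S. UNIV) = (\<Prod>i\<in>S. emeasure unit_uniform UNIV)"
    by (intro unit_uniform.emeasure_PiM) auto
  then show "emeasure (\<Pi>\<^sub>M i\<in>S. unit_uniform) (space (\<Pi>\<^sub>M i\<in>S. unit_uniform)) \<noteq> \<infinity>"
    by (simp add: space_PiM emeasure_unit_uniform)
qed

abbreviation expi2 :: "real \<Rightarrow> complex" where "expi2 t \<equiv> exp (2 * of_real pi * \<i> * of_real t)"

lemma norm_expi2 [simp]: "norm (expi2 t) = 1"
  using norm_exp_i_times[of "2 * pi * t"] by (simp add: mult_ac)

text \<open>On the circle \<open>u = R * expi2 t\<close> the form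
  \<open>du / (2 * pi * \<i> * (u - z))\<close> becomes \<open>dt / (1 - z / u)\<close>. In this
  shape the kernel is the sum of a geometric series in \<open>z / u\<close>, and integration is
  against a probability measure, which can be iterated as a product.\<close>

lemma Cauchy_unit_uniform:
  assumes h: "h holomorphic_on cball 0 R" and R: "R > 0" and z: "norm z < R"
    and [measurable]: "(\<lambda>t. h (R * expi2 t)) \<in> borel_measurable borel"
  shows "(\<integral>t. h (R * expi2 t) * (1 / (1 - z / (R * expi2 t))) \<partial>unit_uniform) = h z"
proof -
  let ?g = "\<lambda>t. h (R * expi2 t) * (1 / (1 - z / (R * expi2 t)))"
  have cp: "circlepath 0 R t = R * expi2 t" for t by (simp add: circlepath)
  have nz: "complex_of_real R * expi2 t - z \<noteq> 0" for t
    using z R by (metis abs_of_pos diff_eq_diff_eq diff_0_right less_irrefl mult.right_neutral norm_expi2 norm_mult norm_of_real eq_iff_diff_eq_0)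
  have nz': "1 - z / (R * expi2 t) \<noteq> 0" for t
    using nz[of t] R by (auto simp: field_simps)
  have "((\<lambda>u. h u / (u - z)) has_contour_integral (2 * of_real pi * \<i> * h z)) (circlepath 0 R)"
    using assms by (intro Cauchy_integral_circlepath_simple) auto
  then have "((\<lambda>t. h (R * expi2 t) / (R * expi2 t - z) * (2 * of_real pi * \<i> * R * expi2 t)) has_integral (2 * of_real pi * \<i> * h z)) {0..1}"
    unfolding has_contour_integral_def
    by (rule has_integral_eq[rotated]) (simp add: vector_derivative_circlepath01 cp mult_ac)
  then have "((\<lambda>t. (1 / (2 * of_real pi * \<i>)) * (h (R * expi2 t) / (R * expi2 t - z) * (2 * of_real pi * \<i> * R * expi2 t)))
      has_integral ((1 / (2 * of_real pi * \<i>)) * (2 * of_real pi * \<i> * h z))) {0..1}"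
    by (rule has_integral_mult_right)
  then have HI: "(?g has_integral h z) {0..1}"
  proof (rule has_integral_eq_rhs[OF has_integral_eq[rotated]])
    fix t :: real
    show "(1 / (2 * of_real pi * \<i>)) * (h (R * expi2 t) / (R * expi2 t - z) * (2 * of_real pi * \<i> * R * expi2 t)) = ?g t"
      using nz[of t] nz'[of t] R by (simp add: field_simps)
  qed simp
  have cont: "continuous_on {0..1} ?g"
  proof (intro continuous_intros)
    have "continuous_on {0..1} (h \<circ> (\<lambda>t. R * expi2 t))"
      using R by (intro continuous_on_compose continuous_intros continuous_on_subset[OF holomorphic_on_imp_continuous_on[OF h]])
        (auto simp: norm_mult)
    then show "continuous_on {0..1} (\<lambda>t. h (R * expi2 t))" by (simp add: o_def)
  qed (use R nz' in auto)
  then have int: "set_integrable lborel {0..1} ?g"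
    by (rule borel_integrable_atLeastAtMost')
  have "(\<integral>t. ?g t \<partial>unit_uniform) = (\<integral>t. indicator {0..1} t *\<^sub>R ?g t \<partial>lborel)"
    unfolding unit_uniform_def by (rule integral_density) auto
  also have "\<dots> = h z"
    using set_borel_integral_eq_integral(2)[OF int] HI by (simp add: set_lebesgue_integral_def integral_unique)
  finally show ?thesis .
qed


text \<open>Only the coordinates in \<open>S\<close> run over circles, the others stay at
  \<open>p\<close>; the torus formula can thus be built up one coordinate at a time.\<close>

definition torus_pt :: "('N::finite \<Rightarrow> real) \<Rightarrow> 'N set \<Rightarrow> complex^'N \<Rightarrow> ('N \<Rightarrow> real) \<Rightarrow> complex^'N" where
  "torus_pt r S p \<theta> = (\<chi> i. if i \<in> S then of_real (r i) * expi2 (\<theta> i) else p $ i)"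

lemma measurable_torus_pt [measurable]:
  "torus_pt r S p \<in> (\<Pi>\<^sub>M i\<in>S. unit_uniform) \<rightarrow>\<^sub>M borel"
proof -
  have "(\<lambda>\<theta> i. if i \<in> S then of_real (r i) * expi2 (\<theta> i) else p $ i) \<in> (\<Pi>\<^sub>M i\<in>S. unit_uniform) \<rightarrow>\<^sub>M (\<Pi>\<^sub>M i\<in>UNIV. borel)"
  proof (rule measurable_PiM_single')
    fix i
    show "(\<lambda>\<theta>. if i \<in> S then of_real (r i) * expi2 (\<theta> i) else p $ i) \<in> borel_measurable (\<Pi>\<^sub>M i\<in>S. unit_uniform)"
      by (cases "i \<in> S") auto
  qed auto
  from measurable_compose[OF this borel_measurable_vec_lambda] show ?thesis
    unfolding torus_pt_def[abs_def] .
qed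

lemma compact_polydisc: "compact {p :: complex^'N::finite. \<forall>i. cmod (p $ i) \<le> r i}"
  unfolding compact_eq_bounded_closed
proof
  have "norm p \<le> (\<Sum>i\<in>UNIV. r i)" if "\<forall>i. cmod (p $ i) \<le> r i" for p :: "complex^'N"
    using that unfolding norm_vec_def by (intro order_trans[OF L2_set_le_sum] sum_mono) auto
  then show "bounded {p :: complex^'N. \<forall>i. cmod (p $ i) \<le> r i}" by (auto simp: bounded_iff)
  show "closed {p :: complex^'N. \<forall>i. cmod (p $ i) \<le> r i}"
    by (intro closed_Collect_all closed_Collect_le continuous_intros)
qed

locale polydisc_holo =
  fixes D :: "(complex^'N::finite) set" and f :: "complex^'N \<Rightarrow> complex" and r :: "'N \<Rightarrow> real"
  assumes D: "open D" and f: "holo_on D f" and r: "\<And>i. r i > 0"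
    and sub: "{p. \<forall>i. cmod (p $ i) \<le> r i} \<subseteq> D"
begin

text \<open>Extension by zero gives a Borel function on the whole space, which can be composed with
  \<open>torus_pt\<close> under the product measure. On the closed polydisc it agrees with
  \<open>f\<close>.\<close>

definition f' :: "complex^'N \<Rightarrow> complex" where "f' p = indicator D p *\<^sub>R f p"

lemma f'_measurable [measurable]: "f' \<in> borel_measurable borel"
  unfolding f'_def[abs_def] using D holo_on_continuous[OF f]
  by (intro borel_measurable_continuous_on_indicator) auto

lemma f'_eq: "(\<And>i. cmod (p $ i) \<le> r i) \<Longrightarrow> f' p = f p"
  using subsetD[OF sub, of p] by (simp add: f'_def)

lemma f'_bounded: "\<exists>B. \<forall>p. (\<forall>i. cmod (p $ i) \<le> r i) \<longrightarrow> cmod (f' p) \<le> B"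
proof -
  have "bounded (f ` {p. \<forall>i. cmod (p $ i) \<le> r i})"
    using sub holo_on_continuous[OF f]
    by (intro compact_imp_bounded compact_continuous_image compact_polydisc) (rule continuous_on_subset)
  then obtain B where "\<forall>x\<in>f ` {p. \<forall>i. cmod (p $ i) \<le> r i}. cmod x \<le> B" by (auto simp: bounded_iff)
  then show ?thesis using f'_eq by (intro exI[of _ B]) auto
qed

lemma torus_pt_in: "(\<And>i. cmod (p $ i) \<le> r i) \<Longrightarrow> cmod (torus_pt r S p \<theta> $ i) \<le> r i"
  using r[of i] by (auto simp: torus_pt_def norm_mult)

lemma integrable_torus:
  assumes p: "\<And>i. cmod (p $ i) \<le> r i" and K: "K \<in> borel_measurable (\<Pi>\<^sub>M i\<in>S. unit_uniform)"
     "\<And>\<theta>. cmod (K \<theta>) \<le> C"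
  shows "integrable (\<Pi>\<^sub>M i\<in>S. unit_uniform) (\<lambda>\<theta>. f' (torus_pt r S p \<theta>) * K \<theta>)"
proof -
  interpret finite_measure "\<Pi>\<^sub>M i\<in>S. unit_uniform" by (rule finite_measure_PiM_unit_uniform) simp
  obtain B where B: "\<And>p. (\<And>i. cmod (p $ i) \<le> r i) \<Longrightarrow> cmod (f' p) \<le> B" using f'_bounded by blast
  show ?thesis
  proof (rule integrable_const_bound[of _ "B * C"])
    show "AE \<theta> in \<Pi>\<^sub>M i\<in>S. unit_uniform. cmod (f' (torus_pt r S p \<theta>) * K \<theta>) \<le> B * C"
      unfolding norm_mult using B[OF torus_pt_in[OF p]] K(2)
      by (intro always_eventually allI mult_mono') auto
  qed (use K(1) in measurable)
qed

lemma kernel_bound: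
  assumes p: "cmod z < R"
  shows "cmod (1 / (1 - z / (R * expi2 t))) \<le> 1 / (1 - cmod z / R)"
proof -
  have R: "R > 0" using p norm_ge_zero[of z] by linarith
  have "cmod (z / (R * expi2 t)) = cmod z / R" using R by (simp add: norm_divide norm_mult)
  moreover have "cmod z / R < 1" using p R by simp
  ultimately show ?thesis
    using norm_triangle_ineq2[of 1 "z / (R * expi2 t)"] by (auto simp: norm_divide intro!: divide_left_mono mult_pos_pos)
qed

text \<open>Fubini isolates the new coordinate \<open>j\<close>. For fixed other angles its integral
  is the one-variable formula on the complex line through \<open>q\<close> in direction
  \<open>axis j 1\<close>.\<close>

lemma Cauchy_torus:
  assumes p: "\<And>i. cmod (p $ i) < r i"
  shows "f p = (\<integral>\<theta>. f' (torus_pt r S p \<theta>) * (\<Prod>i\<in>S. 1 / (1 - p $ i / (r i * expi2 (\<theta> i)))) \<partial>(\<Pi>\<^sub>M i\<in>S. unit_uniform))"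
  using finite[of S]
proof (induction S rule: finite_induct)
  case empty
  have "torus_pt r {} p \<theta> = p" for \<theta> by (simp add: torus_pt_def vec_eq_iff)
  then show ?case using p by (simp add: PiM_empty lebesgue_integral_count_space_finite f'_eq less_imp_le)
next
  case (insert j S)
  let ?K = "\<lambda>S \<theta>. \<Prod>i\<in>S. 1 / (1 - p $ i / (r i * expi2 (\<theta> i)))"
  have Kb: "cmod (?K S \<theta>) \<le> (\<Prod>i\<in>S. 1 / (1 - cmod (p $ i) / r i))" for S \<theta>
    unfolding prod_norm[symmetric] using kernel_bound[OF p] by (intro prod_mono) auto
  have p': "cmod (p $ i) \<le> r i" for i using p[of i] by simp
  have "(\<integral>\<theta>. f' (torus_pt r (insert j S) p \<theta>) * ?K (insert j S) \<theta> \<partial>(\<Pi>\<^sub>M i\<in>insert j S. unit_uniform))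
     = (\<integral>\<theta>. \<integral>y. f' (torus_pt r (insert j S) p (\<theta>(j := y))) * ?K (insert j S) (\<theta>(j := y)) \<partial>unit_uniform \<partial>(\<Pi>\<^sub>M i\<in>S. unit_uniform))"
    by (rule unit_uniform.product_integral_insert[OF insert.hyps(1,2) integrable_torus[OF p' _ Kb]]) measurable
  also have "\<dots> = (\<integral>\<theta>. f' (torus_pt r S p \<theta>) * ?K S \<theta> \<partial>(\<Pi>\<^sub>M i\<in>S. unit_uniform))"
  proof (rule Bochner_Integration.integral_cong[OF refl])
    fix \<theta> assume "\<theta> \<in> space (\<Pi>\<^sub>M i\<in>S. unit_uniform)"
    \<comment> \<open>The torus point with coordinate \<open>j\<close> set to zero, so that the
      parameter of the line is that coordinate itself.\<close>
    define q where "q = torus_pt r S p \<theta> + (- p $ j) *s axis j 1"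
    define h where "h z = f' (q + z *s axis j 1)" for z
    have q: "(q + z *s axis j 1) $ i = (if i = j then z else torus_pt r S p \<theta> $ i)" for z i
      using insert.hyps by (auto simp: q_def torus_pt_def axis_def)
    have q_in: "cmod ((q + z *s axis j 1) $ i) \<le> r i" if "cmod z \<le> r j" for z i
      unfolding q using that torus_pt_in[OF p'] by auto
    have pt: "torus_pt r (insert j S) p (\<theta>(j := y)) = q + (r j * expi2 y) *s axis j 1" for y
      unfolding vec_eq_iff q using insert.hyps by (auto simp: torus_pt_def)
    have pt': "torus_pt r S p \<theta> = q + (p $ j) *s axis j 1"
      unfolding vec_eq_iff q using insert.hyps by (auto simp: torus_pt_def)
    have K: "?K (insert j S) (\<theta>(j := y)) = 1 / (1 - p $ j / (r j * expi2 y)) * ?K S \<theta>" for y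
      using insert.hyps by (simp add: prod.insert_if) (intro disjI2 prod.cong, auto)
    have "h holomorphic_on cball 0 (r j)"
    proof (rule holomorphic_transform)
      show "(\<lambda>z. f (q + z *s axis j 1)) holomorphic_on cball 0 (r j)"
        using q_in sub by (intro holo_on_line(1)[OF f]) auto
    qed (use q_in in \<open>auto simp: h_def f'_eq\<close>)
    moreover have [measurable]: "(\<lambda>y. h (r j * expi2 y)) \<in> borel_measurable borel"
    proof -
      have "(\<lambda>y. q + (r j * expi2 y) *s axis j 1) = (\<lambda>y. \<chi> i. q $ i + (r j * expi2 y) * axis j 1 $ i)"
        by (simp add: fun_eq_iff vec_eq_iff)
      also have "\<dots> \<in> borel_measurable borel"
        by (intro borel_measurable_continuous_onI continuous_on_vec_lambda continuous_intros)
      finally show ?thesis unfolding h_def by measurable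
    qed
    ultimately have C: "(\<integral>y. h (r j * expi2 y) * (1 / (1 - p $ j / (r j * expi2 y))) \<partial>unit_uniform) = h (p $ j)"
      using r[of j] p[of j] by (intro Cauchy_unit_uniform) auto
    have "(\<integral>y. f' (torus_pt r (insert j S) p (\<theta>(j := y))) * ?K (insert j S) (\<theta>(j := y)) \<partial>unit_uniform)
       = (\<integral>y. (h (r j * expi2 y) * (1 / (1 - p $ j / (r j * expi2 y)))) * ?K S \<theta> \<partial>unit_uniform)"
      unfolding K pt h_def by (simp only: mult.assoc)
    also have "\<dots> = h (p $ j) * ?K S \<theta>"
      unfolding C[symmetric] by (rule integral_mult_left_zero)
    finally show "(\<integral>y. f' (torus_pt r (insert j S) p (\<theta>(j := y))) * ?K (insert j S) (\<theta>(j := y)) \<partial>unit_uniform)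
       = f' (torus_pt r S p \<theta>) * ?K S \<theta>" unfolding h_def pt'[symmetric] .
  qed
  finally show ?case using insert.IH by simp
qed

theorem power_series:
  "\<exists>c. \<forall>p. (\<forall>i. cmod (p $ i) < r i) \<longrightarrow> ((\<lambda>a. c a * mon p a) has_sum f p) UNIV"
proof (intro exI allI impI)
  let ?M = "\<Pi>\<^sub>M i\<in>(UNIV :: 'N set). unit_uniform"
  interpret finite_measure ?M by (rule finite_measure_PiM_unit_uniform) simp
  let ?c = "\<lambda>a. \<integral>\<theta>. f' (torus_pt r UNIV 0 \<theta>) * (\<Prod>i\<in>UNIV. (1 / (r i * expi2 (\<theta> i))) ^ a i) \<partial>?M"
  fix p :: "complex^'N" assume "\<forall>i. cmod (p $ i) < r i"
  then have p: "cmod (p $ i) < r i" for i by blast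
  \<comment> \<open>With every coordinate on the torus the point no longer depends on
    \<open>p\<close>, and this is why the coefficients \<open>?c\<close> serve all \<open>p\<close>
    in the polydisc.\<close>
  have pt: "torus_pt r UNIV p = torus_pt r UNIV 0" by (simp add: torus_pt_def fun_eq_iff)
  let ?f = "\<lambda>\<theta>. f' (torus_pt r UNIV 0 \<theta>)" and ?z = "\<lambda>\<theta> i. p $ i / (r i * expi2 (\<theta> i))"
  obtain B where B: "\<And>p. (\<And>i. cmod (p $ i) \<le> r i) \<Longrightarrow> cmod (f' p) \<le> B" using f'_bounded by blast
  have fB: "cmod (?f \<theta>) \<le> B" for \<theta>
    using r by (intro B torus_pt_in) (auto intro: less_imp_le)
  have nz: "cmod (?z \<theta> i) = cmod (p $ i) / r i" for \<theta> i using r[of i] by (simp add: norm_divide norm_mult)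
  have lt: "cmod (p $ i) / r i < 1" for i using r[of i] p[of i] by simp
  have "((\<lambda>a. \<integral>\<theta>. ?f \<theta> * (\<Prod>i\<in>UNIV. ?z \<theta> i ^ a i) \<partial>?M) has_sum (\<integral>\<theta>. ?f \<theta> * (\<Prod>i\<in>UNIV. 1 / (1 - ?z \<theta> i)) \<partial>?M)) UNIV"
  proof (rule has_sum_integral_dominated)
    \<comment> \<open>The ratio \<open>?z \<theta> i\<close> has modulus
      \<open>cmod (p $ i) / r i\<close> for every angle, so one geometric series dominates on the
      whole torus and \<open>?C\<close> is its sum.\<close>
    let ?C = "\<Prod>i\<in>UNIV. 1 / (1 - cmod (p $ i) / r i)"
    show "integrable ?M (\<lambda>_. B * ?C)" by simp
    show "(\<lambda>\<theta>. ?f \<theta> * (\<Prod>i\<in>UNIV. ?z \<theta> i ^ a i)) \<in> borel_measurable ?M" for a by measurable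
    fix \<theta>
    show "((\<lambda>a. ?f \<theta> * (\<Prod>i\<in>UNIV. ?z \<theta> i ^ a i)) has_sum ?f \<theta> * (\<Prod>i\<in>UNIV. 1 / (1 - ?z \<theta> i))) UNIV"
      by (intro has_sum_cmult_right has_sum_geometric_multi) (simp only: nz lt)
    fix F :: "('N \<Rightarrow> nat) set" assume F: "finite F"
    have hs: "((\<lambda>a. \<Prod>i\<in>UNIV. (cmod (p $ i) / r i) ^ a i) has_sum ?C) UNIV"
      using lt r by (intro has_sum_geometric_multi) (simp add: less_imp_le abs_of_nonneg)
    have nn: "0 \<le> (\<Prod>i\<in>UNIV. (cmod (p $ i) / r i) ^ a i)" for a
      using r by (intro prod_nonneg ballI zero_le_power divide_nonneg_pos) auto
    have "(\<Sum>a\<in>F. cmod (?f \<theta> * (\<Prod>i\<in>UNIV. ?z \<theta> i ^ a i))) = cmod (?f \<theta>) * (\<Sum>a\<in>F. \<Prod>i\<in>UNIV. (cmod (p $ i) / r i) ^ a i)"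
      by (simp only: norm_mult prod_norm[symmetric] norm_power nz sum_distrib_left)
    also have "\<dots> \<le> B * ?C"
    proof (rule mult_mono)
      show "(\<Sum>a\<in>F. \<Prod>i\<in>UNIV. (cmod (p $ i) / r i) ^ a i) \<le> ?C"
        using nn by (intro has_sum_mono2[OF has_sum_finite[OF F] hs]) auto
      show "0 \<le> B" using fB[of \<theta>] norm_ge_zero[of "?f \<theta>"] by linarith
    qed (use fB nn in \<open>auto intro!: sum_nonneg\<close>)
    finally show "(\<Sum>a\<in>F. cmod (?f \<theta> * (\<Prod>i\<in>UNIV. ?z \<theta> i ^ a i))) \<le> B * ?C" .
  qed
  moreover have "(\<integral>\<theta>. ?f \<theta> * (\<Prod>i\<in>UNIV. 1 / (1 - ?z \<theta> i)) \<partial>?M) = f p"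
    using Cauchy_torus[OF p, of UNIV] by (simp only: pt)
  moreover have "(\<integral>\<theta>. ?f \<theta> * (\<Prod>i\<in>UNIV. ?z \<theta> i ^ a i) \<partial>?M) = ?c a * mon p a" for a
  proof -
    have "(\<Prod>i\<in>UNIV. ?z \<theta> i ^ a i) = (\<Prod>i\<in>UNIV. (1 / (r i * expi2 (\<theta> i))) ^ a i) * mon p a" for \<theta>
      unfolding mon_def prod.distrib[symmetric] power_mult_distrib[symmetric] by simp
    then show ?thesis by (simp only: mult.assoc[symmetric] integral_mult_left_zero)
  qed
  ultimately show "((\<lambda>a. ?c a * mon p a) has_sum f p) UNIV" by simp
qed

end

section \<open>Reproducing kernels on complete Reinhardt domains\<close>

lemma integral_pos_open:
  fixes g :: "'a::euclidean_space \<Rightarrow> real"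
  assumes g: "integrable lborel g" "\<And>x. g x \<ge> 0" and U: "open U" "U \<noteq> {}" "\<And>x. x \<in> U \<Longrightarrow> g x > 0"
  shows "(\<integral>x. g x \<partial>lborel) > 0"
proof -
  have "(\<integral>x. g x \<partial>lborel) \<noteq> 0"
  proof
    assume "(\<integral>x. g x \<partial>lborel) = 0"
    then have "AE x in lborel. g x = 0"
      using g by (simp add: integral_nonneg_eq_0_iff_AE)
    then have "AE x in lborel. x \<notin> U" by eventually_elim (use U(3) in force)
    then have "U \<in> null_sets lborel" using U(1) by (simp add: AE_iff_null_sets)
    then show False using open_not_negligible[OF U(1,2)]
      by (metis negligible_iff_null_sets null_sets_completionI)
  qed
  moreover have "(\<integral>x. g x \<partial>lborel) \<ge> 0" using g(2) by simp
  ultimately show ?thesis by simp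
qed

section \<open>Monomials, their orthogonality and the recovery of coefficients\<close>

lemma continuous_on_mon [continuous_intros]: "continuous_on S (\<lambda>p. mon p a)"
  using holo_on_continuous[OF holo_on_mon] .

lemma borel_measurable_mon [measurable]: "(\<lambda>p. mon p a) \<in> borel_measurable borel"
  by (intro borel_measurable_continuous_onI continuous_intros)

lemma cmod_mon: "cmod (mon p a) = (\<Prod>i\<in>UNIV. cmod (p $ i) ^ a i)"
  by (simp add: mon_def prod_norm[symmetric] norm_power)

lemma mon_0 [simp]: "mon p (\<lambda>_. 0) = 1"
  by (simp add: mon_def)

lemma mon_eq_0_iff: "mon p a = 0 \<longleftrightarrow> (\<exists>i. p $ i = 0 \<and> a i \<noteq> 0)"
  by (auto simp: mon_def)

lemma cmod_mon_mono: "(\<And>i. cmod (p $ i) \<le> cmod (q $ i)) \<Longrightarrow> cmod (mon p a) \<le> cmod (mon q a)"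
  unfolding cmod_mon by (intro prod_mono conjI power_mono) auto

definition torus_invariant :: "(complex^'N::finite \<Rightarrow> real) \<Rightarrow> bool" where
  "torus_invariant X \<longleftrightarrow> (\<forall>p q. (\<forall>i. cmod (p $ i) = cmod (q $ i)) \<longrightarrow> X p = X q)"

lemma torus_invariant_cmod_mon: "torus_invariant (\<lambda>p. cmod (mon p a))"
  by (auto simp: torus_invariant_def cmod_mon)

lemma borel_measurable_cnj [measurable (raw)]:
  "f \<in> borel_measurable M \<Longrightarrow> (\<lambda>x. cnj (f x)) \<in> borel_measurable M"
  by (rule measurable_compose[OF _ borel_measurable_continuous_onI]) (auto intro: continuous_intros)

lemma mon_orthogonal:
  assumes X: "X \<in> borel_measurable borel" "torus_invariant X" and ab: "a \<noteq> b"
  shows "(\<integral>p. mon p a * (cnj (mon p b) * of_real (X p)) \<partial>lborel) = 0"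
proof -
  from ab obtain j where j: "a j \<noteq> b j" by auto
  \<comment> \<open>With this angle the rotation multiplies the integrand by \<open>-1\<close>, so
    the integral equals its own negative.\<close>
  define \<phi> where "\<phi> = pi / (real (a j) - real (b j))"
  define c where "c i = (if i = j then cis \<phi> else 1)" for i
  have c: "cmod (c i) = 1" for i by (simp add: c_def)
  define T where "T p = (\<chi> i. c i * p $ i)" for p :: "complex^'a"
  have mon_T: "mon (T p) d = (\<Prod>i\<in>UNIV. c i ^ d i) * mon p d" for p d
    by (simp add: mon_def T_def power_mult_distrib prod.distrib)
  have cis_pow: "cis \<phi> ^ k = cis (\<phi> * k)" for k
    using Complex.DeMoivre[of \<phi> k] by (simp add: mult.commute)
  have prod_c: "(\<Prod>i\<in>UNIV. c i ^ d i) = cis (\<phi> * d j)" for d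
  proof -
    have "(\<Prod>i\<in>UNIV. c i ^ d i) = (\<Prod>i\<in>UNIV. if i = j then cis (\<phi> * d j) else 1)"
      by (intro prod.cong) (auto simp: c_def cis_pow)
    then show ?thesis by simp
  qed
  have "cis (\<phi> * a j) * cnj (cis (\<phi> * b j)) = cis (\<phi> * (real (a j) - real (b j)))"
    by (simp add: cis_cnj cis_mult algebra_simps)
  also have "\<dots> = -1" using j by (simp add: \<phi>_def)
  finally have m1: "cis (\<phi> * a j) * cnj (cis (\<phi> * b j)) = -1" .
  have XT: "X (T p) = X p" for p
    by (rule X(2)[unfolded torus_invariant_def, rule_format]) (simp add: T_def norm_mult c)
  have distr: "distr lborel borel T = lborel"
    unfolding T_def[abs_def] by (rule lborel_distr_coordinatewise) (auto simp: c lborel_distr_unit_mult)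
  have [measurable]: "T \<in> borel_measurable borel"
    unfolding T_def[abs_def] by (intro borel_measurable_continuous_onI continuous_on_vec_lambda continuous_intros)
  let ?F = "\<lambda>p. mon p a * (cnj (mon p b) * of_real (X p))"
  note X(1)[measurable]
  have [measurable]: "?F \<in> borel_measurable borel" by measurable
  have "(\<integral>p. ?F p \<partial>lborel) = (\<integral>p. ?F p \<partial>distr lborel borel T)" by (simp only: distr)
  also have "\<dots> = (\<integral>p. ?F (T p) \<partial>lborel)" by (rule integral_distr) auto
  also have "\<dots> = (\<integral>p. (cis (\<phi> * a j) * cnj (cis (\<phi> * b j))) * ?F p \<partial>lborel)"
    by (simp add: mon_T prod_c XT mult_ac)
  also have "\<dots> = - (\<integral>p. ?F p \<partial>lborel)" unfolding m1 by simp
  finally have *: "(\<integral>p. ?F p \<partial>lborel) = - (\<integral>p. ?F p \<partial>lborel)" .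
  have "z = - z \<Longrightarrow> z = 0" for z :: complex by (simp add: complex_eq_iff)
  from this[OF *] show ?thesis .
qed

text \<open>Where \<open>X\<close> is nonzero, all absolute partial sums share the bound
  \<open>B\<close>; hence \<open>B * (cmod (mon p b) * X p)\<close> dominates, the series may be
  integrated term by term, and orthogonality keeps the term \<open>b\<close> only. The full weight
  need not come with such a bound, so \<open>X\<close> will be a cut-off.\<close>

lemma mon_coefficient:
  assumes X: "X \<in> borel_measurable borel" "torus_invariant X" "\<And>p. X p \<ge> 0"
    and int: "integrable lborel (\<lambda>p. cmod (mon p b) * X p)"
    and sums: "\<And>p. X p \<noteq> 0 \<Longrightarrow> ((\<lambda>a. c a * mon p a) has_sum f p) UNIV"
    and bd: "\<And>p F. X p \<noteq> 0 \<Longrightarrow> finite F \<Longrightarrow> (\<Sum>a\<in>F. cmod (c a * mon p a)) \<le> B"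
  shows "(\<integral>p. f p * (cnj (mon p b) * of_real (X p)) \<partial>lborel) = c b * of_real (\<integral>p. (cmod (mon p b))\<^sup>2 * X p \<partial>lborel)"
proof -
  note X(1)[measurable]
  have "((\<lambda>a. \<integral>p. c a * mon p a * (cnj (mon p b) * of_real (X p)) \<partial>lborel)
      has_sum (\<integral>p. f p * (cnj (mon p b) * of_real (X p)) \<partial>lborel)) UNIV"
  proof (rule has_sum_integral_dominated)
    show "integrable lborel (\<lambda>p. B * (cmod (mon p b) * X p))" using int by simp
    show "(\<lambda>p. c a * mon p a * (cnj (mon p b) * of_real (X p))) \<in> borel_measurable lborel" for a
      by measurable
    fix p
    show "((\<lambda>a. c a * mon p a * (cnj (mon p b) * of_real (X p))) has_sum f p * (cnj (mon p b) * of_real (X p))) UNIV"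
      using sums[of p] by (cases "X p = 0") (auto intro: has_sum_cmult_left)
    fix F :: "('a \<Rightarrow> nat) set" assume F: "finite F"
    have "(\<Sum>a\<in>F. cmod (c a * mon p a * (cnj (mon p b) * of_real (X p)))) = (\<Sum>a\<in>F. cmod (c a * mon p a)) * (cmod (mon p b) * X p)"
      using X(3)[of p] by (simp add: norm_mult sum_distrib_right sum_distrib_left mult_ac)
    also have "\<dots> \<le> B * (cmod (mon p b) * X p)"
      using bd[OF _ F, of p] X(3)[of p] by (cases "X p = 0") (auto intro!: mult_right_mono)
    finally show "(\<Sum>a\<in>F. cmod (c a * mon p a * (cnj (mon p b) * of_real (X p)))) \<le> B * (cmod (mon p b) * X p)" .
  qed
  moreover have "((\<lambda>a. \<integral>p. c a * mon p a * (cnj (mon p b) * of_real (X p)) \<partial>lborel)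
      has_sum c b * of_real (\<integral>p. (cmod (mon p b))\<^sup>2 * X p \<partial>lborel)) UNIV"
  proof (rule has_sum_finite_neutralI[of "{b}"])
    show "(\<integral>p. c a * mon p a * (cnj (mon p b) * of_real (X p)) \<partial>lborel) = 0" if "a \<in> UNIV - {b}" for a
      using mon_orthogonal[OF X(1,2), of a b] that by (simp add: mult.assoc)
    have "(\<integral>p. c b * mon p b * (cnj (mon p b) * of_real (X p)) \<partial>lborel)
        = (\<integral>p. c b * of_real ((cmod (mon p b))\<^sup>2 * X p) \<partial>lborel)"
      by (intro Bochner_Integration.integral_cong) (simp_all only: of_real_mult complex_norm_square mult_ac)
    also have "\<dots> = c b * of_real (\<integral>p. (cmod (mon p b))\<^sup>2 * X p \<partial>lborel)"
      by (simp only: integral_mult_right_zero integral_complex_of_real)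
    finally show "c b * of_real (\<integral>p. (cmod (mon p b))\<^sup>2 * X p \<partial>lborel)
       = (\<Sum>a\<in>{b}. \<integral>p. c a * mon p a * (cnj (mon p b) * of_real (X p)) \<partial>lborel)" by simp
  qed auto
  ultimately show ?thesis by (rule has_sum_unique)
qed

lemma abs_has_sum_bounded_sums:
  fixes g :: "'a \<Rightarrow> complex"
  assumes "(g has_sum s) UNIV"
  obtains B where "B \<ge> 0" "\<And>F. finite F \<Longrightarrow> (\<Sum>a\<in>F. cmod (g a)) \<le> B"
proof -
  have "(\<lambda>a. cmod (g a)) summable_on UNIV"
    using assms by (simp add: has_sum_imp_summable flip: summable_on_iff_abs_summable_on_complex)
  then show ?thesis
    by (intro that[of "\<Sum>\<^sub>\<infinity>a. cmod (g a)"] infsum_nonneg finite_sum_le_infsum) auto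
qed

text \<open>Both families of coefficients are given by the same integrals against the indicator of
  the polydisc of half radii. There the absolute sums are bounded by those at the corner
  \<open>p0\<close>, where the series converges absolutely, and the squared norm of each monomial is
  positive.\<close>

lemma power_series_unique:
  assumes r: "\<And>i. r i > 0"
    and c: "\<And>p. (\<And>i. cmod (p $ i) < r i) \<Longrightarrow> ((\<lambda>a. c a * mon p a) has_sum f p) UNIV"
    and c': "\<And>p. (\<And>i. cmod (p $ i) < r i) \<Longrightarrow> ((\<lambda>a. c' a * mon p a) has_sum f p) UNIV"
  shows "c = c'"
proof
  fix b
  let ?P = "{p :: complex^'a. \<forall>i. cmod (p $ i) \<le> r i / 2}"
  define X where "X = (indicator ?P :: complex^'a \<Rightarrow> real)"
  have "?P \<in> sets borel" using compact_polydisc by (rule borel_compact)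
  then have Xm: "X \<in> borel_measurable borel" by (simp add: X_def)
  have Xi: "torus_invariant X" by (simp add: X_def torus_invariant_def indicator_def)
  have X0: "X p \<ge> 0" for p by (simp add: X_def)
  have P: "cmod (p $ i) < r i" if "X p \<noteq> 0" for p i
  proof -
    have "cmod (p $ i) \<le> r i / 2" using that by (auto simp: X_def split: split_indicator_asm)
    then show ?thesis using r[of i] by simp
  qed
  have int: "integrable lborel (\<lambda>p. g p * X p)" if "continuous_on UNIV g" for g
    using borel_integrable_compact[OF compact_polydisc[of "\<lambda>i. r i / 2"] continuous_on_subset[OF that]]
    by (simp add: X_def mult.commute[of _ "indicator _ _"] del: le_divide_eq_numeral1)
  define p0 where "p0 = (\<chi> i. complex_of_real (r i / 2))"
  have eq: "(\<integral>p. f p * (cnj (mon p b) * of_real (X p)) \<partial>lborel) = c b * of_real (\<integral>p. (cmod (mon p b))\<^sup>2 * X p \<partial>lborel)"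
    if c: "\<And>p. (\<And>i. cmod (p $ i) < r i) \<Longrightarrow> ((\<lambda>a. c a * mon p a) has_sum f p) UNIV" for c
  proof -
    have "cmod (p0 $ i) < r i" for i using r[of i] by (simp add: p0_def)
    from abs_has_sum_bounded_sums[OF c[OF this]] obtain B
      where B: "\<And>F. finite F \<Longrightarrow> (\<Sum>a\<in>F. cmod (c a * mon p0 a)) \<le> B" by metis
    show ?thesis
    proof (rule mon_coefficient[OF Xm Xi X0 int c])
      fix p and F :: "('a \<Rightarrow> nat) set" assume "X p \<noteq> 0" and F: "finite F"
      then have p: "cmod (p $ i) \<le> cmod (p0 $ i)" for i
        using r[of i] by (auto simp: X_def p0_def split: split_indicator_asm)
      have "(\<Sum>a\<in>F. cmod (c a * mon p a)) \<le> (\<Sum>a\<in>F. cmod (c a * mon p0 a))"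
        unfolding norm_mult by (intro sum_mono mult_left_mono cmod_mon_mono p) auto
      also have "\<dots> \<le> B" by (rule B[OF F])
      finally show "(\<Sum>a\<in>F. cmod (c a * mon p a)) \<le> B" .
    qed (use P in \<open>auto intro!: continuous_intros\<close>)
  qed
  have "(\<integral>p. (cmod (mon p b))\<^sup>2 * X p \<partial>lborel) > 0"
  proof (rule integral_pos_open)
    let ?U = "{p :: complex^'a. \<forall>i. 0 < cmod (p $ i) \<and> cmod (p $ i) < r i / 2}"
    show "open ?U" 
      unfolding Collect_all_eq by (intro open_INT ballI finite open_Collect_conj open_Collect_less continuous_intros)
    have "(\<chi> i. complex_of_real (r i / 4)) \<in> ?U" using r by (simp add: less_le)
    then show "?U \<noteq> {}" by blast
    show "(cmod (mon p b))\<^sup>2 * X p > 0" if "p \<in> ?U" for p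
      using that by (auto simp: X_def mon_eq_0_iff less_imp_le)
  qed (use X0 in \<open>auto intro!: int continuous_intros\<close>)
  then show "c b = c' b" using eq[OF c] eq[OF c'] by simp
qed


text \<open>\<open>W\<close> is constrained on \<open>D\<close> only: the intended
  \<open>weight\<close> is made of derivatives and a logarithm without meaning off the domain, and
  multiplying by the indicator yields the globally usable \<open>V\<close>. \<open>moments\<close>
  puts every monomial into the space and, for the zero exponent, makes the weight
  integrable.\<close>

locale reinhardt_weight =
  fixes D :: "(complex^'N::finite) set" and W :: "complex^'N \<Rightarrow> real"
  assumes D: "open D" "0 \<in> D"
    and complete: "\<And>p q. p \<in> D \<Longrightarrow> (\<And>i. cmod (q $ i) \<le> cmod (p $ i)) \<Longrightarrow> q \<in> D"
    and W_pos: "\<And>p. p \<in> D \<Longrightarrow> W p > 0"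
    and W_meas: "(\<lambda>p. indicator D p * W p) \<in> borel_measurable borel"
    and W_inv: "\<And>p q. p \<in> D \<Longrightarrow> (\<And>i. cmod (q $ i) = cmod (p $ i)) \<Longrightarrow> W q = W p"
    and moments: "\<And>a. integrable lborel (\<lambda>p. (cmod (mon p a))\<^sup>2 * (indicator D p * W p))"
begin

definition V :: "complex^'N \<Rightarrow> real" where "V p = indicator D p * W p"

lemma V_meas [measurable]: "V \<in> borel_measurable borel"
  using W_meas by (simp add: V_def[abs_def])

lemma V_nonneg: "V p \<ge> 0"
  using W_pos[of p] by (auto simp: V_def less_imp_le split: split_indicator)

lemma V_nz_iff: "V p \<noteq> 0 \<longleftrightarrow> p \<in> D"
  using W_pos[of p] by (auto simp: V_def split: split_indicator)

lemma V_inv: "torus_invariant V"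
  unfolding torus_invariant_def
proof (intro allI impI)
  fix p q :: "complex^'N" assume pq: "\<forall>i. cmod (p $ i) = cmod (q $ i)"
  then have "p \<in> D \<longleftrightarrow> q \<in> D" using complete[of p q] complete[of q p] by auto
  then show "V p = V q" using W_inv[of p q] pq by (auto simp: V_def split: split_indicator)
qed

lemma D_borel [measurable]: "D \<in> sets borel"
  using D(1) by (rule borel_open)

definition N :: "('N \<Rightarrow> nat) \<Rightarrow> real" where
  "N a = (\<integral>p. (cmod (mon p a))\<^sup>2 * V p \<partial>lborel)"

lemma N_int: "integrable lborel (\<lambda>p. (cmod (mon p a))\<^sup>2 * V p)"
  using moments[of a] by (simp add: V_def)

lemma V_int: "integrable lborel V"
  using N_int[of "\<lambda>_. 0"] by simp

lemma mon_int: "integrable lborel (\<lambda>p. cmod (mon p a) * V p)"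
proof (rule Bochner_Integration.integrable_bound)
  show "integrable lborel (\<lambda>p. (cmod (mon p a))\<^sup>2 * V p + V p)"
    by (intro Bochner_Integration.integrable_add N_int V_int)
  have "x \<le> x\<^sup>2 + 1" for x :: real using zero_le_power2[of "x - 1/2"] by (simp add: power2_eq_square algebra_simps)
  then have "cmod (mon p a) * V p \<le> (cmod (mon p a))\<^sup>2 * V p + V p" for p
    using mult_right_mono[OF _ V_nonneg, of "cmod (mon p a)" "(cmod (mon p a))\<^sup>2 + 1" p] by (simp add: algebra_simps)
  then show "AE p in lborel. norm (cmod (mon p a) * V p) \<le> norm ((cmod (mon p a))\<^sup>2 * V p + V p)"
    using V_nonneg by (intro always_eventually allI) simp
qed measurable

text \<open>Completeness puts the vector of moduli of \<open>p\<close> into \<open>D\<close>, and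
  openness leaves room to enlarge every modulus. The corner with coordinates \<open>r i\<close> is
  itself a point of \<open>D\<close>, so series on the polydisc can be majorised by their terms
  there.\<close>

lemma larger_polyradius:
  assumes "p \<in> D"
  obtains r where "\<And>i. cmod (p $ i) < r i" "{q. \<forall>i. cmod (q $ i) \<le> r i} \<subseteq> D" "(\<chi> i. complex_of_real (r i)) \<in> D"
proof -
  define p' where "p' = (\<chi> i. complex_of_real (cmod (p $ i)))"
  have "p' \<in> D" by (rule complete[OF assms]) (simp add: p'_def)
  then obtain e where e: "e > 0" "ball p' e \<subseteq> D" using D(1) open_contains_ball by blast
  \<comment> \<open>The corner differs from \<open>p'\<close> by \<open>d\<close> in each
    coordinate, and the sum of these \<open>CARD('N)\<close> shifts stays below
    \<open>e / 2\<close>.\<close>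
  define d where "d = e / (2 * (real CARD('N) + 1))"
  have d: "d > 0" using e by (simp add: d_def)
  define r where "r i = cmod (p $ i) + d" for i
  have r0: "r i \<ge> 0" for i using d by (simp add: r_def)
  have "norm ((\<chi> i. complex_of_real (r i)) - p') \<le> (\<Sum>i\<in>(UNIV :: 'N set). d)"
    unfolding norm_vec_def using d
    by (intro order_trans[OF L2_set_le_sum] sum_mono) (auto simp: p'_def r_def simp flip: of_real_diff)
  also have "\<dots> < e" using e by (simp add: d_def pos_divide_less_eq add_pos_nonneg algebra_simps)
  finally have R: "(\<chi> i. complex_of_real (r i)) \<in> D"
    using e(2) by (auto simp: dist_norm norm_minus_commute subset_eq)
  show ?thesis
  proof (rule that[of r])
    show "{q. \<forall>i. cmod (q $ i) \<le> r i} \<subseteq> D"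
      using r0 by (auto intro!: complete[OF R])
  qed (use d R in \<open>auto simp: r_def\<close>)
qed

lemma N_pos_general:
  assumes "A \<in> sets borel" "open U" "U \<noteq> {}" "U \<subseteq> A \<inter> D" "\<And>p. p \<in> U \<Longrightarrow> mon p a \<noteq> 0"
  shows "(\<integral>p. (cmod (mon p a))\<^sup>2 * (indicator A p * V p) \<partial>lborel) > 0"
proof (rule integral_pos_open)
  have [measurable]: "A \<in> sets borel" by fact
  show "integrable lborel (\<lambda>p. (cmod (mon p a))\<^sup>2 * (indicator A p * V p))"
    by (rule Bochner_Integration.integrable_bound[OF N_int[of a]])
       (use V_nonneg in \<open>auto intro!: mult_left_mono split: split_indicator\<close>)
  show "(cmod (mon p a))\<^sup>2 * (indicator A p * V p) \<ge> 0" for p using V_nonneg[of p] by simp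
  show "(cmod (mon p a))\<^sup>2 * (indicator A p * V p) > 0" if "p \<in> U" for p
  proof -
    have "V p > 0" using that assms(4) V_nonneg[of p] V_nz_iff[of p] by auto
    then show ?thesis using that assms(4,5) by (auto simp: indicator_def)
  qed
qed (use assms in auto)

lemma open_cmod_greater: "open {p \<in> D. \<forall>i. s i < cmod (p $ i)}"
  unfolding Collect_conj_eq Collect_all_eq
  by (intro open_Int open_INT ballI finite open_Collect_less continuous_intros) (use D in auto)

lemma N_pos: "N a > 0"
proof -
  obtain r where r: "\<And>i. cmod ((0 :: complex^'N) $ i) < r i" "(\<chi> i. complex_of_real (r i)) \<in> D"
    using larger_polyradius[OF D(2)] by metis
  have "(\<chi> i. complex_of_real (r i)) \<in> {p \<in> D. \<forall>i. 0 < cmod (p $ i)}"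
    using r by (simp add: less_le)
  then have "(\<integral>p. (cmod (mon p a))\<^sup>2 * (indicator UNIV p * V p) \<partial>lborel) > 0"
    by (intro N_pos_general[OF _ open_cmod_greater[of "\<lambda>_. 0"]]) (auto simp: mon_eq_0_iff)
  then show ?thesis by (simp add: N_def)
qed

text \<open>Choose \<open>s\<close> strictly between the moduli of \<open>q\<close> and a polyradius
  whose corner is in \<open>D\<close>. On the open set \<open>A\<close> of points with all moduli
  above \<open>s\<close>, the monomial has modulus at least \<open>?m a\<close>, so
  \<open>N a\<close> is at least \<open>(?m a)\<^sup>2\<close> times the mass
  \<open>\<delta>\<close> of \<open>A\<close>. The terms are then dominated by a geometric series in
  the ratios \<open>(cmod (q $ i) / s i)\<^sup>2\<close>.\<close>

lemma kernel_summable: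
  assumes q: "q \<in> D"
  shows "(\<lambda>a. (cmod (mon q a))\<^sup>2 / N a) summable_on UNIV"
proof -
  obtain r where r: "\<And>i. cmod (q $ i) < r i" "(\<chi> i. complex_of_real (r i)) \<in> D"
    using larger_polyradius[OF q] by metis
  define s where "s i = (cmod (q $ i) + r i) / 2" for i
  have s: "cmod (q $ i) < s i" "s i < r i" for i using r(1)[of i] by (auto simp: s_def)
  then have s0: "s i > 0" for i by (meson norm_ge_zero le_less_trans)
  define A where "A = {p \<in> D. \<forall>i. s i < cmod (p $ i)}"
  have "(\<chi> i. complex_of_real (r i)) \<in> A"
    using r s less_trans[OF s0 s(2)] by (simp add: A_def abs_of_pos)
  moreover have oA: "open A" unfolding A_def by (rule open_cmod_greater)
  then have [measurable]: "A \<in> sets borel" by (rule borel_open)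
  moreover have "mon p a \<noteq> 0" if "p \<in> A" for p a
  proof -
    have "p $ i \<noteq> 0" for i
    proof -
      have "s i < cmod (p $ i)" using that by (simp add: A_def)
      then show ?thesis using s0[of i] by auto
    qed
    then show ?thesis by (simp add: mon_eq_0_iff)
  qed
  ultimately have pos: "(\<integral>p. (cmod (mon p (\<lambda>_. 0)))\<^sup>2 * (indicator A p * V p) \<partial>lborel) > 0"
    using oA by (intro N_pos_general[of A A]) (auto simp: A_def)
  define \<delta> where "\<delta> = (\<integral>p. indicator A p * V p \<partial>lborel)"
  have \<delta>: "\<delta> > 0" using pos by (simp add: \<delta>_def)
  let ?m = "\<lambda>a. \<Prod>i\<in>UNIV. s i ^ a i"
  have m0: "?m a > 0" for a using s0 by (intro prod_pos) auto
  have N: "N a \<ge> (?m a)\<^sup>2 * \<delta>" for a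
  proof -
    have "(?m a)\<^sup>2 * \<delta> = (\<integral>p. (?m a)\<^sup>2 * (indicator A p * V p) \<partial>lborel)"
      unfolding \<delta>_def by simp
    also have "\<dots> \<le> N a"
      unfolding N_def
    proof (rule integral_mono)
      show "integrable lborel (\<lambda>p. (?m a)\<^sup>2 * (indicator A p * V p))"
        by (intro integrable_mult_right Bochner_Integration.integrable_bound[OF V_int])
           (use V_nonneg in \<open>auto split: split_indicator\<close>)
      fix p
      have "(?m a)\<^sup>2 \<le> (cmod (mon p a))\<^sup>2" if "p \<in> A"
        unfolding cmod_mon using that s0
        by (intro power_mono prod_mono conjI prod_nonneg) (auto simp: A_def less_imp_le)
      then show "(?m a)\<^sup>2 * (indicator A p * V p) \<le> (cmod (mon p a))\<^sup>2 * V p"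
        using V_nonneg[of p] by (auto intro: mult_right_mono split: split_indicator)
    qed (rule N_int)
    finally show ?thesis .
  qed
  let ?z = "\<lambda>i. (cmod (q $ i) / s i)\<^sup>2"
  have z: "\<bar>?z i\<bar> < 1" for i
  proof -
    have "(cmod (q $ i) / s i)\<^sup>2 < 1\<^sup>2" using s[of i] s0[of i] by (intro power_strict_mono) auto
    then show ?thesis by simp
  qed
  have "(\<lambda>a. (1 / \<delta>) * (\<Prod>i\<in>UNIV. ?z i ^ a i)) summable_on UNIV"
    using has_sum_geometric_multi[of ?z] z by (intro summable_on_cmult_right has_sum_imp_summable) auto
  then show ?thesis
  proof (rule summable_on_comparison_test)
    fix a :: "'N \<Rightarrow> nat"
    have "(cmod (mon q a))\<^sup>2 / N a \<le> (cmod (mon q a))\<^sup>2 / ((?m a)\<^sup>2 * \<delta>)"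
      by (intro divide_left_mono mult_pos_pos zero_less_power m0 \<delta> N N_pos) auto
    also have "\<dots> = (1 / \<delta>) * (cmod (mon q a) / ?m a)\<^sup>2" by (simp add: power_divide)
    also have "cmod (mon q a) / ?m a = (\<Prod>i\<in>UNIV. (cmod (q $ i) / s i) ^ a i)"
      by (simp add: cmod_mon prod_dividef power_divide)
    also have "\<dots>\<^sup>2 = (\<Prod>i\<in>UNIV. ?z i ^ a i)"
      by (simp only: prod_power_distrib power_mult[symmetric] mult.commute[of 2])
    finally show "(cmod (mon q a))\<^sup>2 / N a \<le> (1 / \<delta>) * (\<Prod>i\<in>UNIV. ?z i ^ a i)" .
    show "0 \<le> (cmod (mon q a))\<^sup>2 / N a" using N_pos[of a] by simp
  qed
qed

definition K :: "complex^'N \<Rightarrow> complex^'N \<Rightarrow> complex" where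
  "K p q = (\<Sum>\<^sub>\<infinity>a. mon p a * (cnj (mon q a) / N a))"

text \<open>By \<open>x * y \<le> x\<^sup>2 + y\<^sup>2\<close>, absolute convergence of the kernel
  at two points reduces to convergence on the diagonal at each of them.\<close>

lemma kernel_term_bound:
  "cmod (mon p a * (cnj (mon q a) / N a)) \<le> (cmod (mon p a))\<^sup>2 / N a + (cmod (mon q a))\<^sup>2 / N a"
proof -
  have "x * y \<le> x\<^sup>2 + y\<^sup>2" if "x \<ge> 0" "y \<ge> 0" for x y :: real
    using sum_squares_bound[of x y] mult_nonneg_nonneg[OF that] by linarith
  then show ?thesis using N_pos[of a]
    by (simp add: norm_mult norm_divide add_divide_distrib[symmetric] divide_right_mono)
qed

lemma K_abs_summable:
  assumes "p \<in> D" "q \<in> D"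
  shows "(\<lambda>a. cmod (mon p a * (cnj (mon q a) / N a))) summable_on UNIV"
  by (rule summable_on_comparison_test[OF summable_on_add[OF kernel_summable[OF assms(1)] kernel_summable[OF assms(2)]]])
     (use kernel_term_bound in auto)

lemma K_has_sum:
  assumes "p \<in> D" "q \<in> D"
  shows "((\<lambda>a. mon p a * (cnj (mon q a) / N a)) has_sum K p q) UNIV"
  unfolding K_def using K_abs_summable[OF assms] by (intro has_sum_infsum) (rule abs_summable_summable)

text \<open>The terms at the corner of a polydisc containing \<open>p\<close> form a Weierstrass
  majorant near \<open>p\<close>. The partial sums are polynomials, and their uniform limit is
  holomorphic at \<open>p\<close>.\<close>

lemma K_holo:
  assumes q: "q \<in> D"
  shows "holo_on D (\<lambda>p. K p q)"
  unfolding holo_on_def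
proof
  fix p assume p: "p \<in> D"
  obtain r where r: "\<And>i. cmod (p $ i) < r i" "(\<chi> i. complex_of_real (r i)) \<in> D"
    using larger_polyradius[OF p] by metis
  let ?P = "{x :: complex^'N. \<forall>i. cmod (x $ i) < r i}"
  have P: "open ?P"
    unfolding Collect_all_eq by (intro open_INT ballI finite open_Collect_less continuous_intros)
  have "p \<in> ?P" using r(1) by simp
  with P obtain e where e: "e > 0" "ball p e \<subseteq> ?P" by (rule openE)
  define g where "g n x = (\<Sum>a\<in>exhaustion n. mon x a * (cnj (mon q a) / N a))" for n x
  have "holo_on {p} (\<lambda>x. K x q)"
  proof (rule holo_uniform_limit[OF _ e(1)])
    show "holo_on (ball p e) (g n)" for n
      unfolding g_def[abs_def] by (intro holo_on_sum holo_on_mult holo_on_mon holo_on_const)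
    have "uniform_limit (ball p e) (\<lambda>F x. \<Sum>a\<in>F. mon x a * (cnj (mon q a) / N a)) (\<lambda>x. K x q) (finite_subsets_at_top UNIV)"
      unfolding K_def
    proof (rule Weierstrass_m_test_general)
      show "(\<lambda>a. cmod (mon (\<chi> i. complex_of_real (r i)) a * (cnj (mon q a) / N a))) summable_on UNIV"
        by (rule K_abs_summable[OF r(2) q])
      fix a x assume "x \<in> ball p e"
      with e(2) have "x \<in> ?P" by (rule subsetD)
      then have "cmod (x $ i) < r i" for i by simp
      then have "cmod (x $ i) \<le> cmod ((\<chi> i. complex_of_real (r i)) $ i)" for i
        by (simp add: less_imp_le less_le_trans[OF _ abs_ge_self])
      then show "cmod (mon x a * (cnj (mon q a) / N a)) \<le> cmod (mon (\<chi> i. complex_of_real (r i)) a * (cnj (mon q a) / N a))"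
        unfolding norm_mult by (intro mult_right_mono cmod_mon_mono) auto
    qed
    then show "uniform_limit (ball p e) g (\<lambda>x. K x q) sequentially"
      unfolding g_def[abs_def] by (rule filterlim_compose[OF _ filterlim_exhaustion])
  qed
  then show "\<exists>L. ((\<lambda>p. K p q) has_derivative L) (at p) \<and> (\<forall>c v. L (c *s v) = c * L v)"
    unfolding holo_on_def by blast
qed

text \<open>Cauchy's formula produces one series for each polydisc, with coefficients that might
  depend on the radii. All these polydiscs are centred at 0, so any two share a smaller one, where
  uniqueness forces equal coefficients.\<close>

lemma global_power_series:
  assumes f: "holo_on D f"
  obtains c where "\<And>p. p \<in> D \<Longrightarrow> ((\<lambda>a. c a * mon p a) has_sum f p) UNIV"
proof -
  have ex: "\<exists>c. \<forall>p. (\<forall>i. cmod (p $ i) < r i) \<longrightarrow> ((\<lambda>a. c a * mon p a) has_sum f p) UNIV"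
    if "\<And>i. r i > 0" "{q. \<forall>i. cmod (q $ i) \<le> r i} \<subseteq> D" for r
    by (rule polydisc_holo.power_series[OF polydisc_holo.intro[OF D(1) f that]])
  obtain r where r: "\<And>i. cmod ((0 :: complex^'N) $ i) < r i" "{q. \<forall>i. cmod (q $ i) \<le> r i} \<subseteq> D"
      "(\<chi> i. complex_of_real (r i)) \<in> D"
    by (rule larger_polyradius[OF D(2)], rule that)
  have r0: "r i > 0" for i using r(1)[of i] by simp
  from ex[OF r0 r(2)] obtain c where "\<forall>p. (\<forall>i. cmod (p $ i) < r i) \<longrightarrow> ((\<lambda>a. c a * mon p a) has_sum f p) UNIV" ..
  then have c: "((\<lambda>a. c a * mon p a) has_sum f p) UNIV" if "\<And>i. cmod (p $ i) < r i" for p using that by simp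
  show ?thesis
  proof (rule that[of c])
    fix p assume p: "p \<in> D"
    obtain s where s: "\<And>i. cmod (p $ i) < s i" "{q. \<forall>i. cmod (q $ i) \<le> s i} \<subseteq> D"
        "(\<chi> i. complex_of_real (s i)) \<in> D"
      by (rule larger_polyradius[OF p], rule that)
    have s0: "s i > 0" for i using s(1)[of i] norm_ge_zero by (rule le_less_trans[rotated])
    from ex[OF s0 s(2)] obtain c' where "\<forall>p. (\<forall>i. cmod (p $ i) < s i) \<longrightarrow> ((\<lambda>a. c' a * mon p a) has_sum f p) UNIV" ..
    then have c': "((\<lambda>a. c' a * mon p a) has_sum f p) UNIV" if "\<And>i. cmod (p $ i) < s i" for p using that by simp
    have "c = c'"
    proof (rule power_series_unique[where r="\<lambda>i. min (r i) (s i)" and f=f])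
      fix p assume "\<And>i. cmod (p $ i) < min (r i) (s i)"
      then show "((\<lambda>a. c a * mon p a) has_sum f p) UNIV" "((\<lambda>a. c' a * mon p a) has_sum f p) UNIV"
        by (simp_all add: c c')
    qed (simp add: r0 s0)
    then show "((\<lambda>a. c a * mon p a) has_sum f p) UNIV" using c'[OF s(1)] by simp
  qed
qed

end

section \<open>Square integrability and the reproducing property\<close>

context reinhardt_weight
begin

definition L2 :: "(complex^'N \<Rightarrow> complex) \<Rightarrow> bool" where
  "L2 f \<longleftrightarrow> holo_on D f \<and> (\<integral>\<^sup>+p. ennreal ((cmod (f p))\<^sup>2 * V p) \<partial>lborel) < \<infinity>"

text \<open>Functions holomorphic on \<open>D\<close> are arbitrary elsewhere. Cutting makes them
  Borel measurable and changes no weighted integral, because \<open>V\<close> vanishes off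
  \<open>D\<close>.\<close>

definition cut :: "(complex^'N \<Rightarrow> complex) \<Rightarrow> complex^'N \<Rightarrow> complex" where
  "cut f p = indicator D p *\<^sub>R f p"

lemma cut_measurable: "holo_on D f \<Longrightarrow> cut f \<in> borel_measurable borel"
  unfolding cut_def[abs_def] using D(1)
  by (intro borel_measurable_continuous_on_indicator holo_on_continuous) auto

lemma cut_V: "(cmod (cut f p))\<^sup>2 * V p = (cmod (f p))\<^sup>2 * V p"
  by (auto simp: cut_def V_def split: split_indicator)

lemma L2_sq_int:
  assumes "L2 f"
  shows "integrable lborel (\<lambda>p. (cmod (cut f p))\<^sup>2 * V p)"
proof (rule integrableI_nonneg)
  have [measurable]: "cut f \<in> borel_measurable borel" using assms by (simp add: L2_def cut_measurable)
  show "(\<lambda>p. (cmod (cut f p))\<^sup>2 * V p) \<in> borel_measurable lborel" by measurable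
qed (use assms V_nonneg in \<open>auto simp: L2_def cut_V\<close>)

lemma prod_int:
  fixes f g :: "complex^'N \<Rightarrow> complex"
  assumes [measurable]: "f \<in> borel_measurable borel" "g \<in> borel_measurable borel"
    and f: "integrable lborel (\<lambda>p. (cmod (f p))\<^sup>2 * V p)" and g: "integrable lborel (\<lambda>p. (cmod (g p))\<^sup>2 * V p)"
  shows "integrable lborel (\<lambda>p. f p * (cnj (g p) * of_real (V p)))"
proof (rule Bochner_Integration.integrable_bound)
  show "integrable lborel (\<lambda>p. (cmod (f p))\<^sup>2 * V p + (cmod (g p))\<^sup>2 * V p)"
    by (intro Bochner_Integration.integrable_add f g)
  show "AE p in lborel. norm (f p * (cnj (g p) * of_real (V p))) \<le> norm ((cmod (f p))\<^sup>2 * V p + (cmod (g p))\<^sup>2 * V p)"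
  proof (intro always_eventually allI)
    fix p
    have "cmod (f p) * cmod (g p) \<le> (cmod (f p))\<^sup>2 + (cmod (g p))\<^sup>2"
      using sum_squares_bound[of "cmod (f p)" "cmod (g p)"] mult_nonneg_nonneg[OF norm_ge_zero norm_ge_zero, of "f p" "g p"]
      by linarith
    from mult_right_mono[OF this V_nonneg[of p]] show "norm (f p * (cnj (g p) * of_real (V p))) \<le> norm ((cmod (f p))\<^sup>2 * V p + (cmod (g p))\<^sup>2 * V p)"
      using V_nonneg[of p] by (simp add: norm_mult algebra_simps)
  qed
qed measurable

text \<open>
  The series is integrated termwise over the sublevel sets of \<open>\<Sum>a. cmod (c a * mon p a)\<close>: they are
  invariant under rotation, and they exhaust the domain.
\<close>

lemma coefficient:
  assumes f: "L2 f" and c: "\<And>p. p \<in> D \<Longrightarrow> ((\<lambda>a. c a * mon p a) has_sum f p) UNIV"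
  shows "(\<integral>p. cut f p * (cnj (mon p b) * of_real (V p)) \<partial>lborel) = c b * N b"
proof -
  have [measurable]: "cut f \<in> borel_measurable borel" using f by (simp add: L2_def cut_measurable)
  \<comment> \<open>Testing the bound on the sets \<open>exhaustion n\<close> alone makes
    \<open>A k\<close> a countable intersection, hence measurable; every finite set of indices is
    contained in one of them.\<close>
  define A where "A k = {p. \<forall>n. (\<Sum>a\<in>exhaustion n. cmod (c a * mon p a)) \<le> real k}" for k
  have [measurable]: "A k \<in> sets borel" for k
    unfolding A_def by measurable
  define X where "X k p = indicator (A k) p * V p" for k p
  have Xm [measurable]: "X k \<in> borel_measurable borel" for k unfolding X_def[abs_def] by measurable
  have Xi: "torus_invariant (X k)" for k
    unfolding torus_invariant_def
  proof (intro allI impI)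
    fix p q :: "complex^'N" assume pq: "\<forall>i. cmod (p $ i) = cmod (q $ i)"
    then have "cmod (mon p a) = cmod (mon q a)" "V p = V q" for a
      using torus_invariant_cmod_mon[of a] V_inv unfolding torus_invariant_def by blast+
    then show "X k p = X k q" by (simp add: X_def A_def norm_mult indicator_def)
  qed
  have in_A: "\<exists>k. p \<in> A k" if p: "p \<in> D" for p
  proof -
    obtain B where B: "\<And>F. finite F \<Longrightarrow> (\<Sum>a\<in>F. cmod (c a * mon p a)) \<le> B"
      using abs_has_sum_bounded_sums[OF c[OF p]] by metis
    obtain k where "B \<le> real k" using real_arch_simple by blast
    then have "p \<in> A k" using B[OF finite_exhaustion] by (auto simp: A_def intro: order_trans)
    then show ?thesis by blast
  qed
  have A_mono: "p \<in> A k \<Longrightarrow> k \<le> l \<Longrightarrow> p \<in> A l" for p k l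
    by (force simp: A_def intro: order_trans)
  have X_le: "X k p \<le> V p" "X k p \<ge> 0" for k p using V_nonneg[of p] by (auto simp: X_def split: split_indicator)
  have X_lim: "(\<lambda>k. X k p) \<longlonglongrightarrow> V p" for p
  proof (cases "p \<in> D")
    case True
    then obtain k where k: "p \<in> A k" using in_A by blast
    have "\<forall>\<^sub>F l in sequentially. X l p = V p"
      using A_mono[OF k] by (auto simp: eventually_sequentially X_def intro!: exI[of _ k])
    then show ?thesis by (rule tendsto_eventually)
  next
    case False
    then have "V p = 0" using V_nz_iff by blast
    then show ?thesis by (simp add: X_def)
  qed
  have eq: "(\<integral>p. cut f p * (cnj (mon p b) * of_real (X k p)) \<partial>lborel) = c b * of_real (\<integral>p. (cmod (mon p b))\<^sup>2 * X k p \<partial>lborel)" for k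
  proof -
    have nz: "p \<in> A k \<and> p \<in> D" if "X k p \<noteq> 0" for p using that V_nz_iff[of p] by (auto simp: X_def indicator_def split: if_splits)
    show ?thesis
    proof (rule mon_coefficient[OF Xm Xi X_le(2)])
      show "integrable lborel (\<lambda>p. cmod (mon p b) * X k p)"
        by (rule Bochner_Integration.integrable_bound[OF mon_int[of b]])
           (use X_le V_nonneg in \<open>auto simp: abs_mult intro!: mult_left_mono\<close>)
      show "((\<lambda>a. c a * mon p a) has_sum cut f p) UNIV" if "X k p \<noteq> 0" for p
        using nz[OF that] c[of p] by (simp add: cut_def)
      show "(\<Sum>a\<in>F. cmod (c a * mon p a)) \<le> real k" if "X k p \<noteq> 0" "finite F" for p F
      proof -
        obtain n where "F \<subseteq> exhaustion n" using subset_exhaustion[OF \<open>finite F\<close>] by blast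
        then have "(\<Sum>a\<in>F. cmod (c a * mon p a)) \<le> (\<Sum>a\<in>exhaustion n. cmod (c a * mon p a))"
          by (intro sum_mono2) auto
        then show ?thesis using nz[OF that(1)] by (auto simp: A_def intro: order_trans)
      qed
    qed
  qed
  have "(\<lambda>k. \<integral>p. cut f p * (cnj (mon p b) * of_real (X k p)) \<partial>lborel) \<longlonglongrightarrow> (\<integral>p. cut f p * (cnj (mon p b) * of_real (V p)) \<partial>lborel)"
  proof (rule integral_dominated_convergence)
    show "integrable lborel (\<lambda>p. cmod (cut f p * (cnj (mon p b) * of_real (V p))))"
      by (intro integrable_norm prod_int L2_sq_int[OF f] N_int) measurable
    show "AE p in lborel. cmod (cut f p * (cnj (mon p b) * of_real (X k p))) \<le> cmod (cut f p * (cnj (mon p b) * of_real (V p)))" for k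
      using X_le V_nonneg by (auto simp: norm_mult intro!: mult_left_mono)
    show "AE p in lborel. (\<lambda>k. cut f p * (cnj (mon p b) * of_real (X k p))) \<longlonglongrightarrow> cut f p * (cnj (mon p b) * of_real (V p))"
      using X_lim by (auto intro!: tendsto_intros)
  qed measurable
  moreover have "(\<lambda>k. \<integral>p. (cmod (mon p b))\<^sup>2 * X k p \<partial>lborel) \<longlonglongrightarrow> N b"
    unfolding N_def
  proof (rule integral_dominated_convergence[OF _ _ N_int[of b]])
    show "AE p in lborel. norm ((cmod (mon p b))\<^sup>2 * X k p) \<le> (cmod (mon p b))\<^sup>2 * V p" for k
      using X_le V_nonneg by (auto simp: abs_mult intro!: mult_left_mono)
    show "AE p in lborel. (\<lambda>k. (cmod (mon p b))\<^sup>2 * X k p) \<longlonglongrightarrow> (cmod (mon p b))\<^sup>2 * V p"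
      using X_lim by (auto intro!: tendsto_intros)
  qed measurable
  then have "(\<lambda>k. c b * of_real (\<integral>p. (cmod (mon p b))\<^sup>2 * X k p \<partial>lborel)) \<longlonglongrightarrow> c b * N b"
    by (intro tendsto_intros)
  ultimately show ?thesis unfolding eq by (rule LIMSEQ_unique)
qed

text \<open>Pythagoras for the orthogonal monomials. It evaluates the norm of a difference of two
  partial kernels exactly.\<close>

lemma polynomial_norm:
  assumes "finite F"
  shows "integrable lborel (\<lambda>p. (cmod (\<Sum>a\<in>F. mon p a * d a))\<^sup>2 * V p)"
    and "(\<integral>p. (cmod (\<Sum>a\<in>F. mon p a * d a))\<^sup>2 * V p \<partial>lborel) = (\<Sum>a\<in>F. (cmod (d a))\<^sup>2 * N a)"
proof -
  let ?g = "\<lambda>a b p. mon p a * (cnj (mon p b) * of_real (V p)) * (d a * cnj (d b))"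
  have int: "integrable lborel (?g a b)" for a b
    by (intro integrable_mult_left prod_int N_int) measurable
  have eq: "of_real ((cmod (\<Sum>a\<in>F. mon p a * d a))\<^sup>2 * V p) = (\<Sum>a\<in>F. \<Sum>b\<in>F. ?g a b p)" for p
  proof -
    have "of_real ((cmod (\<Sum>a\<in>F. mon p a * d a))\<^sup>2 * V p) = (\<Sum>a\<in>F. \<Sum>b\<in>F. (mon p a * d a) * cnj (mon p b * d b)) * of_real (V p)"
      by (simp only: of_real_mult complex_norm_square cnj_sum sum_product)
    also have "\<dots> = (\<Sum>a\<in>F. \<Sum>b\<in>F. ?g a b p)"
      unfolding sum_distrib_right by (intro sum.cong refl) simp
    finally show ?thesis .
  qed
  have "integrable lborel (\<lambda>p. complex_of_real ((cmod (\<Sum>a\<in>F. mon p a * d a))\<^sup>2 * V p))"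
    unfolding eq by (intro Bochner_Integration.integrable_sum int)
  then show "integrable lborel (\<lambda>p. (cmod (\<Sum>a\<in>F. mon p a * d a))\<^sup>2 * V p)"
    by (simp only: complex_of_real_integrable_eq)
  have diag: "(\<integral>p. ?g a a p \<partial>lborel) = of_real ((cmod (d a))\<^sup>2 * N a)" for a
  proof -
    have "(\<integral>p. ?g a a p \<partial>lborel) = (\<integral>p. of_real ((cmod (mon p a))\<^sup>2 * V p) * of_real ((cmod (d a))\<^sup>2) \<partial>lborel)"
      by (intro Bochner_Integration.integral_cong refl) (simp only: of_real_mult complex_norm_square mult_ac)
    also have "\<dots> = of_real (N a) * of_real ((cmod (d a))\<^sup>2)"
      unfolding N_def by (simp only: integral_mult_left_zero integral_complex_of_real)
    finally show ?thesis by (simp add: mult.commute)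
  qed
  have "complex_of_real (\<integral>p. (cmod (\<Sum>a\<in>F. mon p a * d a))\<^sup>2 * V p \<partial>lborel) = (\<integral>p. (\<Sum>a\<in>F. \<Sum>b\<in>F. ?g a b p) \<partial>lborel)"
    unfolding eq[symmetric] by (rule integral_complex_of_real[symmetric])
  also have "\<dots> = (\<Sum>a\<in>F. \<Sum>b\<in>F. \<integral>p. ?g a b p \<partial>lborel)"
    using int by (simp add: Bochner_Integration.integral_sum)
  also have "\<dots> = (\<Sum>a\<in>F. \<Sum>b\<in>F. if a = b then of_real ((cmod (d a))\<^sup>2 * N a) else 0)"
  proof (intro sum.cong refl)
    fix a b
    show "(\<integral>p. ?g a b p \<partial>lborel) = (if a = b then of_real ((cmod (d a))\<^sup>2 * N a) else 0)"
    proof (cases "a = b")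
      case False
      then show ?thesis using mon_orthogonal[OF V_meas V_inv False] by (simp only: integral_mult_left_zero) simp
    qed (use diag in simp)
  qed
  also have "\<dots> = of_real (\<Sum>a\<in>F. (cmod (d a))\<^sup>2 * N a)"
    using assms by simp
  finally show "(\<integral>p. (cmod (\<Sum>a\<in>F. mon p a * d a))\<^sup>2 * V p \<partial>lborel) = (\<Sum>a\<in>F. (cmod (d a))\<^sup>2 * N a)"
    by (simp only: of_real_eq_iff)
qed

definition Kpart :: "nat \<Rightarrow> complex^'N \<Rightarrow> complex^'N \<Rightarrow> complex" where
  "Kpart n p q = (\<Sum>a\<in>exhaustion n. mon p a * (cnj (mon q a) / N a))"

definition tail :: "nat \<Rightarrow> complex^'N \<Rightarrow> real" where
  "tail n q = (\<Sum>\<^sub>\<infinity>a. (cmod (mon q a))\<^sup>2 / N a) - (\<Sum>a\<in>exhaustion n. (cmod (mon q a))\<^sup>2 / N a)"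

lemma Kpart_limit: "p \<in> D \<Longrightarrow> q \<in> D \<Longrightarrow> (\<lambda>n. Kpart n p q) \<longlonglongrightarrow> K p q"
  unfolding Kpart_def by (intro has_sum_imp_exhaustion_limit K_has_sum)

lemma tail_nonneg: "q \<in> D \<Longrightarrow> tail n q \<ge> 0"
  unfolding tail_def using finite_sum_le_infsum[OF kernel_summable, of q "exhaustion n"] N_pos
  by (auto simp: less_imp_le)

lemma tail_limit: "q \<in> D \<Longrightarrow> (\<lambda>n. tail n q) \<longlonglongrightarrow> 0"
  unfolding tail_def
  using has_sum_imp_exhaustion_limit[OF has_sum_infsum[OF kernel_summable, of q]]
  by (auto intro!: tendsto_eq_intros)

text \<open>By Fatou, the squared norm of \<open>K - Kpart n\<close> is at most the lower limit of
  those of \<open>Kpart m - Kpart n\<close>. Pythagoras identifies the latter with a finite section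
  of the diagonal series at \<open>q\<close>, which is at most its remainder.\<close>

lemma K_tail:
  assumes q: "q \<in> D"
  shows "(\<integral>\<^sup>+p. ennreal ((cmod (K p q - Kpart n p q))\<^sup>2 * V p) \<partial>lborel) \<le> ennreal (tail n q)"
proof -
  let ?h = "\<lambda>m p. ennreal ((cmod (Kpart m p q - Kpart n p q))\<^sup>2 * V p)"
  have [measurable]: "(\<lambda>p. Kpart m p q) \<in> borel_measurable borel" for m
    unfolding Kpart_def by measurable
  have "(\<integral>\<^sup>+p. ennreal ((cmod (K p q - Kpart n p q))\<^sup>2 * V p) \<partial>lborel) = (\<integral>\<^sup>+p. liminf (\<lambda>m. ?h m p) \<partial>lborel)"
  proof (intro nn_integral_cong)
    fix p
    have "(\<lambda>m. ?h m p) \<longlonglongrightarrow> ennreal ((cmod (K p q - Kpart n p q))\<^sup>2 * V p)"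
    proof (cases "p \<in> D")
      case True
      then show ?thesis by (intro tendsto_intros Kpart_limit q tendsto_ennrealI)
    next
      case False
      then have "V p = 0" using V_nz_iff by blast
      then show ?thesis by simp
    qed
    then show "ennreal ((cmod (K p q - Kpart n p q))\<^sup>2 * V p) = liminf (\<lambda>m. ?h m p)"
      by (intro lim_imp_Liminf[symmetric]) auto
  qed
  also have "\<dots> \<le> liminf (\<lambda>m. \<integral>\<^sup>+p. ?h m p \<partial>lborel)"
    by (intro nn_integral_liminf) measurable
  also have "\<dots> \<le> ennreal (tail n q)"
  proof (rule Liminf_le)
    have "(\<integral>\<^sup>+p. ?h m p \<partial>lborel) \<le> ennreal (tail n q)" if "m \<ge> n" for m
    proof -
      let ?F = "exhaustion m - exhaustion n :: ('N \<Rightarrow> nat) set"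
      have diff: "Kpart m p q - Kpart n p q = (\<Sum>a\<in>?F. mon p a * (cnj (mon q a) / N a))" for p
        unfolding Kpart_def by (simp only: sum_diff[OF finite_exhaustion exhaustion_mono[OF that]])
      have "(\<integral>\<^sup>+p. ?h m p \<partial>lborel) = ennreal (\<integral>p. (cmod (Kpart m p q - Kpart n p q))\<^sup>2 * V p \<partial>lborel)"
        unfolding diff using V_nonneg by (intro nn_integral_eq_integral polynomial_norm(1)) auto
      also have "(\<integral>p. (cmod (Kpart m p q - Kpart n p q))\<^sup>2 * V p \<partial>lborel) = (\<Sum>a\<in>?F. (cmod (cnj (mon q a) / N a))\<^sup>2 * N a)"
        unfolding diff by (intro polynomial_norm(2)) simp
      also have "\<dots> = (\<Sum>a\<in>?F. (cmod (mon q a))\<^sup>2 / N a)"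
      proof (intro sum.cong refl)
        fix a show "(cmod (cnj (mon q a) / N a))\<^sup>2 * N a = (cmod (mon q a))\<^sup>2 / N a"
          using N_pos[of a] by (simp add: norm_divide power_divide power2_eq_square)
      qed
      also have "\<dots> = (\<Sum>a\<in>exhaustion m. (cmod (mon q a))\<^sup>2 / N a) - (\<Sum>a\<in>exhaustion n. (cmod (mon q a))\<^sup>2 / N a)"
        by (simp only: sum_diff[OF finite_exhaustion exhaustion_mono[OF that]])
      also have "\<dots> \<le> tail n q"
        using tail_nonneg[OF q, of m] by (simp add: tail_def)
      finally show ?thesis by (simp add: ennreal_leI)
    qed
    then show "\<forall>\<^sub>F m in sequentially. (\<integral>\<^sup>+p. ?h m p \<partial>lborel) \<le> ennreal (tail n q)"
      by (auto simp: eventually_sequentially)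
  qed simp
  finally show ?thesis .
qed

lemma nn_integral_sq_sum_finite:
  fixes f g :: "complex^'N \<Rightarrow> complex"
  assumes [measurable]: "f \<in> borel_measurable borel" "g \<in> borel_measurable borel"
    and "(\<integral>\<^sup>+p. ennreal ((cmod (f p))\<^sup>2 * V p) \<partial>lborel) < \<infinity>" "(\<integral>\<^sup>+p. ennreal ((cmod (g p))\<^sup>2 * V p) \<partial>lborel) < \<infinity>"
  shows "(\<integral>\<^sup>+p. ennreal ((cmod (f p + g p))\<^sup>2 * V p) \<partial>lborel) < \<infinity>"
proof -
  have "(cmod (f p + g p))\<^sup>2 * V p \<le> 2 * ((cmod (f p))\<^sup>2 * V p) + 2 * ((cmod (g p))\<^sup>2 * V p)" for p
  proof -
    have "(cmod (f p + g p))\<^sup>2 \<le> (cmod (f p) + cmod (g p))\<^sup>2"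
      by (intro power_mono norm_triangle_ineq) auto
    also have "\<dots> \<le> 2 * (cmod (f p))\<^sup>2 + 2 * (cmod (g p))\<^sup>2"
      using sum_squares_bound[of "cmod (f p)" "cmod (g p)"] by (simp add: power2_eq_square algebra_simps)
    finally show ?thesis using mult_right_mono[OF _ V_nonneg[of p]] by (fastforce simp: algebra_simps)
  qed
  then have "(\<integral>\<^sup>+p. ennreal ((cmod (f p + g p))\<^sup>2 * V p) \<partial>lborel)
    \<le> (\<integral>\<^sup>+p. 2 * ennreal ((cmod (f p))\<^sup>2 * V p) + 2 * ennreal ((cmod (g p))\<^sup>2 * V p) \<partial>lborel)"
    using V_nonneg by (intro nn_integral_mono) (auto simp: ennreal_leI simp flip: ennreal_plus ennreal_numeral ennreal_mult')
  also have "\<dots> = 2 * (\<integral>\<^sup>+p. ennreal ((cmod (f p))\<^sup>2 * V p) \<partial>lborel) + 2 * (\<integral>\<^sup>+p. ennreal ((cmod (g p))\<^sup>2 * V p) \<partial>lborel)"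
    by (simp add: nn_integral_add nn_integral_cmult)
  also have "\<dots> < \<infinity>" using assms(3,4) by (auto simp: ennreal_mult_less_top)
  finally show ?thesis .
qed

text \<open>\<open>K\<close> is the sum of \<open>K - Kpart 0\<close>, of finite norm by
  \<open>K_tail\<close>, and the polynomial \<open>Kpart 0\<close>.\<close>

lemma K_L2:
  assumes q: "q \<in> D"
  shows "L2 (\<lambda>p. K p q)"
  unfolding L2_def
proof
  show h: "holo_on D (\<lambda>p. K p q)" by (rule K_holo[OF q])
  have [measurable]: "(\<lambda>p. Kpart 0 p q) \<in> borel_measurable borel" unfolding Kpart_def by measurable
  have [measurable]: "cut (\<lambda>p. K p q) \<in> borel_measurable borel" by (rule cut_measurable[OF h])
  have V_cong: "(cmod (cut (\<lambda>p. K p q) p - x))\<^sup>2 * V p = (cmod (K p q - x))\<^sup>2 * V p" for p x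
    by (auto simp: cut_def V_def split: split_indicator)
  have "(\<integral>\<^sup>+p. ennreal ((cmod ((cut (\<lambda>p. K p q) p - Kpart 0 p q) + Kpart 0 p q))\<^sup>2 * V p) \<partial>lborel) < \<infinity>"
  proof (rule nn_integral_sq_sum_finite)
    show "(\<integral>\<^sup>+p. ennreal ((cmod (cut (\<lambda>p. K p q) p - Kpart 0 p q))\<^sup>2 * V p) \<partial>lborel) < \<infinity>"
      unfolding V_cong using K_tail[OF q, of 0] by (auto intro: le_less_trans)
    show "(\<integral>\<^sup>+p. ennreal ((cmod (Kpart 0 p q))\<^sup>2 * V p) \<partial>lborel) < \<infinity>"
      unfolding Kpart_def using V_nonneg
      by (subst nn_integral_eq_integral[OF polynomial_norm(1)]) auto
  qed measurable
  then show "(\<integral>\<^sup>+p. ennreal ((cmod (K p q))\<^sup>2 * V p) \<partial>lborel) < \<infinity>"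
    by (simp add: cut_V)
qed

text \<open>Paired with \<open>Kpart n\<close>, the function \<open>f\<close> gives the partial sum
  at \<open>q\<close> of its power series, by the coefficient formula. Cauchy-Schwarz bounds the
  error of passing from \<open>Kpart n\<close> to \<open>K\<close> by the norm of \<open>f\<close>
  times the square root of \<open>tail n q\<close>, which tends to 0.\<close>

theorem K_reproducing:
  assumes f: "L2 f" and q: "q \<in> D"
  shows "f q = (\<integral>p. V p *\<^sub>R (f p * cnj (K p q)) \<partial>lborel)"
proof -
  define k where "k = cut (\<lambda>p. K p q)"
  have fm [measurable]: "cut f \<in> borel_measurable borel" using f by (simp add: L2_def cut_measurable)
  have km [measurable]: "k \<in> borel_measurable borel" unfolding k_def by (intro cut_measurable K_holo q)
  have Km [measurable]: "(\<lambda>p. Kpart n p q) \<in> borel_measurable borel" for n unfolding Kpart_def by measurable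
  have k2: "integrable lborel (\<lambda>p. (cmod (k p))\<^sup>2 * V p)" unfolding k_def by (intro L2_sq_int K_L2 q)
  have K2: "integrable lborel (\<lambda>p. (cmod (Kpart n p q))\<^sup>2 * V p)" for n
    unfolding Kpart_def by (rule polynomial_norm) simp
  note f2 = L2_sq_int[OF f]
  let ?I = "\<lambda>g. \<integral>p. cut f p * (cnj (g p) * of_real (V p)) \<partial>lborel"
  have RHS: "(\<integral>p. V p *\<^sub>R (f p * cnj (K p q)) \<partial>lborel) = ?I k"
    by (intro Bochner_Integration.integral_cong) (auto simp: k_def cut_def V_def scaleR_conv_of_real split: split_indicator)
  obtain c where c: "\<And>p. p \<in> D \<Longrightarrow> ((\<lambda>a. c a * mon p a) has_sum f p) UNIV"
    using global_power_series f unfolding L2_def by blast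
  have part: "?I (\<lambda>p. Kpart n p q) = (\<Sum>a\<in>exhaustion n. c a * mon q a)" for n
  proof -
    have int: "integrable lborel (\<lambda>p. cut f p * (cnj (mon p a) * of_real (V p)) * (mon q a / N a))" for a
      by (intro integrable_mult_left prod_int f2 N_int) measurable
    have "?I (\<lambda>p. Kpart n p q) = (\<integral>p. (\<Sum>a\<in>exhaustion n. cut f p * (cnj (mon p a) * of_real (V p)) * (mon q a / N a)) \<partial>lborel)"
      by (intro Bochner_Integration.integral_cong refl) (simp add: Kpart_def sum_distrib_left sum_distrib_right mult_ac)
    also have "\<dots> = (\<Sum>a\<in>exhaustion n. \<integral>p. cut f p * (cnj (mon p a) * of_real (V p)) * (mon q a / N a) \<partial>lborel)"
      by (rule Bochner_Integration.integral_sum[OF int])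
    also have "\<dots> = (\<Sum>a\<in>exhaustion n. c a * mon q a)"
    proof (intro sum.cong refl)
      fix a
      show "(\<integral>p. cut f p * (cnj (mon p a) * of_real (V p)) * (mon q a / N a) \<partial>lborel) = c a * mon q a"
        using N_pos[of a] by (simp only: integral_mult_left_zero coefficient[OF f c]) simp
    qed
    finally show ?thesis .
  qed
  have "(\<lambda>n. ?I (\<lambda>p. Kpart n p q)) \<longlonglongrightarrow> f q"
    unfolding part by (rule has_sum_imp_exhaustion_limit[OF c[OF q]])
  moreover have "(\<lambda>n. ?I (\<lambda>p. Kpart n p q)) \<longlonglongrightarrow> ?I k"
  proof (rule Lim_null[THEN iffD2])
    define A where "A = (\<integral>p. (cmod (cut f p))\<^sup>2 * V p \<partial>lborel)"
    have A: "(\<integral>\<^sup>+p. ennreal ((cmod (cut f p))\<^sup>2 * V p) \<partial>lborel) = ennreal A" "A \<ge> 0"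
      unfolding A_def using V_nonneg by (auto intro!: nn_integral_eq_integral f2 integral_nonneg_AE)
    have bound: "(cmod (?I (\<lambda>p. Kpart n p q) - ?I k))\<^sup>2 \<le> A * tail n q" for n
    proof -
      let ?g = "\<lambda>p. cmod (Kpart n p q - k p) * sqrt (V p)" and ?f = "\<lambda>p. cmod (cut f p) * sqrt (V p)"
      have "?I (\<lambda>p. Kpart n p q) - ?I k = (\<integral>p. cut f p * (cnj (Kpart n p q) * of_real (V p)) - cut f p * (cnj (k p) * of_real (V p)) \<partial>lborel)"
        by (intro Bochner_Integration.integral_diff[symmetric] prod_int f2 K2 k2) measurable
      also have "\<dots> = ?I (\<lambda>p. Kpart n p q - k p)"
        by (intro Bochner_Integration.integral_cong) (auto simp: algebra_simps)
      finally have "ennreal (cmod (?I (\<lambda>p. Kpart n p q) - ?I k)) \<le> (\<integral>\<^sup>+p. ennreal (cmod (cut f p * (cnj (Kpart n p q - k p) * of_real (V p)))) \<partial>lborel)"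
        using integral_norm_bound_ennreal[of lborel "\<lambda>p. cut f p * (cnj (Kpart n p q - k p) * of_real (V p))"]
         integral_eq_zero_null_sets not_integrable_integral_eq[of lborel "\<lambda>p. cut f p * (cnj (Kpart n p q - k p) * of_real (V p))"]
        by (cases "integrable lborel (\<lambda>p. cut f p * (cnj (Kpart n p q - k p) * of_real (V p)))") auto
      also have "\<dots> = (\<integral>\<^sup>+p. ennreal (?f p) * ennreal (?g p) \<partial>lborel)"
        using V_nonneg by (intro nn_integral_cong)
          (simp add: norm_mult mult_ac del: complex_cnj_diff flip: ennreal_mult' real_sqrt_mult_self)
      finally have "(ennreal (cmod (?I (\<lambda>p. Kpart n p q) - ?I k)))\<^sup>2 \<le> (\<integral>\<^sup>+p. ennreal (?f p) * ennreal (?g p) \<partial>lborel)\<^sup>2"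
        by (intro power_mono) auto
      also have "\<dots> \<le> (\<integral>\<^sup>+p. (ennreal (?f p))\<^sup>2 \<partial>lborel) * (\<integral>\<^sup>+p. (ennreal (?g p))\<^sup>2 \<partial>lborel)"
        by (rule Cauchy_Schwarz_nn_integral) measurable
      also have "(\<integral>\<^sup>+p. (ennreal (?f p))\<^sup>2 \<partial>lborel) = ennreal A"
        unfolding A(1)[symmetric] using V_nonneg by (intro nn_integral_cong) (simp add: ennreal_power power_mult_distrib)
      also have "(\<integral>\<^sup>+p. (ennreal (?g p))\<^sup>2 \<partial>lborel) = (\<integral>\<^sup>+p. ennreal ((cmod (K p q - Kpart n p q))\<^sup>2 * V p) \<partial>lborel)"
        using V_nonneg by (intro nn_integral_cong)
          (auto simp: ennreal_power power_mult_distrib k_def cut_def V_def norm_minus_commute split: split_indicator)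
      also have "ennreal A * \<dots> \<le> ennreal A * ennreal (tail n q)"
        by (intro mult_left_mono K_tail q) simp
      also have "\<dots> = ennreal (A * tail n q)" using A by (simp add: ennreal_mult')
      finally show ?thesis using A tail_nonneg[OF q] by (simp add: ennreal_power)
    qed
    have "(\<lambda>n. (cmod (?I (\<lambda>p. Kpart n p q) - ?I k))\<^sup>2) \<longlonglongrightarrow> 0"
    proof (rule tendsto_sandwich[of "\<lambda>_. 0"])
      show "(\<lambda>n. A * tail n q) \<longlonglongrightarrow> 0" using tendsto_mult[OF tendsto_const tail_limit[OF q], of A] by simp
    qed (use bound in auto)
    then have "(\<lambda>n. cmod (?I (\<lambda>p. Kpart n p q) - ?I k)) \<longlonglongrightarrow> 0"
      using tendsto_real_sqrt by fastforce
    then show "(\<lambda>n. ?I (\<lambda>p. Kpart n p q) - ?I k) \<longlonglongrightarrow> 0" by (rule tendsto_norm_zero_cancel)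
  qed
  ultimately show ?thesis unfolding RHS by (rule LIMSEQ_unique)
qed

end

section \<open>The Levi determinant\<close>

definition outer :: "complex^'n \<Rightarrow> complex^'n \<Rightarrow> complex^'n^'n" where
  "outer x y = (\<chi> i j. x $ i * y $ j)"

text \<open>Row \<open>k\<close> is \<open>y\<close>, so adding \<open>x i\<close> times row
  \<open>k\<close> to the unit row \<open>i\<close> is a row operation and preserves the
  determinant. For empty \<open>T\<close>, Cramer's lemma with the identity matrix gives the
  value.\<close>

lemma det_rank_one_aux:
  fixes y :: "'a::field^'n"
  assumes "finite T" "k \<notin> T"
  shows "det (\<chi> i. if i = k then y else if i \<in> T then axis i 1 + x i *s y else axis i 1) = y $ k"
  using assms
proof (induction T rule: finite_induct)
  case empty
  have row1: "row i (mat 1) = (axis i 1 :: 'a^'n)" for i by (auto simp: row_def mat_def axis_def vec_eq_iff)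
  have basis: "(\<Sum>i\<in>UNIV. y $ i *s row i (mat 1)) = y"
    by (simp add: row1 basis_expansion)
  have "det (\<chi> i. if i = k then y else row i (mat 1)) = y $ k * det (mat 1 :: 'a^'n^'n)"
    using cramer_lemma_transpose[of k y "mat 1"] unfolding basis by simp
  then show ?case by (simp add: row1 cong: if_cong)
next
  case (insert j T)
  let ?A = "(\<chi> i. if i = k then y else if i \<in> T then axis i 1 + x i *s y else axis i 1) :: 'a^'n^'n"
  have jk: "j \<noteq> k" using insert by auto
  have row: "row i ?A = ?A $ i" for i by (simp add: row_def vec_eq_iff)
  have "(\<chi> i. if i = k then y else if i \<in> insert j T then axis i 1 + x i *s y else axis i 1)
     = (\<chi> i. if i = j then row j ?A + x j *s row k ?A else row i ?A)"
    unfolding row using insert.hyps jk by (auto simp: vec_eq_iff)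
  then have "det (\<chi> i. if i = k then y else if i \<in> insert j T then axis i 1 + x i *s y else axis i 1) = det ?A"
    by (simp only: det_row_operation[OF jk])
  then show ?case using insert by simp
qed

text \<open>The matrix determinant lemma, by switching on the rank-one part row by row. Linearity in
  row \<open>k\<close> splits off the determinant of \<open>det_rank_one_aux\<close>, so each row
  contributes \<open>x $ k * y $ k\<close>.\<close>

lemma det_rank_one:
  fixes x y :: "complex^'n"
  shows "det (mat 1 + outer x y) = 1 + (\<Sum>i\<in>UNIV. x $ i * y $ i)"
proof -
  have "det (\<chi> i. if i \<in> T then axis i 1 + x $ i *s y else axis i 1) = 1 + (\<Sum>i\<in>T. x $ i * y $ i)" for T
    using finite[of T]
  proof (induction T rule: finite_induct)
    case empty
    have "(\<chi> i. axis i 1) = (mat 1 :: complex^'n^'n)" by (simp add: mat_def axis_def vec_eq_iff)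
    then show ?case by simp
  next
    case (insert k T)
    let ?c = "\<lambda>i. if i \<in> T then axis i 1 + x $ i *s y else axis i 1"
    have "(\<chi> i. if i \<in> insert k T then axis i 1 + x $ i *s y else axis i 1) = (\<chi> i. if i = k then axis i 1 + x $ i *s y else ?c i)"
      by (auto simp: vec_eq_iff)
    also have "det \<dots> = det (\<chi> i. if i = k then axis i 1 else ?c i) + det (\<chi> i. if i = k then x $ i *s y else ?c i)"
      by (rule det_row_add)
    also have "(\<chi> i. if i = k then axis i 1 else ?c i) = (\<chi> i. ?c i)" using insert by (auto simp: vec_eq_iff)
    also have "(\<chi> i. if i = k then x $ i *s y else ?c i) = (\<chi> i. if i = k then x $ k *s y else ?c i)" by (auto simp: vec_eq_iff)
    also have "det \<dots> = x $ k * det (\<chi> i. if i = k then y else ?c i)" by (rule det_row_mul)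
    also have "det (\<chi> i. if i = k then y else ?c i) = y $ k" using det_rank_one_aux[OF insert.hyps] .
    finally show ?case using insert by (simp add: algebra_simps)
  qed
  from this[of UNIV] have "det (\<chi> i. axis i 1 + x $ i *s y) = 1 + (\<Sum>i\<in>UNIV. x $ i * y $ i)" by simp
  moreover have "(\<chi> i. axis i 1 + x $ i *s y) = mat 1 + outer x y"
    by (auto simp: mat_def outer_def axis_def vec_eq_iff)
  ultimately show ?thesis by simp
qed

section \<open>First and second derivatives of the potential\<close>

lemma dirD_eq:
  assumes "(F has_derivative F') (at p)"
  shows "dirD v F p = F' v"
proof -
  have "((\<lambda>t. p + t *\<^sub>R v) has_derivative (\<lambda>t. t *\<^sub>R v)) (at 0)"
    by (auto intro!: derivative_eq_intros)
  then have "((\<lambda>t. F (p + t *\<^sub>R v)) has_derivative (\<lambda>t. F' (t *\<^sub>R v))) (at 0)"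
    using assms by (intro has_derivative_compose[where f="\<lambda>t. p + t *\<^sub>R v" and g=F]) auto
  moreover have "F' (t *\<^sub>R v) = F' v * t" for t
    using has_derivative_bounded_linear[OF assms] by (simp add: linear_simps)
  ultimately show ?thesis
    unfolding dirD_def by (intro DERIV_imp_deriv) (simp add: has_field_derivative_def)
qed

lemma zpart_linear: "bounded_linear (zpart :: complex^('n::finite + 'm::finite) \<Rightarrow> _)"
  by (intro linear_conv_bounded_linear[THEN iffD1] linearI) (simp_all add: zpart_def vec_eq_iff)

lemma wpart_linear: "bounded_linear (wpart :: complex^('n::finite + 'm::finite) \<Rightarrow> _)"
  by (intro linear_conv_bounded_linear[THEN iffD1] linearI) (simp_all add: wpart_def vec_eq_iff)

lemmas zw_derivs = bounded_linear.has_derivative[OF zpart_linear] bounded_linear.has_derivative[OF wpart_linear]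

text \<open>The squared radius of the fibre over \<open>z\<close>. The function \<open>gap\<close>
  that follows is the defining function of the domain and the argument of the logarithm in
  \<open>Phi\<close>.\<close>

definition Rad :: "real \<Rightarrow> complex^('n::finite + 'm::finite) \<Rightarrow> real" where
  "Rad \<mu> p = exp (- \<mu> * (norm (zpart p))\<^sup>2)"

definition gap :: "real \<Rightarrow> complex^('n::finite + 'm::finite) \<Rightarrow> real" where
  "gap \<mu> p = Rad \<mu> p - (norm (wpart p))\<^sup>2"

lemma Dom_gap: "p \<in> Dom \<mu> \<longleftrightarrow> gap \<mu> p > 0"
  by (simp add: Dom_def gap_def Rad_def)

lemma Phi_gap: "Phi \<mu> \<nu> p = \<nu> * \<mu> * (norm (zpart p))\<^sup>2 - ln (gap \<mu> p)"
  by (simp add: Phi_def gap_def Rad_def)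

lemma Rad_derivative:
  "(Rad \<mu> has_derivative (\<lambda>u. - 2 * \<mu> * Rad \<mu> p * (zpart p \<bullet> zpart u))) (at p)"
  unfolding Rad_def[abs_def] power2_norm_eq_inner
  by (auto intro!: derivative_eq_intros zw_derivs simp: inner_commute algebra_simps)

lemma gap_derivative:
  "(gap \<mu> has_derivative (\<lambda>u. - 2 * (\<mu> * Rad \<mu> p * (zpart p \<bullet> zpart u) + wpart p \<bullet> wpart u))) (at p)"
  unfolding gap_def[abs_def] power2_norm_eq_inner
  by (auto intro!: derivative_eq_intros zw_derivs Rad_derivative simp: inner_commute algebra_simps)

lemma open_Dom: "open (Dom \<mu>)"
proof -
  have "continuous_on UNIV (gap \<mu>)"
    using gap_derivative by (intro continuous_at_imp_continuous_on) (blast intro: has_derivative_continuous)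
  then have "open {p. 0 < gap \<mu> p}" by (intro open_Collect_less continuous_intros)
  then show ?thesis by (simp add: Dom_gap[symmetric])
qed

definition dPhi :: "real \<Rightarrow> real \<Rightarrow> complex^('n::finite + 'm::finite) \<Rightarrow> complex^('n + 'm) \<Rightarrow> real" where
  "dPhi \<mu> \<nu> v p = 2 * \<nu> * \<mu> * (zpart p \<bullet> zpart v) + 2 / gap \<mu> p * (\<mu> * Rad \<mu> p * (zpart p \<bullet> zpart v) + wpart p \<bullet> wpart v)"

lemma dirD_Phi:
  assumes "p \<in> Dom \<mu>"
  shows "dirD v (Phi \<mu> \<nu>) p = dPhi \<mu> \<nu> v p"
proof -
  have "gap \<mu> p > 0" using assms by (simp add: Dom_gap)
  then have "(Phi \<mu> \<nu> has_derivative (\<lambda>v. dPhi \<mu> \<nu> v p)) (at p)"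
    unfolding Phi_gap[abs_def] power2_norm_eq_inner dPhi_def
    by (auto intro!: derivative_eq_intros zw_derivs gap_derivative simp: inner_commute field_simps)
  then show ?thesis by (rule dirD_eq)
qed

text \<open>The real Hessian of \<open>Phi\<close> as a bilinear form in \<open>u\<close> and
  \<open>v\<close>; the last summand comes from differentiating \<open>1 / gap\<close> in
  \<open>dPhi\<close>.\<close>

definition hPhi :: "real \<Rightarrow> real \<Rightarrow> complex^('n::finite + 'm::finite) \<Rightarrow> complex^('n + 'm) \<Rightarrow> complex^('n + 'm) \<Rightarrow> real" where
  "hPhi \<mu> \<nu> p u v = 2 * \<nu> * \<mu> * (zpart u \<bullet> zpart v)
    + 2 / gap \<mu> p * (\<mu> * Rad \<mu> p * (zpart u \<bullet> zpart v) + wpart u \<bullet> wpart v - 2 * \<mu>\<^sup>2 * Rad \<mu> p * (zpart p \<bullet> zpart u) * (zpart p \<bullet> zpart v))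
    + 4 / (gap \<mu> p)\<^sup>2 * (\<mu> * Rad \<mu> p * (zpart p \<bullet> zpart u) + wpart p \<bullet> wpart u) * (\<mu> * Rad \<mu> p * (zpart p \<bullet> zpart v) + wpart p \<bullet> wpart v)"

text \<open>The closed form of the first derivative is available on the domain only; as the domain
  is open, it still determines the second derivative there.\<close>

lemma dirD_dirD_Phi:
  assumes "p \<in> Dom \<mu>"
  shows "dirD u (dirD v (Phi \<mu> \<nu>)) p = hPhi \<mu> \<nu> p u v"
proof -
  have g: "gap \<mu> p > 0" using assms by (simp add: Dom_gap)
  then have "(dPhi \<mu> \<nu> v has_derivative (\<lambda>u. hPhi \<mu> \<nu> p u v)) (at p)"
    unfolding dPhi_def[abs_def] hPhi_def
    by (auto intro!: derivative_eq_intros zw_derivs gap_derivative Rad_derivative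
        simp: inner_commute field_simps power2_eq_square)
  then have "(dirD v (Phi \<mu> \<nu>) has_derivative (\<lambda>u. hPhi \<mu> \<nu> p u v)) (at p)"
    by (rule has_derivative_transform_within_open[OF _ open_Dom assms]) (simp add: dirD_Phi)
  then show ?thesis by (rule dirD_eq)
qed

text \<open>Padding \<open>z\<close> and \<open>w\<close> by zeros to the full index type gives all
  four blocks of the Levi matrix a single formula, and makes the two vectors disjointly
  supported.\<close>

definition zvec :: "complex^('n::finite + 'm::finite) \<Rightarrow> complex^('n + 'm)" where
  "zvec p = (\<chi> j. case j of Inl i \<Rightarrow> p $ Inl i | Inr i \<Rightarrow> 0)"

definition wvec :: "complex^('n::finite + 'm::finite) \<Rightarrow> complex^('n + 'm)" where
  "wvec p = (\<chi> j. case j of Inl i \<Rightarrow> 0 | Inr i \<Rightarrow> p $ Inr i)"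

definition cvec :: "complex^'n \<Rightarrow> complex^'n" where
  "cvec x = (\<chi> j. cnj (x $ j))"

lemma inner_zpart_axis:
  fixes p :: "complex^('a::finite + 'b::finite)"
  shows "zpart p \<bullet> zpart (axis j c) = zvec p $ j \<bullet> c"
proof (cases j)
  case (Inl i)
  have "zpart (axis j c :: complex^('a + 'b)) = axis i c" by (auto simp: zpart_def axis_def Inl vec_eq_iff)
  then show ?thesis by (simp add: inner_axis zvec_def Inl zpart_def)
next
  case (Inr i)
  have "zpart (axis j c :: complex^('a + 'b)) = 0" by (auto simp: zpart_def axis_def Inr vec_eq_iff)
  then show ?thesis by (simp add: zvec_def Inr)
qed

lemma inner_wpart_axis:
  fixes p :: "complex^('a::finite + 'b::finite)"
  shows "wpart p \<bullet> wpart (axis j c) = wvec p $ j \<bullet> c"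
proof (cases j)
  case (Inr i)
  have "wpart (axis j c :: complex^('a + 'b)) = axis i c" by (auto simp: wpart_def axis_def Inr vec_eq_iff)
  then show ?thesis by (simp add: inner_axis wvec_def Inr wpart_def)
next
  case (Inl i)
  have "wpart (axis j c :: complex^('a + 'b)) = 0" by (auto simp: wpart_def axis_def Inl vec_eq_iff)
  then show ?thesis by (simp add: wvec_def Inl)
qed

text \<open>A polynomial identity in which \<open>x\<close>, \<open>y\<close> stand for entries
  \<open>j\<close>, \<open>k\<close> of \<open>zvec\<close>, \<open>u\<close>, \<open>v\<close> for
  those of \<open>wvec\<close>, \<open>c\<close> for the inverse of \<open>gap\<close>, and
  \<open>h\<close> for values of \<open>hPhi\<close>. In the imaginary part the last two arguments
  are 0 because \<open>axis j 1\<close> and \<open>axis k \<i>\<close> are always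
  orthogonal.\<close>

lemma levi_algebra:
  fixes x y u v :: complex and \<mu> \<nu> R c \<delta> \<epsilon> :: real
  defines "h a b r s d e \<equiv> 2 * \<nu> * \<mu> * d + 2 * c * (\<mu> * R * d + e - 2 * \<mu>\<^sup>2 * R * a * b) + 4 * c\<^sup>2 * (\<mu> * R * a + r) * (\<mu> * R * b + s)"
  shows "(1/4) * Complex (h (Re x) (Re y) (Re u) (Re v) \<delta> \<epsilon> + h (Im x) (Im y) (Im u) (Im v) \<delta> \<epsilon>)
        (h (Re x) (Im y) (Re u) (Im v) 0 0 - h (Im x) (Re y) (Im u) (Re v) 0 0)
    = of_real (\<nu> * \<mu> * \<delta> + c * (\<mu> * R * \<delta> + \<epsilon>)) - of_real (\<mu>\<^sup>2 * R * c) * cnj x * y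
      + of_real (c\<^sup>2) * cnj (of_real (\<mu> * R) * x + u) * (of_real (\<mu> * R) * y + v)"
  unfolding h_def complex_eq_iff by (simp add: field_simps power2_eq_square)

lemma levi_Phi:
  fixes p :: "complex^('n::finite + 'm::finite)"
  assumes "p \<in> Dom \<mu>"
  shows "levi (Phi \<mu> \<nu>) p j k =
      (if j = k then of_real (case j of Inl _ \<Rightarrow> \<mu> * (\<nu> + Rad \<mu> p / gap \<mu> p) | Inr _ \<Rightarrow> 1 / gap \<mu> p) else 0)
      - of_real (\<mu>\<^sup>2 * Rad \<mu> p / gap \<mu> p) * cnj (zvec p $ j) * (zvec p $ k)
      + of_real (1 / (gap \<mu> p)\<^sup>2) * cnj (of_real (\<mu> * Rad \<mu> p) * zvec p $ j + wvec p $ j) * (of_real (\<mu> * Rad \<mu> p) * zvec p $ k + wvec p $ k)"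
proof -
  define \<delta> where "\<delta> = (if j = k then case j of Inl _ \<Rightarrow> 1 | Inr _ \<Rightarrow> 0 else 0 :: real)"
  define \<epsilon> where "\<epsilon> = (if j = k then case j of Inl _ \<Rightarrow> 0 | Inr _ \<Rightarrow> 1 else 0 :: real)"
  have d: "Re (zvec (axis j 1 :: complex^('n + 'm)) $ k) = \<delta>" "Im (zvec (axis j 1 :: complex^('n + 'm)) $ k) = 0"
    "Re (zvec (axis j \<i> :: complex^('n + 'm)) $ k) = 0" "Im (zvec (axis j \<i> :: complex^('n + 'm)) $ k) = \<delta>"
    "Re (wvec (axis j 1 :: complex^('n + 'm)) $ k) = \<epsilon>" "Im (wvec (axis j 1 :: complex^('n + 'm)) $ k) = 0"
    "Re (wvec (axis j \<i> :: complex^('n + 'm)) $ k) = 0" "Im (wvec (axis j \<i> :: complex^('n + 'm)) $ k) = \<epsilon>"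
    by (auto simp: zvec_def wvec_def axis_def \<delta>_def \<epsilon>_def split: sum.splits)
  have ii: "x \<bullet> 1 = Re x" "x \<bullet> \<i> = Im x" for x by (simp_all add: inner_complex_def)
  have "levi (Phi \<mu> \<nu>) p j k = of_real (\<nu> * \<mu> * \<delta> + inverse (gap \<mu> p) * (\<mu> * Rad \<mu> p * \<delta> + \<epsilon>))
      - of_real (\<mu>\<^sup>2 * Rad \<mu> p * inverse (gap \<mu> p)) * cnj (zvec p $ j) * (zvec p $ k)
      + of_real ((inverse (gap \<mu> p))\<^sup>2) * cnj (of_real (\<mu> * Rad \<mu> p) * zvec p $ j + wvec p $ j) * (of_real (\<mu> * Rad \<mu> p) * zvec p $ k + wvec p $ k)"
    unfolding levi_algebra[symmetric] levi_def dirD_dirD_Phi[OF assms] hPhi_def inner_zpart_axis inner_wpart_axis ii d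
    by (simp only: divide_inverse power_inverse)
  also have "complex_of_real (\<nu> * \<mu> * \<delta> + inverse (gap \<mu> p) * (\<mu> * Rad \<mu> p * \<delta> + \<epsilon>))
     = (if j = k then of_real (case j of Inl _ \<Rightarrow> \<mu> * (\<nu> + Rad \<mu> p / gap \<mu> p) | Inr _ \<Rightarrow> 1 / gap \<mu> p) else 0)"
    by (auto simp: \<delta>_def \<epsilon>_def divide_inverse algebra_simps split: sum.splits)
  finally show ?thesis by (simp only: divide_inverse power_inverse mult_1)
qed

lemma norm_wpart: "of_real ((norm (wpart p))\<^sup>2) = (\<Sum>j\<in>UNIV. wvec p $ j * cnj (wvec p $ j))"
proof -
  have "(\<Sum>j\<in>UNIV. wvec p $ j * cnj (wvec p $ j)) = (\<Sum>i\<in>UNIV. wpart p $ i * cnj (wpart p $ i))"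
    by (subst UNIV_sum, subst sum.union_disjoint) (auto simp: sum.reindex wvec_def wpart_def)
  also have "\<dots> = of_real ((norm (wpart p))\<^sup>2)"
    by (simp add: norm_vec_def L2_set_def sum_nonneg complex_norm_square del: of_real_power)
  finally show ?thesis ..
qed

text \<open>In the adapted coframe the form is \<open>B\<close>: \<open>\<kappa>\<close> times the
  identity on the \<open>z\<close> block, and \<open>1 / E\<close> times the identity plus a
  rank-one term on the \<open>w\<close> block. The coframe changes \<open>Q\<close> and
  \<open>Q'\<close> have determinant 1 because \<open>a\<close> and \<open>b\<close> have disjoint
  supports. In \<open>det B\<close> the rank-one term contributes \<open>1 + S / E\<close>, which is
  \<open>R / E\<close>; this accounts for the factor \<open>Rad\<close> and the exponent
  \<open>m + 1\<close>.\<close>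

lemma vol_density_Phi:
  fixes p :: "complex^('n::finite + 'm::finite)"
  assumes p: "p \<in> Dom \<mu>"
  shows "vol_density (Phi \<mu> \<nu>) p = (\<mu> * (\<nu> + Rad \<mu> p / gap \<mu> p)) ^ CARD('n) * Rad \<mu> p / gap \<mu> p ^ (CARD('m) + 1) / pi ^ CARD('n + 'm)"
proof -
  define E where "E = complex_of_real (gap \<mu> p)"
  define R where "R = complex_of_real (Rad \<mu> p)"
  define S where "S = complex_of_real ((norm (wpart p))\<^sup>2)"
  define \<kappa> where "\<kappa> = complex_of_real (\<mu> * (\<nu> + Rad \<mu> p / gap \<mu> p))"
  define a where "a = zvec p"
  define b where "b = wvec p"
  define dg where "dg j = (case j of Inl _ \<Rightarrow> \<kappa> | Inr _ \<Rightarrow> 1 / E)" for j :: "'n + 'm"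
  define \<mu>' where "\<mu>' = complex_of_real \<mu>"
  have E0: "E \<noteq> 0" using p by (simp add: Dom_gap E_def)
  have RES: "R = E + S" by (simp add: R_def E_def S_def gap_def)
  have S: "(\<Sum>j\<in>UNIV. b $ j * cnj (b $ j)) = S" unfolding S_def b_def norm_wpart ..
  have ab: "a $ j * b $ j = 0" "cnj (a $ j) * b $ j = 0" "dg j * b $ j = b $ j / E" "dg j * cnj (b $ j) = cnj (b $ j) / E" for j
    by (auto simp: a_def b_def zvec_def wvec_def dg_def split: sum.splits)
  define B where "B = (\<chi> j k. (if j = k then dg j else 0) + cnj (b $ j) * b $ k / E\<^sup>2)"
  define Q where "Q = mat 1 + outer (\<mu>' *s cvec a) b"
  define Q' where "Q' = mat 1 + outer (cvec b) (\<mu>' *s a)"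
  have QB: "(Q ** B) $ j $ k = B $ j $ k + \<mu>' * cnj (a $ j) * (R / E\<^sup>2) * b $ k" for j k
  proof -
    \<comment> \<open>\<open>b\<close> is a left eigenvector of \<open>B\<close>, with eigenvalue
      \<open>1 / E + S / E\<^sup>2 = R / E\<^sup>2\<close>.\<close>
    have "(\<Sum>m\<in>UNIV. b $ m * B $ m $ k) = (\<Sum>m\<in>UNIV. (if m = k then dg k * b $ k else 0) + (b $ m * cnj (b $ m)) * b $ k / E\<^sup>2)"
      by (intro sum.cong refl) (simp add: B_def field_simps)
    also have "\<dots> = (R / E\<^sup>2) * b $ k"
      unfolding sum.distrib sum_divide_distrib[symmetric] sum_distrib_right[symmetric] S ab RES
      using E0 by (simp add: ab field_simps power2_eq_square)
    finally have *: "(\<Sum>m\<in>UNIV. b $ m * B $ m $ k) = (R / E\<^sup>2) * b $ k" .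
    have "(Q ** B) $ j $ k = (\<Sum>m\<in>UNIV. (if m = j then B $ j $ k else 0) + \<mu>' * cnj (a $ j) * (b $ m * B $ m $ k))"
      by (auto simp: matrix_matrix_mult_def Q_def outer_def cvec_def mat_def algebra_simps intro!: sum.cong)
    also have "\<dots> = B $ j $ k + \<mu>' * cnj (a $ j) * (R / E\<^sup>2) * b $ k"
      unfolding sum.distrib sum_distrib_left[symmetric] * by simp
    finally show ?thesis .
  qed
  have QBQ: "((Q ** B) ** Q') $ j $ k = B $ j $ k + \<mu>' * cnj (a $ j) * (R / E\<^sup>2) * b $ k
      + (R / E\<^sup>2) * \<mu>' * cnj (b $ j) * a $ k + \<mu>'\<^sup>2 * (R * S / E\<^sup>2) * cnj (a $ j) * a $ k" for j k
  proof -
    have "(\<Sum>m\<in>UNIV. (Q ** B) $ j $ m * cnj (b $ m)) = (\<Sum>m\<in>UNIV. (if m = j then dg j * cnj (b $ j) else 0)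
        + (cnj (b $ j) / E\<^sup>2 + \<mu>' * cnj (a $ j) * (R / E\<^sup>2)) * (b $ m * cnj (b $ m)))"
      unfolding QB by (intro sum.cong refl) (auto simp: B_def algebra_simps add_divide_distrib)
    also have "\<dots> = cnj (b $ j) / E + (cnj (b $ j) / E\<^sup>2 + \<mu>' * cnj (a $ j) * (R / E\<^sup>2)) * S"
      unfolding sum.distrib sum_distrib_left[symmetric] S by (simp add: ab)
    also have "\<dots> = (R / E\<^sup>2) * cnj (b $ j) + \<mu>' * (R * S / E\<^sup>2) * cnj (a $ j)"
      unfolding RES using E0 by (simp add: field_simps power2_eq_square)
    finally have *: "(\<Sum>m\<in>UNIV. (Q ** B) $ j $ m * cnj (b $ m)) = (R / E\<^sup>2) * cnj (b $ j) + \<mu>' * (R * S / E\<^sup>2) * cnj (a $ j)" .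
    have "((Q ** B) ** Q') $ j $ k = (\<Sum>m\<in>UNIV. (if m = k then (Q ** B) $ j $ k else 0) + (Q ** B) $ j $ m * cnj (b $ m) * (\<mu>' * a $ k))"
      by (subst matrix_matrix_mult_def) (auto simp: Q'_def outer_def cvec_def mat_def algebra_simps intro!: sum.cong)
    also have "\<dots> = (Q ** B) $ j $ k + ((R / E\<^sup>2) * cnj (b $ j) + \<mu>' * (R * S / E\<^sup>2) * cnj (a $ j)) * (\<mu>' * a $ k)"
      unfolding sum.distrib sum_distrib_right[symmetric] * by simp
    finally show ?thesis unfolding QB by (simp add: algebra_simps power2_eq_square)
  qed
  have "(\<chi> j k. levi (Phi \<mu> \<nu>) p j k) = (Q ** B) ** Q'"
  proof (simp only: vec_eq_iff vec_lambda_beta QBQ, intro allI)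
    fix j k
    have "levi (Phi \<mu> \<nu>) p j k = (if j = k then dg j else 0) - \<mu>'\<^sup>2 * R / E * cnj (a $ j) * a $ k
       + 1 / E\<^sup>2 * (\<mu>' * R * cnj (a $ j) + cnj (b $ j)) * (\<mu>' * R * a $ k + b $ k)"
      unfolding levi_Phi[OF p] a_def b_def \<mu>'_def R_def E_def dg_def \<kappa>_def by (auto split: sum.splits)
    \<comment> \<open>The coefficients of \<open>cnj (a $ j) * a $ k\<close> match because
      \<open>R\<^sup>2 - R * E = R * S\<close>.\<close>
    also have "\<dots> = B $ j $ k + \<mu>' * cnj (a $ j) * (R / E\<^sup>2) * b $ k
      + (R / E\<^sup>2) * \<mu>' * cnj (b $ j) * a $ k + \<mu>'\<^sup>2 * (R * S / E\<^sup>2) * cnj (a $ j) * a $ k"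
    proof -
      show ?thesis unfolding RES using E0 by (simp add: B_def field_simps power2_eq_square)
    qed
    finally show "levi (Phi \<mu> \<nu>) p j k = B $ j $ k + \<mu>' * cnj (a $ j) * (R / E\<^sup>2) * b $ k
      + (R / E\<^sup>2) * \<mu>' * cnj (b $ j) * a $ k + \<mu>'\<^sup>2 * (R * S / E\<^sup>2) * cnj (a $ j) * a $ k" .
  qed
  moreover have "det Q = 1" unfolding Q_def det_rank_one by (simp add: cvec_def ab mult.assoc)
  moreover have "det Q' = 1"
  proof -
    have "cvec b $ j * (\<mu>' *s a) $ j = 0" for j using ab(1)[of j] by (auto simp: cvec_def)
    then show ?thesis unfolding Q'_def det_rank_one by (simp only: sum.neutral_const add_0_right)
  qed
  moreover have "det B = \<kappa> ^ CARD('n) * R / E ^ (CARD('m) + 1)"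
  proof -
    define G where "G = (\<chi> j k. if j = k then dg j else 0)"
    have "B = G ** (mat 1 + outer ((1 / E) *s cvec b) b)"
    proof (simp only: vec_eq_iff, intro allI)
      fix j k
      have "(G ** (mat 1 + outer ((1 / E) *s cvec b) b)) $ j $ k
         = (\<Sum>m\<in>UNIV. if m = j then dg j * ((if j = k then 1 else 0) + cnj (b $ j) / E * b $ k) else 0)"
        unfolding matrix_matrix_mult_def vec_lambda_beta G_def
        by (intro sum.cong refl) (auto simp: mat_def outer_def cvec_def)
      also have "\<dots> = (if j = k then dg j else 0) + (dg j * cnj (b $ j)) / E * b $ k"
        by (simp add: algebra_simps)
      also have "\<dots> = B $ j $ k" unfolding ab by (simp add: B_def power2_eq_square)
      finally show "B $ j $ k = (G ** (mat 1 + outer ((1 / E) *s cvec b) b)) $ j $ k" ..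
    qed
    then have "det B = det G * (1 + (\<Sum>j\<in>UNIV. (1 / E) * (b $ j * cnj (b $ j))))"
      by (simp add: det_mul det_rank_one cvec_def mult_ac)
    also have "(\<Sum>j\<in>UNIV. (1 / E) * (b $ j * cnj (b $ j))) = S / E"
      unfolding sum_distrib_left[symmetric] S by simp
    also have "det G = (\<Prod>j\<in>UNIV. dg j)" by (subst det_diagonal) (auto simp: G_def)
    also have "(\<Prod>j\<in>UNIV. dg j) = \<kappa> ^ CARD('n) * (1 / E) ^ CARD('m)"
      by (subst UNIV_sum, subst prod.union_disjoint) (auto simp: prod.reindex dg_def)
    finally show ?thesis using E0 by (simp add: RES field_simps power_divide)
  qed
  ultimately have "det (\<chi> j k. levi (Phi \<mu> \<nu>) p j k) = \<kappa> ^ CARD('n) * R / E ^ (CARD('m) + 1)"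
    by (simp add: det_mul)
  also have "\<dots> = of_real ((\<mu> * (\<nu> + Rad \<mu> p / gap \<mu> p)) ^ CARD('n) * Rad \<mu> p / gap \<mu> p ^ (CARD('m) + 1))"
    by (simp add: \<kappa>_def R_def E_def)
  finally have "Re (det (\<chi> j k. levi (Phi \<mu> \<nu>) p j k)) = (\<mu> * (\<nu> + Rad \<mu> p / gap \<mu> p)) ^ CARD('n) * Rad \<mu> p / gap \<mu> p ^ (CARD('m) + 1)"
    by (simp only: Re_complex_of_real)
  then show ?thesis by (simp add: vol_density_def)
qed

section \<open>The weighted Bergman kernel\<close>

lemma norm_zpart_sum: "(norm (zpart p))\<^sup>2 = (\<Sum>i\<in>range Inl. (cmod (p $ i))\<^sup>2)"
  by (simp add: norm_vec_def L2_set_def sum_nonneg zpart_def sum.reindex)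

lemma norm_wpart_sum: "(norm (wpart p))\<^sup>2 = (\<Sum>i\<in>range Inr. (cmod (p $ i))\<^sup>2)"
  by (simp add: norm_vec_def L2_set_def sum_nonneg wpart_def sum.reindex)

text \<open>Since \<open>Rad\<close> is a Gaussian in \<open>z\<close>, each term of the binomial
  expansion of \<open>(\<nu> + Rad / gap) ^ n\<close> is a Gaussian times a power of
  \<open>gap\<close>. This is the integrand of \<open>nn_integral_Hartogs_moment\<close> with
  \<open>\<kappa> = \<alpha> * \<nu> + 1 + d\<close> and
  \<open>\<beta> = \<alpha> - m - d\<close>.\<close>

lemma weight_expand:
  fixes p :: "complex^('n::finite + 'm::finite)"
  assumes p: "p \<in> Dom \<mu>"
  shows "weight \<mu> \<nu> \<alpha> p = (\<Sum>d=0..CARD('n). real (CARD('n) choose d) * \<nu> ^ (CARD('n) - d) * (\<mu> ^ CARD('n) / pi ^ CARD('n + 'm))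
      * (exp (- \<mu> * (\<alpha> * \<nu> + 1 + real d) * (norm (zpart p))\<^sup>2) * gap \<mu> p powr (\<alpha> - real CARD('m) - real d - 1)))"
proof -
  define n where "n = CARD('n)"
  define m where "m = CARD('m)"
  define t where "t = (norm (zpart p))\<^sup>2"
  define E where "E = gap \<mu> p"
  define R where "R = Rad \<mu> p"
  have E: "E > 0" using p by (simp add: E_def Dom_gap)
  have R: "R = exp (- \<mu> * t)" by (simp add: R_def Rad_def t_def)
  have "exp (- \<alpha> * Phi \<mu> \<nu> p) = exp (- \<mu> * (\<alpha> * \<nu>) * t) * E powr \<alpha>"
    using E by (simp add: Phi_gap E_def[symmetric] t_def[symmetric] powr_def algebra_simps flip: exp_add)
  moreover have "vol_density (Phi \<mu> \<nu>) p = \<mu> ^ n * (R / E + \<nu>) ^ n * R / E ^ (m + 1) / pi ^ CARD('n + 'm)"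
    unfolding vol_density_Phi[OF p] E_def R_def n_def m_def by (simp add: power_mult_distrib add.commute)
  moreover have "(R / E + \<nu>) ^ n = (\<Sum>d=0..n. real (n choose d) * (R / E) ^ d * \<nu> ^ (n - d))"
    by (subst binomial_ring) (simp add: atLeast0AtMost)
  ultimately have "weight \<mu> \<nu> \<alpha> p = (\<Sum>d=0..n. (exp (- \<mu> * (\<alpha> * \<nu>) * t) * E powr \<alpha>) * (\<mu> ^ n * (real (n choose d) * (R / E) ^ d * \<nu> ^ (n - d)) * R / E ^ (m + 1) / pi ^ CARD('n + 'm)))"
    unfolding weight_def by (simp only: sum_distrib_left sum_distrib_right sum_divide_distrib)
  also have "\<dots> = (\<Sum>d=0..n. real (n choose d) * \<nu> ^ (n - d) * (\<mu> ^ n / pi ^ CARD('n + 'm))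
      * (exp (- \<mu> * (\<alpha> * \<nu> + 1 + real d) * t) * E powr (\<alpha> - real m - real d - 1)))"
  proof (intro sum.cong refl)
    fix d
    \<comment> \<open>Of the \<open>d + 1\<close> powers of \<open>R\<close>, \<open>d\<close> come
      from the binomial term and one from the Levi determinant.\<close>
    have "exp (- \<mu> * (\<alpha> * \<nu> + 1 + real d) * t) = exp (- \<mu> * (\<alpha> * \<nu>) * t) * R ^ (d + 1)"
      unfolding R by (simp add: exp_of_nat_mult[symmetric] algebra_simps flip: exp_add)
    moreover have "E powr (\<alpha> - real m - real d - 1) = E powr \<alpha> / E ^ (d + (m + 1))"
      using E by (simp add: powr_diff powr_realpow[symmetric] powr_add field_simps)
    ultimately show "(exp (- \<mu> * (\<alpha> * \<nu>) * t) * E powr \<alpha>) * (\<mu> ^ n * (real (n choose d) * (R / E) ^ d * \<nu> ^ (n - d)) * R / E ^ (m + 1) / pi ^ CARD('n + 'm))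
      = real (n choose d) * \<nu> ^ (n - d) * (\<mu> ^ n / pi ^ CARD('n + 'm))
      * (exp (- \<mu> * (\<alpha> * \<nu> + 1 + real d) * t) * E powr (\<alpha> - real m - real d - 1))"
      by (simp only: power_divide power_add) (simp add: field_simps)
  qed
  finally show ?thesis by (simp only: n_def m_def t_def E_def)
qed

text \<open>\<open>dims\<close> carries the types \<open>'n\<close> and \<open>'m\<close>, which the
  types of the real parameters do not mention.\<close>

locale Hartogs =
  fixes \<mu> \<nu> \<alpha> :: real and dims :: "('n::finite \<times> 'm::finite) itself"
  assumes mu: "\<mu> > 0" and nu: "\<nu> > -1" and alpha: "\<alpha> > real (CARD('n) + CARD('m))"
begin

abbreviation Dm :: "(complex^('n + 'm)) set" where "Dm \<equiv> Dom \<mu>"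

abbreviation Wt :: "complex^('n + 'm) \<Rightarrow> real" where "Wt \<equiv> weight \<mu> \<nu> \<alpha>"

abbreviation wdeg :: "('n + 'm \<Rightarrow> nat) \<Rightarrow> nat" where "wdeg a \<equiv> \<Sum>i\<in>range Inr. a i"

abbreviation zdeg :: "('n + 'm \<Rightarrow> nat) \<Rightarrow> nat" where "zdeg a \<equiv> \<Sum>i\<in>range Inl. a i"

text \<open>The Gaussian rate in \<open>z\<close>, up to the factor \<open>\<mu>\<close>. In each
  binomial term it arises as \<open>(\<alpha> * \<nu> + 1 + d) + (\<alpha> - d - 1 + k)\<close>,
  where \<open>d\<close> cancels.\<close>

definition rate :: "nat \<Rightarrow> real" where "rate k = (\<nu> + 1) * \<alpha> + real k"

lemma alpha_pos: "\<alpha> > 0" using alpha by linarith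

lemma rate_pos: "rate k > 0"
  using nu alpha_pos by (simp add: rate_def add_pos_nonneg)

text \<open>One binomial term of the weighted squared monomial, stripped of its coefficient. It is
  nonnegative even when the coefficient, for negative \<open>\<nu>\<close>, is not, so its integral
  can be computed as a nonnegative one.\<close>

definition piece :: "nat \<Rightarrow> ('n + 'm \<Rightarrow> nat) \<Rightarrow> complex^('n + 'm) \<Rightarrow> real" where
  "piece d a p = (cmod (mon p a))\<^sup>2 * (indicator Dm p * (exp (- \<mu> * (\<alpha> * \<nu> + 1 + real d) * (norm (zpart p))\<^sup>2)
      * gap \<mu> p powr (\<alpha> - real CARD('m) - real d - 1)))"

definition piece_val :: "nat \<Rightarrow> ('n + 'm \<Rightarrow> nat) \<Rightarrow> real" where
  "piece_val d a = pi ^ CARD('n + 'm) * (\<Prod>i\<in>UNIV. fact (a i)) * Gamma (\<alpha> - real CARD('m) - real d) / Gamma (\<alpha> - real d + real (wdeg a))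
        / (\<mu> * rate (wdeg a)) ^ (CARD('n) + zdeg a)"

lemma continuous_gap [continuous_intros]: "continuous_on S (gap \<mu> :: complex^('n + 'm) \<Rightarrow> real)"
  using gap_derivative by (intro continuous_at_imp_continuous_on) (blast intro: has_derivative_continuous)

lemma continuous_zpart [continuous_intros]: "continuous_on S (zpart :: complex^('n + 'm) \<Rightarrow> _)"
  using zpart_linear by (rule bounded_linear.continuous_on) (rule continuous_on_id)

lemma measurable_basic [measurable]:
  "gap \<mu> \<in> borel_measurable (borel :: (complex^('n + 'm)) measure)" "Dm \<in> sets borel"
  "zpart \<in> borel_measurable (borel :: (complex^('n + 'm)) measure)"
  by (auto intro!: borel_measurable_continuous_onI continuous_intros borel_open open_Dom)

lemma piece_nonneg: "piece d a p \<ge> 0"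
  by (auto simp: piece_def)

lemma piece_measurable [measurable]: "piece d a \<in> borel_measurable borel"
  unfolding piece_def[abs_def] by measurable

lemma piece_nn_integral:
  assumes d: "d \<le> CARD('n)"
  shows "(\<integral>\<^sup>+p. ennreal (piece d a p) \<partial>lborel) = ennreal (piece_val d a)"
proof -
  let ?\<beta> = "\<alpha> - real CARD('m) - real d" and ?\<kappa> = "\<alpha> * \<nu> + 1 + real d"
  let ?E = "?\<beta> - 1 + real CARD('m) + real (wdeg a)"
  \<comment> \<open>Here the hypothesis on \<open>\<alpha>\<close> gives convergence of the
    \<open>w\<close> integral, with \<open>d = n\<close> the critical case.\<close>
  have beta: "?\<beta> > 0" using alpha d by simp
  have E: "?E + 1 = \<alpha> - real d + real (wdeg a)" "?\<kappa> + ?E = rate (wdeg a)"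
    by (simp_all add: rate_def algebra_simps)
  have pos: "?\<kappa> + ?E > 0" unfolding E using rate_pos .
  have mon2: "(cmod (mon p a))\<^sup>2 = (\<Prod>i\<in>UNIV. ((cmod (p $ i))\<^sup>2) ^ a i)" for p
    unfolding cmod_mon prod_power_distrib by (simp only: power_mult[symmetric] mult.commute[of 2])
  have "(\<integral>\<^sup>+p. ennreal (piece d a p) \<partial>lborel)
    = (\<integral>\<^sup>+p. ennreal ((\<Prod>i\<in>UNIV. ((cmod (p $ i))\<^sup>2) ^ a i) * exp (- \<mu> * ?\<kappa> * (\<Sum>i\<in>range Inl. (cmod (p $ i))\<^sup>2))
      * (exp (- \<mu> * (\<Sum>i\<in>range Inl. (cmod (p $ i))\<^sup>2)) - (\<Sum>i\<in>range Inr. (cmod (p $ i))\<^sup>2)) powr (?\<beta> - 1))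
      * indicator {p. (\<Sum>i\<in>range Inr. (cmod (p $ i))\<^sup>2) < exp (- \<mu> * (\<Sum>i\<in>range Inl. (cmod (p $ i))\<^sup>2))} p \<partial>lborel)"
    unfolding piece_def mon2 gap_def Rad_def Dom_def norm_zpart_sum norm_wpart_sum
    by (intro nn_integral_cong) (simp add: indicator_def mult.assoc)
  also have "\<dots> = ennreal (pi ^ CARD('n + 'm) * (\<Prod>i\<in>UNIV. fact (a i)) * Gamma ?\<beta> / Gamma (?E + 1)
        / (\<mu> * (?\<kappa> + ?E)) ^ (CARD('n) + zdeg a))"
    by (rule nn_integral_Hartogs_moment[OF mu beta pos])
  finally show ?thesis unfolding E piece_val_def .
qed

lemma piece_val_nonneg:
  assumes d: "d \<le> CARD('n)"
  shows "piece_val d a \<ge> 0"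
proof -
  have "\<alpha> - real CARD('m) - real d > 0" "\<alpha> - real d + real (wdeg a) > 0" using alpha d by linarith+
  then show ?thesis unfolding piece_val_def using mu rate_pos[of "wdeg a"]
    by (intro divide_nonneg_nonneg mult_nonneg_nonneg Gamma_real_nonneg prod_nonneg zero_le_power) (auto simp: less_imp_le)
qed

lemma piece_integral:
  assumes d: "d \<le> CARD('n)"
  shows "integrable lborel (piece d a)" "(\<integral>p. piece d a p \<partial>lborel) = piece_val d a"
proof -
  show "integrable lborel (piece d a)"
    by (rule integrableI_nonneg) (auto simp: piece_nonneg piece_nn_integral[OF d])
  show "(\<integral>p. piece d a p \<partial>lborel) = piece_val d a"
    by (subst integral_eq_nn_integral) (auto simp: piece_nonneg piece_nn_integral[OF d] piece_val_nonneg[OF d])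
qed

lemma weight_pieces:
  "(cmod (mon p a))\<^sup>2 * (indicator Dm p * Wt p) = (\<Sum>d=0..CARD('n). real (CARD('n) choose d) * \<nu> ^ (CARD('n) - d) * (\<mu> ^ CARD('n) / pi ^ CARD('n + 'm)) * piece d a p)"
proof (cases "p \<in> Dm")
  case True
  then show ?thesis unfolding piece_def by (simp add: weight_expand sum_distrib_left mult_ac)
qed (simp add: piece_def)

text \<open>\<open>Rad\<close> is at least \<open>gap\<close>, so the factor
  \<open>\<nu> + Rad / gap\<close> of the unexpanded density is at least
  \<open>\<nu> + 1\<close>.\<close>

lemma Wt_pos:
  assumes "p \<in> Dm"
  shows "Wt p > 0"
proof -
  have E: "gap \<mu> p > 0" using assms by (simp add: Dom_gap)
  have "gap \<mu> p \<le> Rad \<mu> p" by (simp add: gap_def)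
  then have "1 \<le> Rad \<mu> p / gap \<mu> p" using E by simp
  then have "\<nu> + Rad \<mu> p / gap \<mu> p > 0" using nu by linarith
  then show ?thesis
    unfolding weight_def vol_density_Phi[OF assms] using E mu by (simp add: Rad_def)
qed

sublocale reinhardt_weight Dm Wt
proof
  show "open Dm" by (rule open_Dom)
  show "0 \<in> Dm" by (simp add: Dom_def zpart_def wpart_def zero_vec_def[symmetric])
  show "q \<in> Dm" if p: "p \<in> Dm" and le: "\<And>i. cmod (q $ i) \<le> cmod (p $ i)" for p q
  proof -
    have "(norm (wpart q))\<^sup>2 \<le> (norm (wpart p))\<^sup>2" "(norm (zpart q))\<^sup>2 \<le> (norm (zpart p))\<^sup>2"
      unfolding norm_wpart_sum norm_zpart_sum by (auto intro!: sum_mono power_mono le)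
    moreover from this have "exp (- \<mu> * (norm (zpart p))\<^sup>2) \<le> exp (- \<mu> * (norm (zpart q))\<^sup>2)"
      using mu by simp
    ultimately show ?thesis using p unfolding Dom_def mem_Collect_eq by linarith
  qed
  show "Wt p > 0" if "p \<in> Dm" for p using that by (rule Wt_pos)
  \<comment> \<open>The weight is defined by iterated derivatives; its measurability is read off the
    explicit expansion, with the zero exponent for the monomial.\<close>
  have eq: "(\<lambda>p. indicator Dm p * Wt p) = (\<lambda>p. \<Sum>d=0..CARD('n). real (CARD('n) choose d) * \<nu> ^ (CARD('n) - d) * (\<mu> ^ CARD('n) / pi ^ CARD('n + 'm)) * piece d (\<lambda>_. 0) p)"
    using weight_pieces[of _ "\<lambda>_. 0"] by simp
  show "(\<lambda>p. indicator Dm p * Wt p) \<in> borel_measurable borel"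
    unfolding eq by measurable
  show "Wt q = Wt p" if p: "p \<in> Dm" and e: "\<And>i. cmod (q $ i) = cmod (p $ i)" for p q
  proof -
    have n: "(norm (wpart q))\<^sup>2 = (norm (wpart p))\<^sup>2" "(norm (zpart q))\<^sup>2 = (norm (zpart p))\<^sup>2"
      unfolding norm_wpart_sum norm_zpart_sum by (simp_all add: e)
    then have q: "q \<in> Dm" using p by (simp add: Dom_def)
    have g: "gap \<mu> q = gap \<mu> p" by (simp add: gap_def Rad_def n)
    show ?thesis unfolding weight_expand[OF p] weight_expand[OF q] g n ..
  qed
  show "integrable lborel (\<lambda>p. (cmod (mon p a))\<^sup>2 * (indicator Dm p * Wt p))" for a
    unfolding weight_pieces by (intro Bochner_Integration.integrable_sum integrable_mult_right piece_integral(1)) simp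
qed

definition denom :: "nat \<Rightarrow> real" where
  "denom k = (\<Sum>d=0..CARD('n). real (CARD('n) choose d) * \<nu> ^ (CARD('n) - d) * Gamma (\<alpha> - real CARD('m) - real d) / Gamma (\<alpha> - real d + real k))"

text \<open>The rate is common to all \<open>d\<close>, so the contribution of \<open>z\<close>
  factors out and the sum over \<open>d\<close> becomes \<open>denom\<close>, the denominator of
  \<open>chi\<close>. The powers of pi cancel against the normalisation of the volume
  density.\<close>

lemma N_value:
  "N a = \<mu> ^ CARD('n) * (\<Prod>i\<in>UNIV. fact (a i)) / (\<mu> * rate (wdeg a)) ^ (CARD('n) + zdeg a) * denom (wdeg a)"
proof -
  have "N a = (\<integral>p. (\<Sum>d=0..CARD('n). real (CARD('n) choose d) * \<nu> ^ (CARD('n) - d) * (\<mu> ^ CARD('n) / pi ^ CARD('n + 'm)) * piece d a p) \<partial>lborel)"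
    unfolding N_def V_def weight_pieces ..
  also have "\<dots> = (\<Sum>d=0..CARD('n). \<integral>p. real (CARD('n) choose d) * \<nu> ^ (CARD('n) - d) * (\<mu> ^ CARD('n) / pi ^ CARD('n + 'm)) * piece d a p \<partial>lborel)"
    by (intro Bochner_Integration.integral_sum integrable_mult_right piece_integral(1)) simp
  also have "\<dots> = (\<Sum>d=0..CARD('n). real (CARD('n) choose d) * \<nu> ^ (CARD('n) - d) * (\<mu> ^ CARD('n) / pi ^ CARD('n + 'm)) * piece_val d a)"
    by (intro sum.cong refl) (simp add: piece_integral(2))
  also have "\<dots> = (\<Sum>d=0..CARD('n). \<mu> ^ CARD('n) * (\<Prod>i\<in>UNIV. fact (a i)) / (\<mu> * rate (wdeg a)) ^ (CARD('n) + zdeg a)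
      * (real (CARD('n) choose d) * \<nu> ^ (CARD('n) - d) * Gamma (\<alpha> - real CARD('m) - real d) / Gamma (\<alpha> - real d + real (wdeg a))))"
    unfolding piece_val_def by (intro sum.cong refl) (simp add: mult_ac)
  also have "\<dots> = \<mu> ^ CARD('n) * (\<Prod>i\<in>UNIV. fact (a i)) / (\<mu> * rate (wdeg a)) ^ (CARD('n) + zdeg a) * denom (wdeg a)"
    unfolding denom_def sum_distrib_left ..
  finally show ?thesis .
qed

text \<open>After cutting, the integrand is Borel, and then integrals over \<open>lebesgue\<close>
  and \<open>lborel\<close> agree.\<close>

lemma inH_iff_L2: "inH \<mu> \<nu> \<alpha> f \<longleftrightarrow> L2 (f :: complex^('n + 'm) \<Rightarrow> complex)"
proof (cases "holo_on Dm f")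
  case True
  then have [measurable]: "cut f \<in> borel_measurable borel" by (rule cut_measurable)
  have "(\<integral>\<^sup>+p. indicator Dm p * ennreal ((cmod (f p))\<^sup>2 * Wt p) \<partial>lebesgue) = (\<integral>\<^sup>+p. ennreal ((cmod (cut f p))\<^sup>2 * V p) \<partial>lebesgue)"
    by (intro nn_integral_cong) (auto simp: cut_def V_def split: split_indicator)
  also have "\<dots> = (\<integral>\<^sup>+p. ennreal ((cmod (cut f p))\<^sup>2 * V p) \<partial>lborel)"
    by (rule nn_integral_completion) measurable
  finally show ?thesis unfolding inH_def L2_def cut_V by simp
qed (simp add: inH_def L2_def)

lemma set_integral_eq:
  assumes "holo_on Dm f" "holo_on Dm g"
  shows "set_lebesgue_integral lebesgue Dm (\<lambda>p. Wt p *\<^sub>R (f p * cnj (g p))) = (\<integral>p. V p *\<^sub>R (f p * cnj (g p)) \<partial>lborel)"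
proof -
  have [measurable]: "cut f \<in> borel_measurable borel" "cut g \<in> borel_measurable borel" using assms by (auto intro: cut_measurable)
  have "set_lebesgue_integral lebesgue Dm (\<lambda>p. Wt p *\<^sub>R (f p * cnj (g p))) = (\<integral>p. V p *\<^sub>R (cut f p * cnj (cut g p)) \<partial>lebesgue)"
    unfolding set_lebesgue_integral_def
    by (intro Bochner_Integration.integral_cong refl) (auto simp: cut_def V_def split: split_indicator)
  also have "\<dots> = (\<integral>p. V p *\<^sub>R (cut f p * cnj (cut g p)) \<partial>lborel)"
    by (rule integral_completion) measurable
  also have "\<dots> = (\<integral>p. V p *\<^sub>R (f p * cnj (g p)) \<partial>lborel)"
    by (intro Bochner_Integration.integral_cong refl) (auto simp: cut_def V_def split: split_indicator)
  finally show ?thesis .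
qed

lemma K_bergman: "is_bergman_kernel \<mu> \<nu> \<alpha> K"
  unfolding is_bergman_kernel_def inH_iff_L2
proof (intro ballI conjI allI impI)
  fix q :: "complex^('n + 'm)" and f :: "complex^('n + 'm) \<Rightarrow> complex"
  assume q: "q \<in> Dm"
  show "L2 (\<lambda>p. K p q)" by (rule K_L2[OF q])
  assume f: "L2 f"
  then show "f q = set_lebesgue_integral lebesgue Dm (\<lambda>p. Wt p *\<^sub>R (f p * cnj (K p q)))"
    using K_reproducing[OF f q] K_holo[OF q] by (simp add: set_integral_eq L2_def)
qed

section \<open>Uniqueness of the kernel\<close>

lemma bergman_inH:
  assumes "is_bergman_kernel \<mu> \<nu> \<alpha> A" "q \<in> Dm"
  shows "inH \<mu> \<nu> \<alpha> (\<lambda>p. A p q)"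
  using assms(1)[unfolded is_bergman_kernel_def, THEN bspec, OF assms(2)] by (rule conjunct1)

lemma bergman_reproducing:
  assumes "is_bergman_kernel \<mu> \<nu> \<alpha> A" "q \<in> Dm" "inH \<mu> \<nu> \<alpha> f"
  shows "f q = set_lebesgue_integral lebesgue Dm (\<lambda>p. Wt p *\<^sub>R (f p * cnj (A p q)))"
  by (rule assms(1)[unfolded is_bergman_kernel_def, THEN bspec, OF assms(2), THEN conjunct2, THEN spec, THEN mp, OF assms(3)])

text \<open>The section of \<open>A\<close> at \<open>p\<close> is reproduced at \<open>q\<close> by
  \<open>B\<close>, and the section of \<open>B\<close> at \<open>q\<close> is reproduced at
  \<open>p\<close> by \<open>A\<close>. The two integrals are conjugate to each other.\<close>

lemma bergman_swap:
  fixes A B :: "complex^('n + 'm) \<Rightarrow> complex^('n + 'm) \<Rightarrow> complex"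
  assumes A: "is_bergman_kernel \<mu> \<nu> \<alpha> A" and B: "is_bergman_kernel \<mu> \<nu> \<alpha> B" and pq: "p \<in> Dm" "q \<in> Dm"
  shows "A q p = cnj (B p q)"
proof -
  let ?I = "\<lambda>f g. set_lebesgue_integral lebesgue Dm (\<lambda>x. Wt x *\<^sub>R (f x * cnj (g x)))"
  have "A q p = ?I (\<lambda>x. A x p) (\<lambda>x. B x q)"
    by (rule bergman_reproducing[OF B pq(2) bergman_inH[OF A pq(1)]])
  also have "\<dots> = cnj (?I (\<lambda>x. B x q) (\<lambda>x. A x p))"
    unfolding set_lebesgue_integral_def
    by (rule trans[OF _ Bochner_Integration.integral_cnj], intro Bochner_Integration.integral_cong refl) (simp add: mult.commute)
  also have "?I (\<lambda>x. B x q) (\<lambda>x. A x p) = B p q"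
    by (rule bergman_reproducing[OF A pq(1) bergman_inH[OF B pq(2)], symmetric])
  finally show ?thesis .
qed

text \<open>Swapping \<open>A\<close> with \<open>K\<close> gives the conjugate of
  \<open>K p p\<close>, and swapping \<open>K\<close> with itself shows that \<open>K p p\<close> is
  real.\<close>

lemma bergman_unique_diagonal:
  assumes A: "is_bergman_kernel \<mu> \<nu> \<alpha> A" and p: "p \<in> Dm"
  shows "A p p = K p p"
  using bergman_swap[OF A K_bergman p p] bergman_swap[OF K_bergman K_bergman p p] by simp

text \<open>A multi-index is split into its \<open>w\<close> part \<open>q\<close> and its
  \<open>z\<close> part \<open>b\<close>. For fixed \<open>q\<close> the sum over \<open>b\<close>
  is a product of exponential series with total exponent \<open>\<mu> * rate * norm z ^ 2\<close>.
  Of the power \<open>n + zdeg\<close> of \<open>\<mu> * rate\<close> in \<open>N_value\<close>, the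
  \<open>n\<close> surplus factors leave \<open>rate ^ n\<close>, because \<open>\<mu> ^ n\<close>
  cancels.\<close>

lemma diagonal_has_sum:
  assumes p: "p \<in> Dm"
  shows "((\<lambda>q. complex_of_real (rate (\<Sum>i\<in>UNIV. q i) ^ CARD('n) * exp (\<mu> * rate (\<Sum>i\<in>UNIV. q i) * (norm (zpart p))\<^sup>2)
      * (\<Prod>j\<in>UNIV. ((cmod (wpart p $ j))\<^sup>2) ^ q j) / ((\<Prod>j\<in>UNIV. fact (q j)) * denom (\<Sum>i\<in>UNIV. q i)))) has_sum K p p) UNIV"
proof -
  let ?F = "\<lambda>a. mon p a * (cnj (mon p a) / N a)"
  let ?c = "\<lambda>q. rate (\<Sum>i\<in>(UNIV :: 'm set). q i)"
  let ?C = "\<lambda>q. ?c q ^ CARD('n) * (\<Prod>j\<in>UNIV. ((cmod (wpart p $ j))\<^sup>2) ^ q j) / ((\<Prod>j\<in>UNIV. fact (q j)) * denom (\<Sum>i\<in>UNIV. q i))"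
  let ?g = "\<lambda>q i k. (\<mu> * ?c q * (cmod (zpart p $ i))\<^sup>2) ^ k / fact k"
  have bij: "bij_betw (\<lambda>(q, b). case_sum b q) (UNIV \<times> UNIV) (UNIV :: ('n + 'm \<Rightarrow> nat) set)"
    by (rule bij_betwI[where g="\<lambda>a. (a \<circ> Inr, a \<circ> Inl)"]) (auto simp: fun_eq_iff split: sum.splits)
  have "(?F has_sum K p p) UNIV" by (rule K_has_sum[OF p p])
  then have "((\<lambda>x. ?F (case x of (q, b) \<Rightarrow> case_sum b q)) has_sum K p p) (UNIV \<times> UNIV)"
    by (subst has_sum_reindex_bij_betw[OF bij])
  moreover have summand: "?F (case_sum b q) = of_real (?C q * (\<Prod>i\<in>UNIV. ?g q i (b i)))" for q b
  proof -
    have mu0: "\<mu> \<noteq> 0" "?c q \<noteq> 0" using mu rate_pos[of "\<Sum>i\<in>UNIV. q i"] by auto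
    have deg: "wdeg (case_sum b q) = (\<Sum>i\<in>UNIV. q i)" "zdeg (case_sum b q) = (\<Sum>i\<in>UNIV. b i)"
      by (simp_all add: sum.reindex)
    have split: "(\<Prod>i\<in>UNIV. h i) = (\<Prod>i\<in>UNIV. h (Inl i)) * (\<Prod>j\<in>UNIV. h (Inr j))" for h :: "'n + 'm \<Rightarrow> real"
      by (subst UNIV_sum, subst prod.union_disjoint) (auto simp: prod.reindex)
    have m2: "(cmod (mon p (case_sum b q)))\<^sup>2 = (\<Prod>i\<in>UNIV. ((cmod (zpart p $ i))\<^sup>2) ^ b i) * (\<Prod>j\<in>UNIV. ((cmod (wpart p $ j))\<^sup>2) ^ q j)"
      unfolding cmod_mon split power_mult_distrib prod_power_distrib
      by (simp add: zpart_def wpart_def power_mult[symmetric] mult.commute[of 2])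
    have Nv: "N (case_sum b q) = \<mu> ^ CARD('n) * ((\<Prod>i\<in>UNIV. fact (b i)) * (\<Prod>j\<in>UNIV. fact (q j))) / (\<mu> * ?c q) ^ (CARD('n) + (\<Sum>i\<in>UNIV. b i)) * denom (\<Sum>i\<in>UNIV. q i)"
      unfolding N_value deg split by simp
    have "?F (case_sum b q) = of_real ((cmod (mon p (case_sum b q)))\<^sup>2 / N (case_sum b q))"
      by (simp add: complex_norm_square del: of_real_power)
    also have "(cmod (mon p (case_sum b q)))\<^sup>2 / N (case_sum b q)
       = ?C q * ((\<mu> * ?c q) ^ (\<Sum>i\<in>UNIV. b i) * (\<Prod>i\<in>UNIV. ((cmod (zpart p $ i))\<^sup>2) ^ b i) / (\<Prod>i\<in>UNIV. fact (b i)))"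
      unfolding m2 Nv using mu0 by (simp add: power_add power_mult_distrib field_simps)
    also have "(\<mu> * ?c q) ^ (\<Sum>i\<in>UNIV. b i) * (\<Prod>i\<in>UNIV. ((cmod (zpart p $ i))\<^sup>2) ^ b i) / (\<Prod>i\<in>UNIV. fact (b i)) = (\<Prod>i\<in>UNIV. ?g q i (b i))"
      by (simp add: power_sum prod.distrib prod_dividef power_mult_distrib)
    finally show ?thesis .
  qed
  ultimately have "((\<lambda>(q, b). complex_of_real (?C q * (\<Prod>i\<in>UNIV. ?g q i (b i)))) has_sum K p p) (UNIV \<times> UNIV)"
    by (simp add: case_prod_unfold)
  moreover have "((\<lambda>b. complex_of_real (?C q * (\<Prod>i\<in>UNIV. ?g q i (b i)))) has_sum of_real (?C q * exp (\<mu> * ?c q * (norm (zpart p))\<^sup>2))) UNIV" for q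
  proof -
    have abs: "(\<lambda>k. norm (?g q i k)) summable_on UNIV" for i
      using summable_norm_exp[of "\<mu> * ?c q * (cmod (zpart p $ i))\<^sup>2"]
      by (intro norm_summable_imp_summable_on) (simp add: scaleR_conv_of_real divide_inverse mult.commute)
    have inf: "infsum (?g q i) UNIV = exp (\<mu> * ?c q * (cmod (zpart p $ i))\<^sup>2)" for i
    proof (rule sums_unique2)
      show "?g q i sums exp (\<mu> * ?c q * (cmod (zpart p $ i))\<^sup>2)"
        using exp_converges[of "\<mu> * ?c q * (cmod (zpart p $ i))\<^sup>2"] by (simp add: divide_inverse mult.commute)
      show "?g q i sums infsum (?g q i) UNIV"
        using abs_summable_summable[OF abs] by (intro has_sum_imp_sums has_sum_infsum)
    qed
    have "((\<lambda>b. \<Prod>i\<in>UNIV. ?g q i (b i)) has_sum (\<Prod>i\<in>UNIV. infsum (?g q i) UNIV)) UNIV"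
      by (rule has_sum_prod_fun[OF abs])
    also have "(\<Prod>i\<in>UNIV. infsum (?g q i) UNIV) = exp (\<mu> * ?c q * (norm (zpart p))\<^sup>2)"
      unfolding inf by (simp add: exp_sum[symmetric] sum_distrib_left[symmetric] norm_vec_def L2_set_def sum_nonneg)
    finally show ?thesis by (intro has_sum_of_real has_sum_cmult_right)
  qed
  ultimately have "((\<lambda>q. complex_of_real (?C q * exp (\<mu> * ?c q * (norm (zpart p))\<^sup>2))) has_sum K p p) UNIV"
    by (rule has_sum_SigmaD[of "\<lambda>(q, b). complex_of_real (?C q * (\<Prod>i\<in>UNIV. ?g q i (b i)))", unfolded prod.case])
  then show ?thesis by (simp add: mult_ac)
qed

text \<open>The powers of \<open>exp (\<mu> / 2 * norm z ^ 2)\<close> inside \<open>wt\<close>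
  supply the part of \<open>rate\<close> that depends on the degree, and the exponential prefactor
  supplies \<open>(\<nu> + 1) * \<alpha>\<close>. The Gamma values at \<open>\<alpha>\<close>,
  \<open>\<alpha> - m - n\<close> and \<open>\<alpha> + k q\<close> cancel between the Pochhammer
  symbol, \<open>psi\<close> and the multinomial factor, leaving \<open>chi\<close> over the product
  of factorials.\<close>

lemma summand_eq:
  fixes p :: "complex^('n + 'm)"
  defines "wt \<equiv> exp (\<mu> / 2 * norm (zpart p) ^ 2) *\<^sub>R wpart p"
  defines "k \<equiv> \<lambda>q. \<Sum>i\<in>(UNIV :: 'm set). q i"
  shows "complex_of_real
          ((Gamma \<alpha> / Gamma (\<alpha> - real (CARD('m) + CARD('n)))) * exp (\<mu> * (\<nu> + 1) * \<alpha> * norm (zpart p) ^ 2) *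
           psi CARD('n) CARD('m) \<nu> \<alpha> (k q) * (Gamma (real (k q) + \<alpha>) / (Gamma \<alpha> * (\<Prod>i\<in>UNIV. Gamma (real (q i) + 1)))))
        * ((\<Prod>j\<in>UNIV. (wt $ j) ^ q j) * cnj (\<Prod>j\<in>UNIV. (wt $ j) ^ q j))
     = complex_of_real (rate (k q) ^ CARD('n) * exp (\<mu> * rate (k q) * (norm (zpart p))\<^sup>2)
      * (\<Prod>j\<in>UNIV. ((cmod (wpart p $ j))\<^sup>2) ^ q j) / ((\<Prod>j\<in>UNIV. fact (q j)) * denom (k q)))"
proof -
  let ?t = "(norm (zpart p))\<^sup>2"
  have G: "Gamma \<alpha> \<noteq> 0" "Gamma (\<alpha> - real CARD('m) - real CARD('n)) \<noteq> 0" "Gamma (\<alpha> + real (k q)) \<noteq> 0"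
    using Gamma_real_pos[OF alpha_pos] Gamma_real_pos[of "\<alpha> - real CARD('m) - real CARD('n)"]
      Gamma_real_pos[of "\<alpha> + real (k q)"] alpha alpha_pos by (simp_all add: less_imp_neq[symmetric] add_pos_nonneg)
  have fact: "Gamma (real n + 1) = fact n" for n
    using Gamma_fact[of n, where 'a=real] by (simp add: add.commute)
  have chi: "chi CARD('n) CARD('m) \<nu> \<alpha> (k q) = rate (k q) ^ CARD('n) / denom (k q)"
    by (simp add: chi_def rate_def denom_def)
  have "(\<Prod>j\<in>UNIV. (wt $ j) ^ q j) * cnj (\<Prod>j\<in>UNIV. (wt $ j) ^ q j) = of_real ((cmod (\<Prod>j\<in>UNIV. (wt $ j) ^ q j))\<^sup>2)"
    by (rule complex_norm_square[symmetric])
  also have "(cmod (\<Prod>j\<in>UNIV. (wt $ j) ^ q j))\<^sup>2 = (\<Prod>j\<in>UNIV. ((cmod (wt $ j))\<^sup>2) ^ q j)"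
    by (simp only: prod_norm[symmetric] norm_power prod_power_distrib power_mult[symmetric] mult.commute[of 2])
  also have "\<dots> = (\<Prod>j\<in>UNIV. exp (\<mu> * ?t) ^ q j * ((cmod (wpart p $ j))\<^sup>2) ^ q j)"
  proof (intro prod.cong refl)
    fix j
    have "(exp (\<mu> / 2 * ?t))\<^sup>2 = exp (\<mu> * ?t)" by (simp flip: exp_double)
    then have "(cmod (wt $ j))\<^sup>2 = exp (\<mu> * ?t) * (cmod (wpart p $ j))\<^sup>2"
      by (simp add: wt_def power_mult_distrib)
    then show "((cmod (wt $ j))\<^sup>2) ^ q j = exp (\<mu> * ?t) ^ q j * ((cmod (wpart p $ j))\<^sup>2) ^ q j"
      by (simp only: power_mult_distrib)
  qed
  also have "\<dots> = exp (\<mu> * ?t * real (k q)) * (\<Prod>j\<in>UNIV. ((cmod (wpart p $ j))\<^sup>2) ^ q j)"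
    unfolding prod.distrib power_sum[symmetric] k_def by (simp add: exp_of_nat_mult[symmetric] mult.commute)
  finally have w: "(\<Prod>j\<in>UNIV. (wt $ j) ^ q j) * cnj (\<Prod>j\<in>UNIV. (wt $ j) ^ q j)
     = of_real (exp (\<mu> * ?t * real (k q)) * (\<Prod>j\<in>UNIV. ((cmod (wpart p $ j))\<^sup>2) ^ q j))" .
  have e: "exp (\<mu> * rate (k q) * ?t) = exp (\<mu> * (\<nu> + 1) * \<alpha> * ?t) * exp (\<mu> * ?t * real (k q))"
    by (simp add: rate_def algebra_simps flip: exp_add)
  show ?thesis
    unfolding w e psi_def chi fact of_real_mult[symmetric] of_real_eq_iff
    using G by (simp add: add.commute[of "real (k q)"] diff_diff_eq mult_ac)
qed

end

theorem theorem2p6: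
  fixes \<mu> \<nu> \<alpha> :: real
  assumes "\<mu> > 0" and "\<nu> > -1" and "\<alpha> > real (CARD('n::finite) + CARD('m::finite))"
  shows "(\<exists>K. is_bergman_kernel \<mu> \<nu> \<alpha> (K :: complex^('n + 'm) \<Rightarrow> complex^('n + 'm) \<Rightarrow> complex)) \<and>
    (\<forall>K :: complex^('n + 'm) \<Rightarrow> complex^('n + 'm) \<Rightarrow> complex. is_bergman_kernel \<mu> \<nu> \<alpha> K \<longrightarrow>
      (\<forall>p\<in>Dom \<mu>.
        let n = CARD('n); m = CARD('m); z = zpart p;
            wt = exp (\<mu> / 2 * norm z ^ 2) *\<^sub>R wpart p
        in ((\<lambda>q::'m \<Rightarrow> nat.
              complex_of_real
                ((Gamma \<alpha> / Gamma (\<alpha> - real (m + n))) * exp (\<mu> * (\<nu> + 1) * \<alpha> * norm z ^ 2) *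
                 psi n m \<nu> \<alpha> (\<Sum>i\<in>UNIV. q i) *
                 (Gamma (real (\<Sum>i\<in>UNIV. q i) + \<alpha>) / (Gamma \<alpha> * (\<Prod>i\<in>UNIV. Gamma (real (q i) + 1)))))
              * ((\<Prod>j\<in>UNIV. (wt $ j) ^ q j) * cnj (\<Prod>j\<in>UNIV. (wt $ j) ^ q j)))
            has_sum K p p) UNIV))"
proof -
  interpret Hartogs \<mu> \<nu> \<alpha> "TYPE('n \<times> 'm)" by (rule Hartogs.intro) fact+
  show ?thesis
    unfolding Let_def summand_eq
  proof (intro conjI exI allI impI ballI)
    show "is_bergman_kernel \<mu> \<nu> \<alpha> K" by (rule K_bergman)
    fix A :: "complex^('n + 'm) \<Rightarrow> complex^('n + 'm) \<Rightarrow> complex" and p :: "complex^('n + 'm)"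
    assume "is_bergman_kernel \<mu> \<nu> \<alpha> A" and p: "p \<in> Dom \<mu>"
    then have "A p p = K p p" by (rule bergman_unique_diagonal)
    with diagonal_has_sum[OF p] show "((\<lambda>q. complex_of_real (rate (\<Sum>i\<in>UNIV. q i) ^ CARD('n) * exp (\<mu> * rate (\<Sum>i\<in>UNIV. q i) * (norm (zpart p))\<^sup>2)
      * (\<Prod>j\<in>UNIV. ((cmod (wpart p $ j))\<^sup>2) ^ q j) / ((\<Prod>j\<in>UNIV. fact (q j)) * denom (\<Sum>i\<in>UNIV. q i)))) has_sum A p p) UNIV"
      by simp
  qed
qed

end
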